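(* Let $X$ be a Banach lattice and let $A$ and $B$ be positive operators on $X$ such that $A \leq B$, $B$ is band irreducible, and $\rho(A) = \rho(B) > 0$. Assume additionally that at least one of the following conditions is satisfied. (a) The sequential Lorentz seminorm $l$ is a norm on $X$, $B$ is $\sigma$-order continuous, and $\rho(B)$ is a pole of the resolvent $R(\lambda,B)$. (b) The sequential Lorentz seminorm $l$ is a norm on $X$, $B$ is $\sigma$-order continuous, $\rho(A)$ is a pole of the resolvent $R(\lambda,A)$, and the corresponding spectral subspace of $A$ is finite dimensional. (c) The operator $B$ is weakly compact and $\sigma$-order continuous, and $\rho(B)$ is a pole of the resolvent $R(\lambda,B)$. (d) The operator $A$ is band irreducible and weakly compact, and $\rho(A)$ is a pole of the resolvent $R(\lambda,A)$. The operator $B$ is $\sigma$-order continuous. Then $A = B$.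
   Context: For a bounded operator $T$ on a Banach lattice, $\rho(T)$ denotes its spectral radius and $R(\lambda,T) = (\lambda I - T)^{-1}$ its resolvent (spectral notions are taken in the complexification if the lattice is real). For operators, $A \le B$ means that $B-A$ is positive. A positive operator $T$ on $X$ is band irreducible if it leaves invariant no band of $X$ other than $\{0\}$ and $X$. A positive operator $T$ on $X$ is $\sigma$-order continuous if for every sequence $\{x_n\} \subset X$ with $x_n \downarrow 0$ one has $Tx_n \downarrow 0$. The sequential Lorentz seminorm $l$ on $X$ is defined by $$l(x) = \inf_{x_n \uparrow |x|} \ \lim_{n} \|x_n\|, \quad x \in X,$$ where the infimum is taken over all sequences $\{x_n\} \subset X$ such that $x_n \geq 0$ and $x_n \uparrow |x|$ (i.e. the sequence is increasing with supremum $|x|$). *)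

theory Defs
  imports
    "HOL-Analysis.Analysis"
    "HOL-Library.Lattice_Algebras"
    "HOL-Library.Lub_Glb"
begin

section \<open>Banach lattices\<close>

class banach_lattice = banach + ordered_real_vector + lattice_ab_group_add_abs +
  assumes norm_mono_abs: "\<bar>x\<bar> \<le> \<bar>y\<bar> \<Longrightarrow> norm x \<le> norm y"

instance real :: banach_lattice
  by standard simp

definition order_ideal :: "'a::banach_lattice set \<Rightarrow> bool" where
  "order_ideal I \<longleftrightarrow> subspace I \<and> (\<forall>x\<in>I. \<forall>y. \<bar>y\<bar> \<le> \<bar>x\<bar> \<longrightarrow> y \<in> I)"

definition band :: "'a::banach_lattice set \<Rightarrow> bool" where
  "band I \<longleftrightarrow> order_ideal I \<and> (\<forall>D x. D \<subseteq> I \<and> isLub UNIV D x \<longrightarrow> x \<in> I)"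

definition seq_increases_to :: "(nat \<Rightarrow> 'a::banach_lattice) \<Rightarrow> 'a \<Rightarrow> bool" where
  "seq_increases_to s x \<longleftrightarrow> incseq s \<and> isLub UNIV (range s) x"

definition seq_decreases_to :: "(nat \<Rightarrow> 'a::banach_lattice) \<Rightarrow> 'a \<Rightarrow> bool" where
  "seq_decreases_to s x \<longleftrightarrow> decseq s \<and> isGlb UNIV (range s) x"

text \<open>The limit below exists: the norms increase and are bounded by \<open>norm x\<close>.\<close>

definition lorentz_seminorm :: "'a::banach_lattice \<Rightarrow> real" where
  "lorentz_seminorm x =
     (INF s \<in> {s. (\<forall>n. 0 \<le> s n) \<and> seq_increases_to s \<bar>x\<bar>}. lim (\<lambda>n. norm (s n)))"

definition is_norm :: "('a::real_vector \<Rightarrow> real) \<Rightarrow> bool" where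
  "is_norm p \<longleftrightarrow>
     (\<forall>x. 0 \<le> p x) \<and> (\<forall>x. p x = 0 \<longleftrightarrow> x = 0) \<and>
     (\<forall>c x. p (c *\<^sub>R x) = \<bar>c\<bar> * p x) \<and> (\<forall>x y. p (x + y) \<le> p x + p y)"

section \<open>Operators on a Banach lattice\<close>

text \<open>
  Every positive linear operator on a Banach lattice is bounded, so nothing is lost by
  working with bounded operators throughout.
\<close>

definition positive_op :: "('a::banach_lattice \<Rightarrow>\<^sub>L 'a) \<Rightarrow> bool" where
  "positive_op T \<longleftrightarrow> (\<forall>x\<ge>0. 0 \<le> blinfun_apply T x)"

definition band_irreducible :: "('a::banach_lattice \<Rightarrow>\<^sub>L 'a) \<Rightarrow> bool" where
  "band_irreducible T \<longleftrightarrow> positive_op T \<and>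
     (\<forall>I. band I \<and> blinfun_apply T ` I \<subseteq> I \<longrightarrow> I = {0} \<or> I = UNIV)"

definition sigma_order_continuous :: "('a::banach_lattice \<Rightarrow>\<^sub>L 'a) \<Rightarrow> bool" where
  "sigma_order_continuous T \<longleftrightarrow> positive_op T \<and>
     (\<forall>s. seq_decreases_to s 0 \<longrightarrow> seq_decreases_to (\<lambda>n. blinfun_apply T (s n)) 0)"

definition weak_topology :: "'a::real_normed_vector topology" where
  "weak_topology =
     pullback_topology UNIV (\<lambda>x. \<lambda>\<phi>::'a \<Rightarrow>\<^sub>L real. blinfun_apply \<phi> x) euclidean"

definition weakly_compact_op :: "('a::real_normed_vector \<Rightarrow>\<^sub>L 'b::real_normed_vector) \<Rightarrow> bool" where
  "weakly_compact_op T \<longleftrightarrow>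
     compactin weak_topology (weak_topology closure_of (blinfun_apply T ` cball 0 1))"

section \<open>Spectral theory in the complexification\<close>

text \<open>
  The complexification of a real Banach space is \<open>'a \<times> 'a\<close>, where \<open>(x, y)\<close> stands for
  \<open>x + \<i> y\<close>. The product norm is equivalent to the usual complexification norms, in
  particular to the norm of the modulus \<open>\<bar>x + \<i> y\<bar>\<close>, and everything below depends only
  on the topology. Bounded operators on the complexification are real-linear operators on
  \<open>'a \<times> 'a\<close>; the inverses, Laurent coefficients and integrals formed below from
  complex-linear operators are again complex-linear.
\<close>

lift_definition complexify :: "('a::banach \<Rightarrow>\<^sub>L 'a) \<Rightarrow> (('a \<times> 'a) \<Rightarrow>\<^sub>L ('a \<times> 'a))"
  is "\<lambda>T v. (T (fst v), T (snd v))"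
  by (intro bounded_linear_Pair bounded_linear_compose[OF _ bounded_linear_fst]
      bounded_linear_compose[OF _ bounded_linear_snd])

text \<open>
  Multiplication by a complex scalar; for an operator \<open>S\<close> on the complexification, the
  scalar multiple of \<open>S\<close> by \<open>c\<close> is \<open>cmul c o\<^sub>L S\<close>.
\<close>

lift_definition cmul :: "complex \<Rightarrow> (('a::banach \<times> 'a) \<Rightarrow>\<^sub>L ('a \<times> 'a))"
  is "\<lambda>c v. (Re c *\<^sub>R fst v - Im c *\<^sub>R snd v, Im c *\<^sub>R fst v + Re c *\<^sub>R snd v)"
  by (intro bounded_linear_Pair bounded_linear_add bounded_linear_sub
      bounded_linear_compose[OF bounded_linear_scaleR_right bounded_linear_fst]
      bounded_linear_compose[OF bounded_linear_scaleR_right bounded_linear_snd])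

interpretation complexification: vector_space "\<lambda>c. blinfun_apply (cmul c :: ('a::banach \<times> 'a) \<Rightarrow>\<^sub>L _)"
  by standard (transfer; auto simp: algebra_simps)+

definition is_resolvent_at ::
    "('a::banach \<Rightarrow>\<^sub>L 'a) \<Rightarrow> complex \<Rightarrow> (('a \<times> 'a) \<Rightarrow>\<^sub>L ('a \<times> 'a)) \<Rightarrow> bool" where
  "is_resolvent_at T z S \<longleftrightarrow>
     S o\<^sub>L (cmul z - complexify T) = id_blinfun \<and> (cmul z - complexify T) o\<^sub>L S = id_blinfun"

definition resolvent_set :: "('a::banach \<Rightarrow>\<^sub>L 'a) \<Rightarrow> complex set" where
  "resolvent_set T = {z. \<exists>S. is_resolvent_at T z S}"

definition resolvent :: "complex \<Rightarrow> ('a::banach \<Rightarrow>\<^sub>L 'a) \<Rightarrow> (('a \<times> 'a) \<Rightarrow>\<^sub>L ('a \<times> 'a))" where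
  "resolvent z T = (THE S. is_resolvent_at T z S)"

definition spectrum :: "('a::banach \<Rightarrow>\<^sub>L 'a) \<Rightarrow> complex set" where
  "spectrum T = - resolvent_set T"

definition spectral_radius :: "('a::banach \<Rightarrow>\<^sub>L 'a) \<Rightarrow> real" where
  "spectral_radius T = (SUP z\<in>spectrum T. cmod z)"

text \<open>
  A pole of order \<open>m \<ge> 1\<close>: near \<open>z\<close>, the resolvent has a Laurent expansion whose lowest
  nonzero term has exponent \<open>- m\<close>. The library's \<open>is_pole\<close> only requires the norm to
  tend to infinity. This would not do here, as the norm of the resolvent tends to infinity
  at every isolated point of the spectrum, also at essential singularities.
\<close>

definition is_resolvent_pole :: "('a::banach \<Rightarrow>\<^sub>L 'a) \<Rightarrow> complex \<Rightarrow> bool" where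
  "is_resolvent_pole T z \<longleftrightarrow>
     (\<exists>m>0. \<exists>C. C 0 \<noteq> 0 \<and>
        (\<forall>\<^sub>F w in at z. w \<in> resolvent_set T \<and>
           (\<lambda>k. cmul ((w - z) powi (int k - int m)) o\<^sub>L C k) sums resolvent w T))"

text \<open>
  The operator \<open>1 / (2 \<pi> \<i>) \<integral> R(w, T) dw\<close>, the integral being taken once counterclockwise
  around the circle \<open>w = z + r e\<^sup>i\<^sup>t\<close>. At an isolated point \<open>z\<close> of the spectrum it is the
  same for all sufficiently small \<open>r\<close>, and it is the spectral projection of \<open>T\<close> at \<open>z\<close>.
\<close>

definition circle_resolvent_integral ::
    "('a::banach \<Rightarrow>\<^sub>L 'a) \<Rightarrow> complex \<Rightarrow> real \<Rightarrow> (('a \<times> 'a) \<Rightarrow>\<^sub>L ('a \<times> 'a))" where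
  "circle_resolvent_integral T z r =
     (1 / (2 * pi)) *\<^sub>R
       integral {0..2 * pi}
         (\<lambda>t. cmul (of_real r * cis t) o\<^sub>L resolvent (z + of_real r * cis t) T)"

definition spectral_projection ::
    "('a::banach \<Rightarrow>\<^sub>L 'a) \<Rightarrow> complex \<Rightarrow> (('a \<times> 'a) \<Rightarrow>\<^sub>L ('a \<times> 'a))" where
  "spectral_projection T z =
     (THE P. \<forall>\<^sub>F r in at_right 0. circle_resolvent_integral T z r = P)"

definition spectral_subspace :: "('a::banach \<Rightarrow>\<^sub>L 'a) \<Rightarrow> complex \<Rightarrow> ('a \<times> 'a) set" where
  "spectral_subspace T z = range (blinfun_apply (spectral_projection T z))"

definition complex_finite_dim :: "('a::banach \<times> 'a) set \<Rightarrow> bool" where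
  "complex_finite_dim V \<longleftrightarrow> (\<exists>S. finite S \<and> V = complexification.span S)"

end

theory Submission
  imports Defs
begin

text \<open>
  Let \<open>r\<close> be the common spectral radius and \<open>D = B - A \<ge> 0\<close>. The proof works with the resolvents
  \<open>R(l, A)\<close> and \<open>R(l, B)\<close> at real points \<open>l > r\<close>, where both are positive. Four ideas carry it.

  \<^bold>\<open>Weak units.\<close> If \<open>e > 0\<close> and \<open>B e \<le> c e\<close>, then \<open>\<sigma>\<close>-order continuity makes the principal band of
  \<open>e\<close> invariant under \<open>B\<close>, so this band is the whole space
  (\<open>irreducible_weak_unit\<close>). A \<open>\<sigma>\<close>-order continuous operator that kills such an \<open>e\<close> is zero
  (\<open>weak_unit_sigma_oc_eq_0\<close>). In particular \<open>R(l, B) x\<close> is a weak unit for every \<open>x > 0\<close>, and a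
  nonzero \<open>\<sigma>\<close>-order continuous \<open>Q \<ge> 0\<close> with \<open>Q B = r Q\<close> is strictly positive
  (\<open>left_eigenoperator_strictly_positive\<close>).

  \<^bold>\<open>Leading Laurent coefficients.\<close> At a pole of order \<open>m\<close> the leading coefficient is the limit
  of \<open>(l - r)\<^sup>m R(l)\<close> as \<open>l\<close> decreases to \<open>r\<close>; it is positive, nonzero, and absorbs the operator up
  to the factor \<open>r\<close>. It is \<open>\<sigma>\<close>-order continuous in each of the four cases: if the Lorentz
  seminorm is a norm, then norm limits of \<open>\<sigma>\<close>-order continuous operators are \<open>\<sigma>\<close>-order continuous
  (\<open>sigma_oc_norm_limit\<close>), and if the operator is weakly compact, then it sends sequences
  decreasing to zero to norm null sequences (\<open>weakly_compact_sigma_oc_norm_null\<close>). For a band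
  irreducible operator the coefficient is then strictly positive, and this makes the pole
  simple and the eigenspace one-dimensional (\<open>irreducible_leading_coefficient\<close>).

  \<^bold>\<open>A pole of the larger operator\<close> (conditions (a) and (c), \<open>eq_if_pole_of_larger\<close>). Let \<open>P\<close> be the
  spectral projection of \<open>B\<close>, with range spanned by \<open>u > 0\<close>. As \<open>r\<close> is in the spectrum of \<open>A\<close>, there
  are positive unit vectors \<open>x\<close> with \<open>A x \<approx> r x\<close>, and \<open>R(l, A) \<le> R(l, B)\<close> shows that \<open>x\<close> lies almost
  below \<open>P x\<close>, a multiple of \<open>u\<close>. Applying \<open>P A\<close> gives \<open>r u \<le> P A u\<close>, hence \<open>P D u \<le> 0\<close>, \<open>D u = 0\<close>, and
  \<open>D = 0\<close> because \<open>u\<close> is a weak unit.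

  \<^bold>\<open>A finite rank pole of the smaller operator\<close> (conditions (b) and (d),
  \<open>eq_if_finite_rank_pole_of_smaller\<close>). Let \<open>Q\<close> be the leading coefficient of \<open>A\<close> and suppose
  \<open>D \<noteq> 0\<close>. Then \<open>K = Q D R(b, B)\<close> has finite rank and kills no nonzero positive vector, so its powers
  decay at most geometrically. But \<open>K\<close> is the limit of \<open>(l - r)\<^sup>m G\<close> with \<open>G = R(l, A) D R(b, B)\<close>, and all
  powers of \<open>G\<close> are dominated by \<open>l R(l, B)\<close>, so the powers of \<open>(l - r)\<^sup>m G\<close> decay faster than any
  prescribed geometric rate when \<open>l\<close> is close to \<open>r\<close>. This is a contradiction.

  The link from the spectrum in the complexification to the real resolvents is
  \<open>positive_op_resolvent\<close>: above the spectral radius the resolvent is positive, and at distance \<open>\<epsilon>\<close>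
  above it the resolvent has norm at least \<open>1 / \<epsilon>\<close>.
\<close>

section \<open>Order and norm in a Banach lattice\<close>

text \<open>
  These rewrite rules would turn the truncations \<open>x - inf x (n *\<^sub>R e)\<close> used throughout into sums
  with a supremum.
\<close>

declare diff_inf_eq_sup [simp del] diff_sup_eq_inf [simp del]
  neg_inf_eq_sup [simp del] neg_sup_eq_inf [simp del]

lemma norm_abs_eq: "norm \<bar>x::'a::banach_lattice\<bar> = norm x"
  by (rule antisym) (auto intro: norm_mono_abs)

lemma norm_mono_nonneg: "0 \<le> x \<Longrightarrow> x \<le> y \<Longrightarrow> norm (x::'a::banach_lattice) \<le> norm y"
  by (rule norm_mono_abs) (auto simp: order_trans)

text \<open>
  If \<open>0 \<le> f n\<close> and \<open>f n\<close> tends to \<open>l\<close>, then the negative part of \<open>l\<close> is dominated by \<open>\<bar>f n - l\<bar>\<close>, whose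
  norm tends to zero.
\<close>

lemma closed_nonneg: "closed {x::'a::banach_lattice. 0 \<le> x}"
  unfolding closed_sequential_limits
proof (intro allI impI, elim conjE)
  fix f :: "nat \<Rightarrow> 'a" and l assume f: "\<forall>n. f n \<in> {x. 0 \<le> x}" "f \<longlonglongrightarrow> l"
  have "norm (pprt (- l)) \<le> norm (f n - l)" for n
  proof (rule norm_mono_abs)
    have "- l \<le> f n - l" using f(1) by (simp add: le_diff_eq)
    hence "- l \<le> \<bar>f n - l\<bar>" using abs_ge_self order_trans by blast
    thus "\<bar>pprt (- l)\<bar> \<le> \<bar>f n - l\<bar>" by (simp add: pprt_def)
  qed
  moreover have "(\<lambda>n. norm (f n - l)) \<longlonglongrightarrow> 0"
    using f(2) by (simp add: LIM_zero tendsto_norm_zero)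
  ultimately have "norm (pprt (- l)) \<le> 0"
    using LIMSEQ_le_const[of "\<lambda>n. norm (f n - l)" 0 "norm (pprt (- l))"] by blast
  hence "- l \<le> 0" using le_zero_iff_zero_pprt[of "- l"] by simp
  thus "l \<in> {x. 0 \<le> x}" by simp
qed

lemma tendsto_le_lattice:
  fixes a b :: "'a::banach_lattice"
  assumes "(f \<longlongrightarrow> a) F" "(g \<longlongrightarrow> b) F" "\<forall>\<^sub>F n in F. f n \<le> g n" "F \<noteq> bot"
  shows "a \<le> b"
proof -
  have "b - a \<in> {x. 0 \<le> x}"
    using assms by (intro Lim_in_closed_set[OF closed_nonneg _ _ tendsto_diff]) auto
  thus ?thesis by simp
qed

lemma le_zero_if_small_upper_bounds:
  fixes y :: "'a::banach_lattice"
  assumes "\<And>e. 0 < e \<Longrightarrow> \<exists>k. y \<le> k \<and> norm k \<le> e"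
  shows "y \<le> 0"
proof -
  have "norm (pprt y) \<le> e" if e: "0 < e" for e
  proof -
    obtain k where k: "y \<le> k" "norm k \<le> e" using assms[OF e] by blast
    have "y \<le> \<bar>k\<bar>" using k(1) abs_ge_self by (rule order_trans)
    hence "pprt y \<le> \<bar>k\<bar>" by (simp add: pprt_def)
    hence "norm (pprt y) \<le> norm \<bar>k\<bar>" by (intro norm_mono_nonneg) auto
    thus ?thesis using k(2) by (simp add: norm_abs_eq)
  qed
  hence "norm (pprt y) \<le> 0" by (rule field_le_epsilon[of _ 0, simplified])
  thus ?thesis using le_zero_iff_zero_pprt[of y] by simp
qed

lemma archimedean_lattice:
  fixes x y :: "'a::banach_lattice"
  assumes "\<And>n::nat. real n *\<^sub>R x \<le> y"
  shows "x \<le> 0"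
proof -
  have "x \<le> (1 / real (Suc n)) *\<^sub>R y" for n
  proof -
    have "(1 / real (Suc n)) *\<^sub>R (real (Suc n) *\<^sub>R x) \<le> (1 / real (Suc n)) *\<^sub>R y"
      by (rule scaleR_left_mono[OF assms]) simp
    thus ?thesis by (simp del: of_nat_Suc)
  qed
  moreover have "(\<lambda>n. (1 / real (Suc n)) *\<^sub>R y) \<longlonglongrightarrow> 0 *\<^sub>R y"
    by (intro tendsto_scaleR LIMSEQ_Suc[OF lim_1_over_n] tendsto_const)
  ultimately show ?thesis
    by (intro tendsto_le_lattice[OF tendsto_const[of x sequentially]]) auto
qed

lemma inf_zero_mono: "0 \<le> x \<Longrightarrow> x \<le> y \<Longrightarrow> 0 \<le> z \<Longrightarrow> inf y z = 0 \<Longrightarrow> inf x z = (0::'a::lattice_ab_group_add)"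
  by (metis antisym inf_mono le_infI order_refl)

lemma inf_add_le_lattice:
  fixes a b c :: "'a::lattice_ab_group_add"
  assumes "0 \<le> a" "0 \<le> b" "0 \<le> c"
  shows "inf (a + b) c \<le> inf a c + inf b c"
proof -
  have "inf (a + b) c - inf a c \<le> inf b c"
  proof (rule inf_greatest)
    have "inf (a + b) c \<le> inf (b + a) (b + c)"
      using assms by (auto simp: add.commute intro: le_infI2 add_increasing)
    hence "inf (a + b) c \<le> b + inf a c" by (simp only: add_inf_distrib_left)
    thus "inf (a + b) c - inf a c \<le> b" by (simp only: diff_le_eq)
    have "inf (a + b) c \<le> c + inf a c" 
      using assms by (metis inf.coboundedI2 add_increasing2 le_inf_iff order_refl)
    thus "inf (a + b) c - inf a c \<le> c" by (simp only: diff_le_eq)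
  qed
  thus ?thesis by (simp only: diff_le_eq add.commute)
qed

lemma inf_zero_of_nat_scaleR:
  fixes x y :: "'a::banach_lattice"
  assumes "0 \<le> x" "0 \<le> y" "inf x y = 0"
  shows "inf (real n *\<^sub>R x) y = 0"
proof (induction n)
  case (Suc n)
  have "inf (real (Suc n) *\<^sub>R x) y = inf (real n *\<^sub>R x + x) y"
    by (simp add: algebra_simps)
  also have "\<dots> \<le> inf (real n *\<^sub>R x) y + inf x y"
    using assms by (intro inf_add_le_lattice) (auto simp: scaleR_nonneg_nonneg)
  finally have "inf (real (Suc n) *\<^sub>R x) y \<le> 0" using Suc assms by simp
  moreover have "0 \<le> real (Suc n) *\<^sub>R x"
    using assms(1) by (rule scaleR_nonneg_nonneg[rotated]) simp
  ultimately show ?case using assms by (intro antisym) (auto intro: le_infI)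
qed (use assms in \<open>simp add: inf.absorb1\<close>)

lemma scaleR_abs_le:
  fixes v :: "'a::banach_lattice"
  assumes "0 < r"
  shows "r *\<^sub>R \<bar>v\<bar> \<le> \<bar>r *\<^sub>R v\<bar>"
proof -
  have "\<bar>v\<bar> \<le> (1/r) *\<^sub>R \<bar>r *\<^sub>R v\<bar>"
  proof (rule abs_leI)
    have "(1/r) *\<^sub>R (r *\<^sub>R v) \<le> (1/r) *\<^sub>R \<bar>r *\<^sub>R v\<bar>" "(1/r) *\<^sub>R (- (r *\<^sub>R v)) \<le> (1/r) *\<^sub>R \<bar>r *\<^sub>R v\<bar>"
      using assms by (intro scaleR_left_mono abs_ge_self abs_ge_minus_self; simp)+
    thus "v \<le> (1/r) *\<^sub>R \<bar>r *\<^sub>R v\<bar>" "- v \<le> (1/r) *\<^sub>R \<bar>r *\<^sub>R v\<bar>" using assms by auto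
  qed
  hence "r *\<^sub>R \<bar>v\<bar> \<le> r *\<^sub>R ((1/r) *\<^sub>R \<bar>r *\<^sub>R v\<bar>)" using assms by (intro scaleR_left_mono) auto
  thus ?thesis using assms by simp
qed

lemma pprt_half: "pprt x = (1/2) *\<^sub>R (\<bar>x\<bar> + (x::'a::banach_lattice))"
proof -
  have "\<bar>x\<bar> + x = 2 *\<^sub>R pprt x" using prts[of x] abs_prts[of x]
    by (metis (no_types, lifting) add_diff_cancel_right' diff_add_cancel scaleR_2 add.assoc add.commute)
  thus ?thesis by simp
qed

lemma disjoint_pprt: "inf (pprt x) (pprt (- x :: 'a::lattice_ab_group_add)) = 0"
proof -
  have "pprt x = x - nprt x" unfolding eq_diff_eq by (rule prts[symmetric])
  hence eq: "pprt (- x) = pprt x + - x" by (simp add: pprt_neg)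
  have "inf (pprt x) (pprt (- x)) = inf (pprt x + 0) (pprt x + - x)"
    by (simp only: eq add_0_right)
  also have "\<dots> = pprt x + inf 0 (- x)"
    by (rule add_inf_distrib_left[symmetric])
  also have "inf 0 (- x) = - pprt x" unfolding nprt_neg[symmetric] nprt_def by (rule inf.commute)
  finally show ?thesis by (simp only: add.right_inverse)
qed

lemma seq_decreases_to_0_iff:
  "seq_decreases_to s (0::'a::banach_lattice) \<longleftrightarrow>
     decseq s \<and> (\<forall>n. 0 \<le> s n) \<and> (\<forall>y. (\<forall>n. y \<le> s n) \<longrightarrow> y \<le> 0)"
  unfolding seq_decreases_to_def isGlb_def greatestP_def isLb_def setge_def setle_def by auto

lemma seq_decreases_to_0I:
  assumes "decseq s" "\<And>n. (0::'a::banach_lattice) \<le> s n" "\<And>y. (\<And>n. y \<le> s n) \<Longrightarrow> y \<le> 0"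
  shows "seq_decreases_to s 0"
  using assms by (auto simp: seq_decreases_to_0_iff)

lemma seq_decreases_to_0D:
  assumes "seq_decreases_to s (0::'a::banach_lattice)"
  shows "decseq s" "0 \<le> s n" "(\<And>n. y \<le> s n) \<Longrightarrow> y \<le> 0"
  using assms by (auto simp: seq_decreases_to_0_iff)

section \<open>Positive and sigma-order continuous operators\<close>

lemma positive_op_nonneg: "positive_op T \<Longrightarrow> 0 \<le> x \<Longrightarrow> 0 \<le> blinfun_apply T x"
  by (simp add: positive_op_def)

lemma positive_op_mono: "positive_op T \<Longrightarrow> x \<le> y \<Longrightarrow> blinfun_apply T x \<le> blinfun_apply T y"
  using positive_op_nonneg[of T "y - x"] by (simp add: blinfun.bilinear_simps)

lemma positive_op_abs: "positive_op T \<Longrightarrow> \<bar>blinfun_apply T x\<bar> \<le> blinfun_apply T \<bar>x\<bar>"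
  using positive_op_mono[of T x "\<bar>x\<bar>"] positive_op_mono[of T "-x" "\<bar>x\<bar>"]
    abs_ge_self[of x] abs_ge_minus_self[of x]
  by (intro abs_leI) (auto simp: blinfun.bilinear_simps)

lemma positive_op_diff_mono: "positive_op (B - A) \<Longrightarrow> 0 \<le> x \<Longrightarrow> blinfun_apply A x \<le> blinfun_apply B x"
  using positive_op_nonneg[of "B - A" x] by (simp add: blinfun.bilinear_simps)

lemma positive_op_compose: "positive_op S \<Longrightarrow> positive_op T \<Longrightarrow> positive_op (S o\<^sub>L T)"
  by (simp add: positive_op_def)

lemma positive_op_scaleR: "positive_op S \<Longrightarrow> 0 \<le> c \<Longrightarrow> positive_op (c *\<^sub>R S)"
  by (simp add: positive_op_def blinfun.bilinear_simps scaleR_nonneg_nonneg)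

lemma positive_op_add: "positive_op S \<Longrightarrow> positive_op T \<Longrightarrow> positive_op (S + T)"
  by (simp add: positive_op_def blinfun.bilinear_simps)

lemma positive_op_id: "positive_op id_blinfun"
  by (simp add: positive_op_def)

lemma positive_op_eq_0:
  fixes T :: "'a::banach_lattice \<Rightarrow>\<^sub>L 'a"
  assumes "positive_op T" "\<And>x. 0 \<le> x \<Longrightarrow> blinfun_apply T x = 0"
  shows "T = 0"
proof (rule blinfun_eqI)
  fix x
  have "\<bar>blinfun_apply T x\<bar> \<le> 0" using positive_op_abs[OF assms(1), of x] assms(2)[of "\<bar>x\<bar>"] by simp
  thus "blinfun_apply T x = blinfun_apply 0 x" by simp
qed

lemma tendsto_positive_op:
  fixes T :: "'a::banach_lattice \<Rightarrow>\<^sub>L 'a"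
  assumes "(f \<longlongrightarrow> T) F" "\<forall>\<^sub>F n in F. positive_op (f n)" "F \<noteq> bot"
  shows "positive_op T"
  unfolding positive_op_def
proof (intro allI impI)
  fix x :: 'a assume x: "0 \<le> x"
  have "((\<lambda>n. blinfun_apply (f n) x) \<longlongrightarrow> blinfun_apply T x) F"
    using assms(1) by (intro tendsto_intros)
  thus "0 \<le> blinfun_apply T x"
    by (rule tendsto_le_lattice[OF tendsto_const _ _ assms(3)])
       (use assms(2) x in \<open>auto elim!: eventually_mono simp: positive_op_def\<close>)
qed

lemma sigma_oc_positive: "sigma_order_continuous T \<Longrightarrow> positive_op T"
  by (simp add: sigma_order_continuous_def)

lemma sigma_oc_D: "sigma_order_continuous T \<Longrightarrow> seq_decreases_to s 0 \<Longrightarrow> seq_decreases_to (\<lambda>n. blinfun_apply T (s n)) 0"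
  by (simp add: sigma_order_continuous_def)

lemma sigma_oc_I:
  fixes T :: "'a::banach_lattice \<Rightarrow>\<^sub>L 'a"
  assumes "positive_op T"
    and "\<And>s y. seq_decreases_to s 0 \<Longrightarrow> (\<And>n. y \<le> blinfun_apply T (s n)) \<Longrightarrow> y \<le> 0"
  shows "sigma_order_continuous T"
  unfolding sigma_order_continuous_def
  using assms(1)
proof (intro conjI allI impI)
  fix s :: "nat \<Rightarrow> 'a" assume s: "seq_decreases_to s 0"
  show "seq_decreases_to (\<lambda>n. blinfun_apply T (s n)) 0"
    using seq_decreases_to_0D[OF s] assms(1)
    by (intro seq_decreases_to_0I assms(2)[OF s])
       (auto simp: decseq_def intro: positive_op_mono positive_op_nonneg)
qed

lemma sigma_oc_id: "sigma_order_continuous id_blinfun"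
  by (simp add: sigma_order_continuous_def positive_op_id)

lemma sigma_oc_zero: "sigma_order_continuous 0"
  by (intro sigma_oc_I) (auto simp: positive_op_def)

lemma sigma_oc_compose: "sigma_order_continuous S \<Longrightarrow> sigma_order_continuous T \<Longrightarrow> sigma_order_continuous (S o\<^sub>L T)"
  by (simp add: sigma_order_continuous_def positive_op_def)

lemma sigma_oc_dominated:
  fixes A B S T :: "'a::banach_lattice \<Rightarrow>\<^sub>L 'a"
  assumes "sigma_order_continuous B" "positive_op A" "positive_op (B - A)"
  shows "sigma_order_continuous A"
proof (rule sigma_oc_I[OF assms(2)])
  fix s and y :: 'a assume s: "seq_decreases_to s 0" "\<And>n. y \<le> blinfun_apply A (s n)"
  hence "y \<le> blinfun_apply B (s n)" for n
    using positive_op_diff_mono[OF assms(3)] seq_decreases_to_0D(2)[OF s(1)] order_trans by blast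
  thus "y \<le> 0" using seq_decreases_to_0D(3)[OF sigma_oc_D[OF assms(1) s(1)]] by blast
qed

text \<open>
  A lower bound \<open>y\<close> of \<open>S (s n) + T (s n)\<close> is, by monotonicity, a lower bound of \<open>S (s k) + T (s n)\<close>
  for all \<open>k\<close> and \<open>n\<close> independently, so the two infima can be taken one after the other.
\<close>

lemma sigma_oc_add:
  fixes A B S T :: "'a::banach_lattice \<Rightarrow>\<^sub>L 'a"
  assumes "sigma_order_continuous S" "sigma_order_continuous T"
  shows "sigma_order_continuous (S + T)"
proof (rule sigma_oc_I)
  show "positive_op (S + T)" using assms by (auto intro: positive_op_add sigma_oc_positive)
  fix s and y :: 'a assume s: "seq_decreases_to s 0" "\<And>n. y \<le> blinfun_apply (S + T) (s n)"
  note d1 = seq_decreases_to_0D[OF sigma_oc_D[OF assms(1) s(1)]]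
  note d2 = seq_decreases_to_0D[OF sigma_oc_D[OF assms(2) s(1)]]
  have "y - blinfun_apply S (s k) \<le> blinfun_apply T (s n)" for k n
  proof -
    have "y \<le> blinfun_apply S (s (max k n)) + blinfun_apply T (s (max k n))"
      using s(2) by (simp add: blinfun.bilinear_simps)
    also have "\<dots> \<le> blinfun_apply S (s k) + blinfun_apply T (s n)"
      using d1(1) d2(1) by (intro add_mono) (auto simp: decseq_def)
    finally show ?thesis by (simp add: algebra_simps)
  qed
  hence "y - blinfun_apply S (s k) \<le> 0" for k using d2(3) by blast
  thus "y \<le> 0" using d1(3) by simp
qed

lemma sigma_oc_scaleR:
  fixes A B S T :: "'a::banach_lattice \<Rightarrow>\<^sub>L 'a"
  assumes "sigma_order_continuous S" "0 < c"
  shows "sigma_order_continuous (c *\<^sub>R S)"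
proof (rule sigma_oc_I)
  show "positive_op (c *\<^sub>R S)" using assms by (auto intro: positive_op_scaleR sigma_oc_positive)
  fix s and y :: 'a assume s: "seq_decreases_to s 0" "\<And>n. y \<le> blinfun_apply (c *\<^sub>R S) (s n)"
  have "(1/c) *\<^sub>R y \<le> blinfun_apply S (s n)" for n
    using scaleR_left_mono[OF s(2)[of n], of "1/c"] assms(2) by (simp add: blinfun.bilinear_simps)
  hence "(1/c) *\<^sub>R y \<le> 0" using seq_decreases_to_0D(3)[OF sigma_oc_D[OF assms(1) s(1)]] by blast
  hence "c *\<^sub>R ((1/c) *\<^sub>R y) \<le> c *\<^sub>R 0" using assms(2) by (intro scaleR_left_mono) auto
  thus "y \<le> 0" using assms(2) by simp
qed

lemma lorentz_seminorm_le:
  assumes "\<And>n. 0 \<le> s n" "seq_increases_to s \<bar>x\<bar>" "\<And>n. norm (s n) \<le> c"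
  shows "lorentz_seminorm (x::'a::banach_lattice) \<le> c"
proof -
  let ?S = "{s. (\<forall>n. 0 \<le> s n) \<and> seq_increases_to s \<bar>x\<bar>}"
  have lim: "(\<lambda>n. norm (t n)) \<longlonglongrightarrow> lim (\<lambda>n. norm (t n))" if "t \<in> ?S" for t
  proof -
    have t: "incseq t" "t n \<le> \<bar>x\<bar>" "0 \<le> t n" for n
      using that by (auto simp: seq_increases_to_def dest: isLubD2)
    have "incseq (\<lambda>n. norm (t n))"
      using t by (auto simp: incseq_def intro!: norm_mono_nonneg)
    moreover have "norm (t n) \<le> norm x" for n
      using norm_mono_nonneg[OF t(3) t(2)] by (simp add: norm_abs_eq)
    ultimately obtain L where "(\<lambda>n. norm (t n)) \<longlonglongrightarrow> L"
      using incseq_convergent by blast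
    thus ?thesis by (simp add: limI)
  qed
  have s: "s \<in> ?S" using assms by auto
  have "bdd_below ((\<lambda>s. lim (\<lambda>n. norm (s n))) ` ?S)"
  proof (rule bdd_belowI2[of _ 0])
    fix t assume "t \<in> ?S"
    show "0 \<le> lim (\<lambda>n. norm (t n))" by (rule LIMSEQ_le_const[OF lim[OF \<open>t \<in> ?S\<close>]]) simp
  qed
  hence "lorentz_seminorm x \<le> lim (\<lambda>n. norm (s n))"
    unfolding lorentz_seminorm_def using s by (rule cINF_lower)
  also have "\<dots> \<le> c" by (rule LIMSEQ_le_const2[OF lim[OF s]]) (simp add: assms(3))
  finally show ?thesis .
qed

text \<open>
  This is where the Lorentz seminorm enters. Let \<open>0 \<le> y \<le> T (s n)\<close> with \<open>s n\<close> decreasing to zero. The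
  positive parts of \<open>y - f k (s n)\<close> increase to \<open>y\<close>, and they are dominated by \<open>\<bar>(T - f k) (s n)\<bar>\<close>, so
  their norms are at most \<open>norm (T - f k) * norm (s 0)\<close>. Hence \<open>y\<close> has Lorentz seminorm zero.
\<close>

lemma sigma_oc_norm_limit:
  assumes l: "is_norm (lorentz_seminorm :: 'a::banach_lattice \<Rightarrow> real)"
    and f: "\<And>k. sigma_order_continuous (f k :: 'a \<Rightarrow>\<^sub>L 'a)" "f \<longlonglongrightarrow> T"
  shows "sigma_order_continuous T"
proof (rule sigma_oc_I)
  show "positive_op T"
    by (rule tendsto_positive_op[OF f(2)]) (simp_all add: sigma_oc_positive[OF f(1)])
  fix s :: "nat \<Rightarrow> 'a" and y
  assume s: "seq_decreases_to s 0" and y: "\<And>n. y \<le> blinfun_apply T (s n)"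
  define y' where "y' = pprt y"
  have s0: "0 \<le> s n" for n using seq_decreases_to_0D(2)[OF s] .
  have y': "0 \<le> y'" "\<And>n. y' \<le> blinfun_apply T (s n)"
    using y positive_op_nonneg[OF \<open>positive_op T\<close> s0] by (auto simp: y'_def pprt_def)
  have bound: "lorentz_seminorm y' \<le> norm (T - f k) * norm (s 0)" for k
  proof (rule lorentz_seminorm_le)
    let ?t = "\<lambda>n. pprt (y' - blinfun_apply (f k) (s n))"
    note d = seq_decreases_to_0D[OF sigma_oc_D[OF f(1)[of k] s]]
    show "0 \<le> ?t n" for n by simp
    have up: "?t n \<le> y'" for n using d(2) y'(1) by (simp add: pprt_def)
    have "isLub UNIV (range ?t) y'"
      unfolding isLub_def leastP_def isUb_def setle_def setge_def
    proof (safe; (rule up UNIV_I)?; clarsimp)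
      fix z assume z: "\<forall>n. ?t n \<le> z"
      have "y' - z \<le> blinfun_apply (f k) (s n)" for n
      proof -
        have "y' - blinfun_apply (f k) (s n) \<le> ?t n" by (simp add: pprt_def)
        hence "y' - blinfun_apply (f k) (s n) \<le> z" using z order_trans by blast
        thus ?thesis by (simp add: algebra_simps)
      qed
      thus "y' \<le> z" using d(3) by force
    qed
    moreover have "incseq ?t"
      using d(1) by (auto simp: incseq_def decseq_def intro!: pprt_mono diff_left_mono)
    ultimately show "seq_increases_to ?t \<bar>y'\<bar>" using y'(1) by (simp add: seq_increases_to_def)
    fix n
    have "y' - blinfun_apply (f k) (s n) \<le> blinfun_apply (T - f k) (s n)"
      using y'(2)[of n] by (simp add: blinfun.bilinear_simps)
    hence "\<bar>?t n\<bar> \<le> \<bar>blinfun_apply (T - f k) (s n)\<bar>"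
      by (simp add: pprt_def) (metis abs_ge_self order_trans)
    hence "norm (?t n) \<le> norm (blinfun_apply (T - f k) (s n))" by (rule norm_mono_abs)
    also have "\<dots> \<le> norm (T - f k) * norm (s n)" by (rule norm_blinfun)
    also have "\<dots> \<le> norm (T - f k) * norm (s 0)"
      using seq_decreases_to_0D(1)[OF s] s0
      by (intro mult_left_mono norm_mono_nonneg) (auto simp: decseq_def)
    finally show "norm (?t n) \<le> norm (T - f k) * norm (s 0)" .
  qed
  have "(\<lambda>k. norm (T - f k) * norm (s 0)) \<longlonglongrightarrow> norm (T - T) * norm (s 0)"
    by (intro tendsto_intros f(2))
  hence "lorentz_seminorm y' \<le> 0" using bound
    LIMSEQ_le_const[of "\<lambda>k. norm (T - f k) * norm (s 0)" 0 "lorentz_seminorm y'"] by simp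
  hence "y' = 0" using l unfolding is_norm_def by (metis antisym)
  thus "y \<le> 0" by (simp add: y'_def le_zero_iff_zero_pprt)
qed

section \<open>Bands and weak units\<close>

text \<open>
  The principal band generated by \<open>e\<close>, as the double disjoint complement; positive \<open>y\<close> suffice to
  test disjointness.
\<close>

definition double_disjoint_complement :: "'a::banach_lattice \<Rightarrow> 'a set" where
  "double_disjoint_complement e = {x. \<forall>y\<ge>0. inf y \<bar>e\<bar> = 0 \<longrightarrow> inf \<bar>x\<bar> y = 0}"

text \<open>
  The delicate point is a supremum \<open>x\<close> of an arbitrary subset \<open>D\<close>. If \<open>y\<close> is disjoint from \<open>D\<close>, then
  subtracting \<open>t = inf (pprt x) y\<close> from \<open>x\<close> still leaves an upper bound of \<open>D\<close>, so \<open>t = 0\<close>; and the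
  negative part of \<open>x\<close> is below that of any member of \<open>D\<close>.
\<close>

lemma band_double_disjoint_complement: "band (double_disjoint_complement (e::'a::banach_lattice))"
  unfolding band_def order_ideal_def
proof (intro conjI ballI allI impI)
  show "subspace (double_disjoint_complement e)"
    unfolding subspace_def
  proof (intro conjI ballI allI)
    show "0 \<in> double_disjoint_complement e" by (auto simp: double_disjoint_complement_def inf.absorb1)
    fix x y assume xy: "x \<in> double_disjoint_complement e" "y \<in> double_disjoint_complement e"
    show "x + y \<in> double_disjoint_complement e"
      unfolding double_disjoint_complement_def
    proof (safe)
      fix z :: 'a assume z: "0 \<le> z" "inf z \<bar>e\<bar> = 0"
      have "inf \<bar>x + y\<bar> z \<le> inf (\<bar>x\<bar> + \<bar>y\<bar>) z" by (intro inf_mono abs_triangle_ineq order_refl)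
      also have "\<dots> \<le> inf \<bar>x\<bar> z + inf \<bar>y\<bar> z" using z by (intro inf_add_le_lattice) auto
      also have "\<dots> = 0" using xy z by (simp add: double_disjoint_complement_def)
      finally show "inf \<bar>x + y\<bar> z = 0" using z by (intro antisym) (auto intro: le_infI)
    qed
  next
    fix c x assume x: "x \<in> double_disjoint_complement e"
    show "c *\<^sub>R x \<in> double_disjoint_complement e"
      unfolding double_disjoint_complement_def
    proof safe
      fix z :: 'a assume z: "0 \<le> z" "inf z \<bar>e\<bar> = 0"
      obtain n where n: "\<bar>c\<bar> \<le> real n" using real_arch_simple by blast
      have le: "c *\<^sub>R x \<le> real n *\<^sub>R \<bar>x\<bar>" if "\<bar>c\<bar> \<le> real n" for c and x :: 'a
      proof -
        have "c *\<^sub>R x \<le> \<bar>c\<bar> *\<^sub>R \<bar>x\<bar>"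
        proof (cases "c \<ge> 0")
          case True thus ?thesis by (simp add: scaleR_left_mono abs_ge_self)
        next
          case False
          have "(- c) *\<^sub>R (- x) \<le> (- c) *\<^sub>R \<bar>x\<bar>" using False by (intro scaleR_left_mono abs_ge_minus_self) auto
          thus ?thesis using False by simp
        qed
        also have "\<dots> \<le> real n *\<^sub>R \<bar>x\<bar>" using that by (intro scaleR_right_mono) auto
        finally show ?thesis .
      qed
      have "\<bar>c *\<^sub>R x\<bar> \<le> real n *\<^sub>R \<bar>x\<bar>"
        using le[OF n, of x] le[of "- c" x] n by (intro abs_leI) auto
      moreover have "inf (real n *\<^sub>R \<bar>x\<bar>) z = 0"
        using x z by (intro inf_zero_of_nat_scaleR) (auto simp: double_disjoint_complement_def)
      ultimately show "inf \<bar>c *\<^sub>R x\<bar> z = 0" using z by - (rule inf_zero_mono[of _ "real n *\<^sub>R \<bar>x\<bar>"]; auto)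
    qed
  qed
  fix x y assume xy: "x \<in> double_disjoint_complement e" "\<bar>y\<bar> \<le> \<bar>x\<bar>"
  show "y \<in> double_disjoint_complement e" unfolding double_disjoint_complement_def
  proof safe
    fix z :: 'a assume z: "0 \<le> z" "inf z \<bar>e\<bar> = 0"
    show "inf \<bar>y\<bar> z = 0"
      using xy z by (intro inf_zero_mono[OF abs_ge_zero xy(2) z(1)]) (simp add: double_disjoint_complement_def)
  qed
next
  fix D and x :: 'a assume D: "D \<subseteq> double_disjoint_complement e \<and> isLub UNIV D x"
  have ub: "d \<le> x" if "d \<in> D" for d using D that by (auto dest: isLubD2)
  have lub: "x \<le> z" if "\<And>d. d \<in> D \<Longrightarrow> d \<le> z" for z
    using D that by (auto intro!: isLub_le_isUb simp: isUb_def setle_def)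
  show "x \<in> double_disjoint_complement e"
  proof (cases "D = {}")
    case True
    hence "x \<le> 0" "x \<le> 2 *\<^sub>R x" using lub by auto
    hence "x = 0" by (simp add: scaleR_2)
    thus ?thesis by (auto simp: double_disjoint_complement_def inf.absorb1)
  next
    case False
    then obtain d0 where d0: "d0 \<in> D" by blast
    show ?thesis unfolding double_disjoint_complement_def
    proof safe
      fix y :: 'a assume y: "0 \<le> y" "inf y \<bar>e\<bar> = 0"
      have disj: "inf \<bar>d\<bar> y = 0" if "d \<in> D" for d using that D y by (auto simp: double_disjoint_complement_def)
      have part: "inf (pprt d) y = 0" "inf (pprt (- d)) y = 0" if "d \<in> D" for d
        by (rule inf_zero_mono[OF zero_le_pprt _ y(1) disj[OF that]];
            simp add: pprt_def abs_ge_minus_self abs_ge_self)+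
      define t where "t = inf (pprt x) y"
      have t0: "0 \<le> t" using y by (simp add: t_def)
      have "d \<le> x - t" if "d \<in> D" for d
      proof -
        have "inf t (pprt d) = 0" using part(1)[OF that] y t0
          by - (rule inf_zero_mono[of t y]; simp add: t_def inf.commute)
        hence "inf (pprt d) t = 0" by (simp only: inf.commute)
        hence "pprt d + t = sup (pprt d) t" using add_eq_inf_sup[of "pprt d" t] by simp
        also have "\<dots> \<le> pprt x" using ub[OF that] by (auto simp: t_def intro: pprt_mono)
        finally have "pprt d + t \<le> pprt x" .
        moreover have "nprt d \<le> nprt x" using ub[OF that] by (rule nprt_mono)
        ultimately have "pprt d + t + nprt d \<le> pprt x + nprt x" by (rule add_mono)
        thus ?thesis using prts[of d] prts[of x] by (metis add.commute add.assoc le_diff_eq)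
      qed
      hence "x \<le> x - t" by (rule lub)
      hence "t \<le> 0" by simp
      hence t: "inf (pprt x) y = 0" using t0 unfolding t_def by (rule antisym)
      have "pprt (- x) \<le> pprt (- d0)" using ub[OF d0] by (intro pprt_mono) simp
      hence "inf (pprt (- x)) y = 0" using part(2)[OF d0] y by - (rule inf_zero_mono[of _ "pprt (- d0)"]; auto)
      moreover have "\<bar>x\<bar> = pprt x + pprt (- x)" by (simp add: abs_prts pprt_neg)
      ultimately have "inf \<bar>x\<bar> y \<le> 0" using inf_add_le_lattice[of "pprt x" "pprt (- x)" y] y t by simp
      thus "inf \<bar>x\<bar> y = 0" using y by (intro antisym) (auto intro: le_infI)
    qed
  qed
qed

text \<open>
  The Archimedean argument: if \<open>w \<ge> 0\<close> is a lower bound of the remainders, then \<open>n *\<^sub>R inf w e \<le> x\<close> for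
  all \<open>n\<close> by induction, so \<open>w\<close> is disjoint from \<open>e\<close>, hence from \<open>x\<close>, although \<open>w \<le> x\<close>.
\<close>

lemma double_disjoint_complement_truncations:
  fixes e x :: "'a::banach_lattice"
  assumes e: "0 \<le> e" and x: "0 \<le> x" "x \<in> double_disjoint_complement e"
  shows "seq_decreases_to (\<lambda>n. x - inf x (real n *\<^sub>R e)) 0"
proof (rule seq_decreases_to_0I)
  show "decseq (\<lambda>n. x - inf x (real n *\<^sub>R e))"
    unfolding decseq_def
  proof (intro allI impI diff_left_mono inf_mono order_refl scaleR_right_mono e)
  qed simp
  show "0 \<le> x - inf x (real n *\<^sub>R e)" for n by simp
  fix z assume z: "\<And>n. z \<le> x - inf x (real n *\<^sub>R e)"
  define w where "w = pprt z"
  have w0: "0 \<le> w" by (simp add: w_def)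
  have wle: "w \<le> x - inf x (real n *\<^sub>R e)" for n using z by (simp add: w_def pprt_def)
  have "real n *\<^sub>R inf w e \<le> x" for n
  proof (induction n)
    case (Suc n)
    have "real n *\<^sub>R inf w e \<le> real n *\<^sub>R e" by (intro scaleR_left_mono) auto
    with Suc have "real n *\<^sub>R inf w e \<le> inf x (real n *\<^sub>R e)" by simp
    also have "\<dots> \<le> x - w" using wle[of n] by (simp add: algebra_simps)
    also have "\<dots> \<le> x - inf w e" by (simp add: diff_left_mono)
    finally show ?case by (simp add: algebra_simps)
  qed (use x in simp)
  hence "inf w e \<le> 0" by (rule archimedean_lattice)
  hence "inf w \<bar>e\<bar> = 0" using w0 e by (intro antisym) auto
  hence "inf x w = 0" using x w0 by (auto simp: double_disjoint_complement_def)
  moreover have "w \<le> x" using wle[of 0] x by (simp add: inf.absorb2)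
  ultimately have "w = 0" by (simp add: inf.absorb2)
  thus "z \<le> 0" by (simp add: w_def le_zero_iff_zero_pprt)
qed

text \<open>
  The sequential form, on which \<open>\<sigma>\<close>-order continuous operators act: the truncations
  \<open>inf x (n *\<^sub>R e)\<close> increase to \<open>x\<close>.
\<close>

definition weak_unit :: "'a::banach_lattice \<Rightarrow> bool" where
  "weak_unit e \<longleftrightarrow> 0 \<le> e \<and> (\<forall>x\<ge>0. seq_decreases_to (\<lambda>n. x - inf x (real n *\<^sub>R e)) 0)"

text \<open>
  The principal band of \<open>e\<close> is invariant: for \<open>x\<close> in it, \<open>B \<bar>x\<bar>\<close> is approached from below by
  \<open>B (inf \<bar>x\<bar> (n *\<^sub>R e)) \<le> (n * c) *\<^sub>R e\<close>, up to remainders decreasing to zero, so it is disjoint from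
  everything that is disjoint from \<open>e\<close>. As this band contains \<open>e\<close>, it is the whole space.
\<close>

lemma irreducible_weak_unit:
  fixes B :: "'a::banach_lattice \<Rightarrow>\<^sub>L 'a"
  assumes B: "band_irreducible B" "sigma_order_continuous B"
    and e: "0 \<le> e" "e \<noteq> 0" "blinfun_apply B e \<le> c *\<^sub>R e"
  shows "weak_unit e"
proof -
  have pos: "positive_op B" using B by (simp add: sigma_oc_positive)
  have "blinfun_apply B ` double_disjoint_complement e \<subseteq> double_disjoint_complement e"
  proof safe
    fix x assume x: "x \<in> double_disjoint_complement e"
    have ax: "\<bar>x\<bar> \<in> double_disjoint_complement e" using x by (simp add: double_disjoint_complement_def)
    let ?r = "\<lambda>n. \<bar>x\<bar> - inf \<bar>x\<bar> (real n *\<^sub>R e)"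
    note d = seq_decreases_to_0D[OF sigma_oc_D[OF B(2) double_disjoint_complement_truncations[OF e(1) abs_ge_zero ax]]]
    show "blinfun_apply B x \<in> double_disjoint_complement e" unfolding double_disjoint_complement_def
    proof safe
      fix y :: 'a assume y: "0 \<le> y" "inf y \<bar>e\<bar> = 0"
      have ey: "inf e y = 0" using y e by (simp add: inf.commute)
      define t where "t = inf (blinfun_apply B \<bar>x\<bar>) y"
      have "t \<le> blinfun_apply B (?r n)" for n
      proof -
        let ?a = "blinfun_apply B (inf \<bar>x\<bar> (real n *\<^sub>R e))"
        have a0: "0 \<le> ?a" using e by (intro positive_op_nonneg[OF pos]) (auto simp: scaleR_nonneg_nonneg)
        obtain N where N: "real n * c \<le> real N" using real_arch_simple by blast
        have "?a \<le> blinfun_apply B (real n *\<^sub>R e)" by (intro positive_op_mono[OF pos]) auto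
        also have "\<dots> \<le> real n *\<^sub>R (c *\<^sub>R e)"
          unfolding blinfun.scaleR_right using e(3) by (rule scaleR_left_mono) simp
        also have "\<dots> \<le> real N *\<^sub>R e" using N e by (simp add: scaleR_right_mono)
        finally have "inf ?a y = 0"
          using a0 y inf_zero_of_nat_scaleR[OF e(1) y(1) ey, of N]
          by - (rule inf_zero_mono[of ?a "real N *\<^sub>R e"]; simp)
        moreover have "t \<le> inf ?a y + inf (blinfun_apply B (?r n)) y"
        proof -
          have "t = inf (?a + blinfun_apply B (?r n)) y" by (simp add: t_def blinfun.bilinear_simps)
          also have "\<dots> \<le> inf ?a y + inf (blinfun_apply B (?r n)) y"
            using a0 y d(2) by (intro inf_add_le_lattice) auto
          finally show ?thesis .
        qed
        ultimately show ?thesis by (simp add: inf.coboundedI1)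
      qed
      hence "t \<le> 0" by (rule d(3))
      hence "inf (blinfun_apply B \<bar>x\<bar>) y = 0"
        unfolding t_def using y positive_op_nonneg[OF pos, of "\<bar>x\<bar>"] by (intro antisym) auto
      thus "inf \<bar>blinfun_apply B x\<bar> y = 0"
        using y positive_op_abs[OF pos, of x] by - (rule inf_zero_mono[of _ "blinfun_apply B \<bar>x\<bar>"]; auto)
    qed
  qed
  hence "double_disjoint_complement e = {0} \<or> double_disjoint_complement e = UNIV"
    using B(1) band_double_disjoint_complement[of e] unfolding band_irreducible_def by blast
  moreover have "e \<in> double_disjoint_complement e" using e by (auto simp: double_disjoint_complement_def inf.commute)
  ultimately have "double_disjoint_complement e = UNIV" using e by auto
  thus ?thesis using double_disjoint_complement_truncations[OF e(1)] e(1) by (simp add: weak_unit_def)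
qed

text \<open>
  \<open>S\<close> kills all truncations \<open>inf x (n *\<^sub>R e)\<close>, so \<open>S x\<close> is its value on remainders that decrease to
  zero.
\<close>

lemma weak_unit_sigma_oc_eq_0:
  fixes e :: "'a::banach_lattice"
  assumes "weak_unit e" "sigma_order_continuous S" "blinfun_apply S e = 0"
  shows "S = 0"
proof (rule positive_op_eq_0)
  show pos: "positive_op S" using assms by (simp add: sigma_oc_positive)
  fix x :: 'a assume x: "0 \<le> x"
  have e: "0 \<le> e" using assms by (simp add: weak_unit_def)
  have "blinfun_apply S x \<le> blinfun_apply S (x - inf x (real n *\<^sub>R e))" for n
  proof -
    have "blinfun_apply S (inf x (real n *\<^sub>R e)) \<le> blinfun_apply S (real n *\<^sub>R e)"
      by (intro positive_op_mono[OF pos]) auto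
    thus ?thesis using assms(3) by (simp add: blinfun.bilinear_simps)
  qed
  moreover have "seq_decreases_to (\<lambda>n. x - inf x (real n *\<^sub>R e)) 0"
    using assms(1) x unfolding weak_unit_def by (elim conjE allE impE)
  ultimately have "blinfun_apply S x \<le> 0"
    by (intro seq_decreases_to_0D(3)[OF sigma_oc_D[OF assms(2)]])
  thus "blinfun_apply S x = 0" using positive_op_nonneg[OF pos x] by simp
qed

lemma weak_unit_disjoint:
  fixes e :: "'a::banach_lattice"
  assumes "weak_unit e" "0 \<le> x" "inf x e = 0"
  shows "x = 0"
proof -
  have e: "0 \<le> e" using assms by (simp add: weak_unit_def)
  have "inf x (real n *\<^sub>R e) = 0" for n
    using inf_zero_of_nat_scaleR[OF e assms(2)] assms(3) by (metis inf.commute)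
  hence "x \<le> x - inf x (real n *\<^sub>R e)" for n by (simp)
  moreover have "seq_decreases_to (\<lambda>n. x - inf x (real n *\<^sub>R e)) 0"
    using assms(1,2) unfolding weak_unit_def by (elim conjE allE impE)
  ultimately have "x \<le> 0" by (rule seq_decreases_to_0D(3)[rotated])
  thus ?thesis using assms by simp
qed

section \<open>Separation of convex sets and weak compactness\<close>

text \<open>
  Homogeneity is required only as an inequality; for positive factors equality follows, see
  \<open>sublinear_scale\<close>.
\<close>

definition sublinear :: "('a::real_vector \<Rightarrow> real) \<Rightarrow> bool" where
  "sublinear p \<longleftrightarrow> (\<forall>x y. p (x + y) \<le> p x + p y) \<and> (\<forall>t x. 0 \<le> t \<longrightarrow> p (t *\<^sub>R x) \<le> t * p x)"

lemma sublinear_add: "sublinear p \<Longrightarrow> p (x + y) \<le> p x + p y"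
  by (simp add: sublinear_def)

lemma sublinear_scale_le: "sublinear p \<Longrightarrow> 0 \<le> t \<Longrightarrow> p (t *\<^sub>R x) \<le> t * p x"
  by (simp add: sublinear_def)

lemma sublinear_0: "sublinear p \<Longrightarrow> p 0 = 0"
  using sublinear_add[of p 0 0] sublinear_scale_le[of p 0 0] by simp

lemma sublinear_scale:
  assumes "sublinear p" "0 \<le> t"
  shows "p (t *\<^sub>R x) = t * p x"
proof (cases "t = 0")
  case True thus ?thesis using sublinear_0[OF assms(1)] by simp
next
  case False
  hence t: "t > 0" using assms by simp
  have "p ((1/t) *\<^sub>R (t *\<^sub>R x)) \<le> (1/t) * p (t *\<^sub>R x)"
    using t by (intro sublinear_scale_le[OF assms(1)]) simp
  hence "t * p x \<le> p (t *\<^sub>R x)" using t by (simp add: field_simps)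
  thus ?thesis using sublinear_scale_le[OF assms, of x] by simp
qed

lemma sublinear_ge: "sublinear p \<Longrightarrow> - p (- x) \<le> p x"
  using sublinear_add[of p x "- x"] sublinear_0[of p] by simp

text \<open>
  The lower bounds of chains for an application of Zorn's lemma: a minimal sublinear functional
  below \<open>p\<close> will turn out to be linear.
\<close>

lemma sublinear_INF_chain:
  fixes p :: "'a::real_vector \<Rightarrow> real"
  assumes ne: "C \<noteq> {}" and sub: "\<And>q. q \<in> C \<Longrightarrow> sublinear q \<and> q \<le> p"
    and chain: "\<And>q q'. q \<in> C \<Longrightarrow> q' \<in> C \<Longrightarrow> q \<le> q' \<or> q' \<le> q"
  shows "sublinear (\<lambda>x. INF q\<in>C. q x)" and "q \<in> C \<Longrightarrow> (\<lambda>x. INF q\<in>C. q x) \<le> q"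
proof -
  have bdd: "bdd_below ((\<lambda>q. q x) ` C)" for x
  proof (rule bdd_belowI2[of _ "- p (- x)"])
    fix q assume "q \<in> C"
    hence "sublinear q" "q (- x) \<le> p (- x)" using sub by (auto simp: le_fun_def)
    thus "- p (- x) \<le> q x" using sublinear_ge[of q x] by simp
  qed
  show "(\<lambda>x. INF q\<in>C. q x) \<le> q" if "q \<in> C" for q
    using that by (auto simp: le_fun_def intro: cINF_lower[OF bdd])
  show "sublinear (\<lambda>x. INF q\<in>C. q x)"
    unfolding sublinear_def
  proof (intro conjI allI impI)
    fix x y
    have "(INF q\<in>C. q (x + y)) - q1 x \<le> q2 y" if q: "q1 \<in> C" "q2 \<in> C" for q1 q2
    proof -
      obtain q where q': "q \<in> C" "q \<le> q1" "q \<le> q2" using chain[OF q] q by blast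
      have "(INF q\<in>C. q (x + y)) \<le> q (x + y)" by (rule cINF_lower[OF bdd q'(1)])
      also have "\<dots> \<le> q x + q y" using sub[OF q'(1)] by (simp add: sublinear_add)
      also have "\<dots> \<le> q1 x + q2 y" using q'(2,3) by (intro add_mono) (auto simp: le_fun_def)
      finally show ?thesis by simp
    qed
    hence "(INF q\<in>C. q (x + y)) - q1 x \<le> (INF q\<in>C. q y)" if "q1 \<in> C" for q1
      using that ne by (intro cINF_greatest) auto
    hence "(INF q\<in>C. q (x + y)) - (INF q\<in>C. q y) \<le> q1 x" if "q1 \<in> C" for q1
      using that by (simp add: algebra_simps)
    hence "(INF q\<in>C. q (x + y)) - (INF q\<in>C. q y) \<le> (INF q\<in>C. q x)"
      using ne by (intro cINF_greatest) auto
    thus "(INF q\<in>C. q (x + y)) \<le> (INF q\<in>C. q x) + (INF q\<in>C. q y)" by simp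
  next
    fix t :: real and x assume t: "0 \<le> t"
    show "(INF q\<in>C. q (t *\<^sub>R x)) \<le> t * (INF q\<in>C. q x)"
    proof (cases "t = 0")
      case True
      obtain q where q: "q \<in> C" using ne by blast
      have "(INF q\<in>C. q (t *\<^sub>R x)) \<le> q (t *\<^sub>R x)" by (rule cINF_lower[OF bdd q])
      thus ?thesis using True sub[OF q] by (simp add: sublinear_0)
    next
      case False
      hence t0: "0 < t" using t by simp
      have "(INF q\<in>C. q (t *\<^sub>R x)) / t \<le> q x" if "q \<in> C" for q
      proof -
        have "(INF q\<in>C. q (t *\<^sub>R x)) \<le> q (t *\<^sub>R x)" by (rule cINF_lower[OF bdd that])
        also have "\<dots> \<le> t * q x" using sub[OF that] t by (simp add: sublinear_scale_le)
        finally show ?thesis using t0 by (simp add: field_simps)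
      qed
      hence "(INF q\<in>C. q (t *\<^sub>R x)) / t \<le> (INF q\<in>C. q x)" using ne by (intro cINF_greatest) auto
      thus ?thesis using t0 by (simp add: field_simps)
    qed
  qed
qed

text \<open>
  The functional \<open>\<lambda>x. INF t\<ge>0. q (x + t *\<^sub>R y) - t * q y\<close> is sublinear and below \<open>q\<close>, so it equals \<open>q\<close>;
  its value at \<open>x\<close> is at most the term for \<open>t = 1\<close>.
\<close>

lemma minimal_sublinear_superadditive:
  fixes q :: "'a::real_vector \<Rightarrow> real"
  assumes q: "sublinear q" and minimal: "\<And>q'. sublinear q' \<Longrightarrow> q' \<le> q \<Longrightarrow> q' = q"
  shows "q x + q y \<le> q (x + y)"
proof -
  define q' where "q' x = (INF t\<in>{0..}. q (x + t *\<^sub>R y) - t * q y)" for x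
  have bdd: "bdd_below ((\<lambda>t. q (x + t *\<^sub>R y) - t * q y) ` {0..})" for x
  proof (rule bdd_belowI2[of _ "- q (- x)"])
    fix t :: real assume "t \<in> {0..}"
    hence "t * q y = q (t *\<^sub>R y)" using sublinear_scale[OF q] by simp
    also have "\<dots> \<le> q (x + t *\<^sub>R y) + q (- x)" using sublinear_add[OF q, of "x + t *\<^sub>R y" "- x"] by simp
    finally show "- q (- x) \<le> q (x + t *\<^sub>R y) - t * q y" by simp
  qed
  have low: "q' x \<le> q (x + t *\<^sub>R y) - t * q y" if "0 \<le> t" for x t
    unfolding q'_def using that by (intro cINF_lower[OF bdd]) simp
  have great: "c \<le> q' x" if "\<And>t. 0 \<le> t \<Longrightarrow> c \<le> q (x + t *\<^sub>R y) - t * q y" for c x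
    unfolding q'_def using that by (intro cINF_greatest) auto
  have "q' \<le> q" using low[of 0] by (auto simp: le_fun_def)
  moreover have "sublinear q'"
    unfolding sublinear_def
  proof (intro conjI allI impI)
    fix u v
    have "q' (u + v) - (q (u + t *\<^sub>R y) - t * q y) \<le> q (v + s *\<^sub>R y) - s * q y"
      if "0 \<le> t" "0 \<le> s" for s t
    proof -
      have "q' (u + v) \<le> q ((u + v) + (t + s) *\<^sub>R y) - (t + s) * q y" using that by (intro low) simp
      also have "(u + v) + (t + s) *\<^sub>R y = (u + t *\<^sub>R y) + (v + s *\<^sub>R y)" by (simp add: algebra_simps)
      also have "q \<dots> \<le> q (u + t *\<^sub>R y) + q (v + s *\<^sub>R y)" by (rule sublinear_add[OF q])
      finally show ?thesis by (simp add: algebra_simps)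
    qed
    hence "q' (u + v) - (q (u + t *\<^sub>R y) - t * q y) \<le> q' v" if "0 \<le> t" for t
      using that by (intro great)
    hence "q' (u + v) - q' v \<le> q (u + t *\<^sub>R y) - t * q y" if "0 \<le> t" for t
      using that by (simp add: algebra_simps)
    hence "q' (u + v) - q' v \<le> q' u" by (rule great)
    thus "q' (u + v) \<le> q' u + q' v" by simp
  next
    fix c :: real and u assume c: "0 \<le> c"
    show "q' (c *\<^sub>R u) \<le> c * q' u"
    proof (cases "c = 0")
      case True thus ?thesis using low[of 0 0] sublinear_0[OF q] by simp
    next
      case False
      hence c0: "0 < c" using c by simp
      have "q' (c *\<^sub>R u) / c \<le> q (u + t *\<^sub>R y) - t * q y" if "0 \<le> t" for t
      proof -
        have "q' (c *\<^sub>R u) \<le> q (c *\<^sub>R u + (c * t) *\<^sub>R y) - (c * t) * q y" using that c by (intro low) simp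
        also have "c *\<^sub>R u + (c * t) *\<^sub>R y = c *\<^sub>R (u + t *\<^sub>R y)" by (simp add: algebra_simps)
        also have "q \<dots> = c * q (u + t *\<^sub>R y)" by (rule sublinear_scale[OF q c])
        finally show ?thesis using c0 by (simp add: field_simps)
      qed
      hence "q' (c *\<^sub>R u) / c \<le> q' u" by (rule great)
      thus ?thesis using c0 by (simp add: field_simps)
    qed
  qed
  ultimately have "q' = q" by (intro minimal)
  thus ?thesis using low[of 1 x] by simp
qed

lemma hahn_banach_sublinear:
  fixes p :: "'a::real_vector \<Rightarrow> real"
  assumes p: "sublinear p"
  obtains f where "linear f" "\<And>x. f x \<le> p x"
proof -
  define A where "A = {q. sublinear q \<and> q \<le> p}"
  define P where "P q q' \<longleftrightarrow> q' \<le> q" for q q' :: "'a \<Rightarrow> real"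
  have "\<exists>m\<in>A. \<forall>a\<in>A. P m a \<longrightarrow> a = m"
  proof (rule predicate_Zorn)
    show "partial_order_on A (relation_of P A)"
      by (rule partial_order_on_relation_ofI) (auto simp: P_def)
    fix C assume "C \<in> Chains (relation_of P A)"
    hence C: "C \<subseteq> A" "\<And>q q'. q \<in> C \<Longrightarrow> q' \<in> C \<Longrightarrow> q \<le> q' \<or> q' \<le> q"
      unfolding Chains_def relation_of_def P_def by auto
    show "\<exists>u\<in>A. \<forall>a\<in>C. P a u"
    proof (cases "C = {}")
      case True thus ?thesis using p by (auto simp: A_def)
    next
      case False
      then obtain q0 where q0: "q0 \<in> C" by blast
      have sub: "\<And>q. q \<in> C \<Longrightarrow> sublinear q \<and> q \<le> p" using C(1) by (auto simp: A_def)
      have inf1: "sublinear (\<lambda>x. INF q\<in>C. q x)"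
        by (rule sublinear_INF_chain(1)[of C p]; fact False sub C(2))
      have inf2: "(\<lambda>x. INF q\<in>C. q x) \<le> q" if "q \<in> C" for q
        by (rule sublinear_INF_chain(2)[of C p]; fact False sub C(2) that)
      have "(\<lambda>x. INF q\<in>C. q x) \<le> p" using inf2[OF q0] sub[OF q0] by (meson order_trans)
      thus ?thesis using inf1 inf2 by (intro bexI[of _ "\<lambda>x. INF q\<in>C. q x"]) (auto simp: A_def P_def)
    qed
  qed
  then obtain q where q: "sublinear q" "q \<le> p" and m: "\<And>a. a \<in> A \<Longrightarrow> a \<le> q \<Longrightarrow> a = q"
    by (auto simp: A_def P_def)
  have min: "q' = q" if "sublinear q'" "q' \<le> q" for q'
    using m[of q'] that q by (auto simp: A_def intro: order_trans)
  have add: "q (x + y) = q x + q y" for x y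
    using minimal_sublinear_superadditive[OF q(1) min, of x y] sublinear_add[OF q(1), of x y] by simp
  have neg: "q (- x) = - q x" for x using add[of x "- x"] sublinear_0[OF q(1)] by simp
  have "linear q"
  proof (rule linearI)
    fix c x
    show "q (c *\<^sub>R x) = c *\<^sub>R q x"
    proof (cases "0 \<le> c")
      case True thus ?thesis using sublinear_scale[OF q(1)] by simp
    next
      case False
      hence "q ((- c) *\<^sub>R x) = (- c) * q x" by (intro sublinear_scale[OF q(1)]) simp
      thus ?thesis using neg[of "c *\<^sub>R x"] by simp
    qed
  qed (rule add)
  thus ?thesis using that[of q] q(2) by (auto simp: le_fun_def)
qed

text \<open>
  Apply the preceding lemma to \<open>p x = (INF t\<ge>0, c\<in>C. norm (x + t *\<^sub>R c) - t * \<eta>)\<close>. A linear \<open>f \<le> p\<close>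
  satisfies \<open>f x \<le> norm x\<close> (take \<open>t = 0\<close>) and \<open>f (- c) \<le> - \<eta>\<close> (take \<open>t = 1\<close>).
\<close>

lemma separate_convex_from_0:
  fixes C :: "'a::real_normed_vector set"
  assumes C: "convex C" "C \<noteq> {}" and \<eta>: "0 < \<eta>" "\<And>c. c \<in> C \<Longrightarrow> \<eta> \<le> norm c"
  obtains \<phi> :: "'a \<Rightarrow>\<^sub>L real" where "\<And>c. c \<in> C \<Longrightarrow> \<eta> \<le> blinfun_apply \<phi> c"
proof -
  let ?g = "\<lambda>x (t, c). norm (x + t *\<^sub>R c) - t * \<eta>"
  let ?I = "{0..} \<times> C :: (real \<times> 'a) set"
  define p where "p x = (INF tc\<in>?I. ?g x tc)" for x
  have bdd: "bdd_below (?g x ` ?I)" for x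
  proof (rule bdd_belowI2[of _ "- norm x"])
    fix tc assume "tc \<in> ?I"
    then obtain t c where tc: "tc = (t, c)" "0 \<le> t" "c \<in> C" by auto
    have "t * \<eta> \<le> t * norm c" using tc \<eta>(2) by (intro mult_left_mono) auto
    also have "\<dots> \<le> norm (x + t *\<^sub>R c) + norm x"
      using norm_triangle_ineq4[of "x + t *\<^sub>R c" x] tc(2) by simp
    finally show "- norm x \<le> ?g x tc" by (simp add: tc)
  qed
  have low: "p x \<le> norm (x + t *\<^sub>R c) - t * \<eta>" if "0 \<le> t" "c \<in> C" for x t c
    using cINF_lower[OF bdd[of x], of "(t, c)"] that by (simp add: p_def)
  have great: "r \<le> p x" if "\<And>t c. 0 \<le> t \<Longrightarrow> c \<in> C \<Longrightarrow> r \<le> norm (x + t *\<^sub>R c) - t * \<eta>" for r x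
    unfolding p_def using that C(2) by (intro cINF_greatest) auto
  obtain c0 where c0: "c0 \<in> C" using C by blast
  have "sublinear p"
    unfolding sublinear_def
  proof (intro conjI allI impI)
    fix u v
    have "p (u + v) - (norm (u + t *\<^sub>R c) - t * \<eta>) \<le> norm (v + s *\<^sub>R d) - s * \<eta>"
      if st: "0 \<le> t" "0 \<le> s" "c \<in> C" "d \<in> C" for s t c d
    proof -
      obtain e where e: "e \<in> C" "(t + s) *\<^sub>R e = t *\<^sub>R c + s *\<^sub>R d"
      proof (cases "t + s = 0")
        case True
        hence "t = 0" "s = 0" using st by auto
        thus ?thesis using that[of c0] c0 by simp
      next
        case False
        hence pos: "0 < t + s" using st by simp
        have "(t / (t + s)) *\<^sub>R c + (s / (t + s)) *\<^sub>R d \<in> C"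
          using st pos by (intro convexD[OF C(1)]) (auto simp: add_divide_distrib[symmetric])
        moreover have "(t + s) *\<^sub>R ((t / (t + s)) *\<^sub>R c + (s / (t + s)) *\<^sub>R d) = t *\<^sub>R c + s *\<^sub>R d"
          using pos by (simp add: scaleR_add_right)
        ultimately show ?thesis by (rule that)
      qed
      have "p (u + v) \<le> norm ((u + v) + (t + s) *\<^sub>R e) - (t + s) * \<eta>" using st e by (intro low) auto
      also have "(u + v) + (t + s) *\<^sub>R e = (u + t *\<^sub>R c) + (v + s *\<^sub>R d)" by (simp add: e)
      also have "norm \<dots> \<le> norm (u + t *\<^sub>R c) + norm (v + s *\<^sub>R d)" by (rule norm_triangle_ineq)
      finally show ?thesis by (simp add: algebra_simps)
    qed
    hence le: "p (u + v) - (norm (u + t *\<^sub>R c) - t * \<eta>) \<le> p v" if "0 \<le> t" "c \<in> C" for t c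
      using that by (intro great)
    have "p (u + v) - p v \<le> norm (u + t *\<^sub>R c) - t * \<eta>" if "0 \<le> t" "c \<in> C" for t c
      using le[OF that] by linarith
    hence "p (u + v) - p v \<le> p u" by (rule great)
    thus "p (u + v) \<le> p u + p v" by simp
  next
    fix k :: real and u assume k: "0 \<le> k"
    show "p (k *\<^sub>R u) \<le> k * p u"
    proof (cases "k = 0")
      case True thus ?thesis using low[of 0 c0 0] c0 by simp
    next
      case False
      hence k0: "0 < k" using k by simp
      have "p (k *\<^sub>R u) / k \<le> norm (u + t *\<^sub>R c) - t * \<eta>" if "0 \<le> t" "c \<in> C" for t c
      proof -
        have "p (k *\<^sub>R u) \<le> norm (k *\<^sub>R u + (k * t) *\<^sub>R c) - (k * t) * \<eta>" using that k by (intro low) auto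
        also have "k *\<^sub>R u + (k * t) *\<^sub>R c = k *\<^sub>R (u + t *\<^sub>R c)" by (simp add: algebra_simps)
        also have "norm \<dots> = k * norm (u + t *\<^sub>R c)" using k by simp
        finally show ?thesis using k0 by (simp add: field_simps)
      qed
      hence "p (k *\<^sub>R u) / k \<le> p u" by (rule great)
      thus ?thesis using k0 by (simp add: field_simps)
    qed
  qed
  then obtain f where f: "linear f" "\<And>x. f x \<le> p x" by (rule hahn_banach_sublinear) blast
  have fle: "f x \<le> norm x" for x using f(2)[of x] low[of 0 c0 x] c0 by simp
  have "norm (f x) \<le> norm x * 1" for x
    using fle[of x] fle[of "- x"] linear_neg[OF f(1), of x] by (simp add: abs_le_iff)
  hence bl: "bounded_linear f"
    using f(1) by (intro bounded_linear_intro[of f 1]) (auto simp: linear_add linear_scale)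
  have "\<eta> \<le> f c" if "c \<in> C" for c
    using f(2)[of "- c"] low[of 1 c "- c"] that linear_neg[OF f(1), of c] by simp
  thus ?thesis using that[of "Blinfun f"] by (simp add: bounded_linear_Blinfun_apply bl)
qed

text \<open>
  Mazur's theorem for cluster points. The assumption tests one functional at a time, which is
  weaker than being a cluster point in the weak topology.
\<close>

lemma weak_cluster_point_in_closure:
  fixes C :: "'a::real_normed_vector set" and z :: "nat \<Rightarrow> 'a"
  assumes C: "convex C" and z: "\<And>n. N \<le> n \<Longrightarrow> z n \<in> C"
    and y: "\<And>(\<phi>::'a \<Rightarrow>\<^sub>L real) e N. 0 < e \<Longrightarrow> \<exists>n\<ge>N. \<bar>blinfun_apply \<phi> (z n) - blinfun_apply \<phi> y\<bar> < e"
  shows "y \<in> closure C"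
proof (rule ccontr)
  assume "y \<notin> closure C"
  then obtain e where e: "0 < e" "\<And>c. c \<in> C \<Longrightarrow> e \<le> dist c y"
    unfolding closure_approachable by (auto simp: not_less)
  have "convex ((\<lambda>c. c - y) ` C)" using C by (simp add: convex_translation_subtract_eq)
  moreover have "(\<lambda>c. c - y) ` C \<noteq> {}" using z[OF order_refl] by auto
  ultimately obtain \<phi> :: "'a \<Rightarrow>\<^sub>L real" where \<phi>: "\<And>c. c \<in> (\<lambda>c. c - y) ` C \<Longrightarrow> e \<le> blinfun_apply \<phi> c"
    by (rule separate_convex_from_0[where \<eta> = e]) (use e in \<open>auto simp: dist_norm\<close>)
  obtain n where n: "n \<ge> N" "\<bar>blinfun_apply \<phi> (z n) - blinfun_apply \<phi> y\<bar> < e"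
    using y[OF e(1)] by blast
  have "e \<le> blinfun_apply \<phi> (z n - y)" using \<phi> z[OF n(1)] by blast
  thus False using n(2) by (simp add: blinfun.bilinear_simps)
qed

lemma weakly_compact_cluster_point:
  fixes K :: "'a::real_normed_vector set" and w :: "nat \<Rightarrow> 'a"
  assumes K: "compactin weak_topology K" and w: "\<And>n. w n \<in> K"
  obtains y where "\<And>(\<phi>::'a \<Rightarrow>\<^sub>L real) e N. 0 < e \<Longrightarrow> \<exists>n\<ge>N. \<bar>blinfun_apply \<phi> (w n) - blinfun_apply \<phi> y\<bar> < e"
proof (rule ccontr)
  assume "\<not> thesis"
  hence "\<forall>y. \<exists>(\<phi>::'a \<Rightarrow>\<^sub>L real) e N. 0 < e \<and> (\<forall>n\<ge>N. e \<le> \<bar>blinfun_apply \<phi> (w n) - blinfun_apply \<phi> y\<bar>)"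
    using that by (metis not_less)
  then obtain \<phi> :: "'a \<Rightarrow> 'a \<Rightarrow>\<^sub>L real" and e N where
    far: "\<And>y. 0 < e y" "\<And>y n. N y \<le> n \<Longrightarrow> e y \<le> \<bar>blinfun_apply (\<phi> y) (w n) - blinfun_apply (\<phi> y) y\<bar>"
    by metis
  define U where "U y = {x. \<bar>blinfun_apply (\<phi> y) x - blinfun_apply (\<phi> y) y\<bar> < e y}" for y
  have op: "openin weak_topology (U y)" for y
  proof -
    let ?V = "{g :: ('a \<Rightarrow>\<^sub>L real) \<Rightarrow> real. \<bar>g (\<phi> y) - blinfun_apply (\<phi> y) y\<bar> < e y}"
    have "open ?V"
      by (intro open_Collect_less continuous_intros continuous_on_product_coordinates)
    moreover have "U y = (\<lambda>x. \<lambda>\<phi>::'a \<Rightarrow>\<^sub>L real. blinfun_apply \<phi> x) -` ?V \<inter> UNIV"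
      by (auto simp: U_def)
    ultimately show ?thesis unfolding weak_topology_def openin_pullback_topology by auto
  qed
  have "K \<subseteq> \<Union> (U ` K)" using far(1) by (auto simp: U_def)
  then obtain F where F: "finite F" "F \<subseteq> U ` K" "K \<subseteq> \<Union>F"
    using K op unfolding compactin_def by (metis (no_types, lifting) imageE)
  then obtain Y where Y: "finite Y" "F = U ` Y" by (meson finite_subset_image)
  define M where "M = Max (insert 0 (N ` Y))"
  obtain y where y: "y \<in> Y" "w M \<in> U y" using F(3) w[of M] Y(2) by auto
  have "N y \<le> M" using y Y by (auto simp: M_def intro: Max_ge)
  thus False using far(2)[of y M] y(2) by (simp add: U_def)
qed

text \<open>
  Let \<open>y\<close> be a weak cluster point of the decreasing sequence \<open>T (s n)\<close>. The sets \<open>{x. 0 \<le> x}\<close> and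
  \<open>{x. x \<le> T (s k)}\<close> are closed and convex and contain the sequence from some index on, so
  \<open>0 \<le> y \<le> T (s k)\<close> for all \<open>k\<close>, and \<open>y = 0\<close>. Now Mazur's theorem for the convex set of all elements
  above some \<open>T (s n)\<close> yields such elements of arbitrarily small norm.
\<close>

theorem weakly_compact_sigma_oc_norm_null:
  fixes T :: "'a::banach_lattice \<Rightarrow>\<^sub>L 'a"
  assumes T: "weakly_compact_op T" "sigma_order_continuous T" and s: "seq_decreases_to s 0"
  shows "(\<lambda>n. blinfun_apply T (s n)) \<longlonglongrightarrow> 0"
proof -
  note sd = seq_decreases_to_0D[OF s]
  \<comment> \<open>Scales the sequence into the unit ball.\<close>
  define c where "c = 1 / (norm (s 0) + 1)"
  have c: "0 < c" "c * norm (s 0) \<le> 1" by (auto simp: c_def field_simps add_pos_nonneg)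
  define z where "z n = blinfun_apply (c *\<^sub>R T) (s n)" for n
  have "sigma_order_continuous (c *\<^sub>R T)" using T(2) c(1) by (rule sigma_oc_scaleR)
  hence "seq_decreases_to z 0" unfolding z_def using s by (rule sigma_oc_D)
  note zd = seq_decreases_to_0D[OF this]
  let ?K = "weak_topology closure_of (blinfun_apply T ` cball 0 1)"
  have "z n \<in> ?K" for n
  proof -
    have "norm (s n) \<le> norm (s 0)" using sd(1,2) by (intro norm_mono_nonneg) (auto simp: decseq_def)
    hence "norm (c *\<^sub>R s n) \<le> 1" using c by (simp add: mult_left_mono order_trans[OF mult_left_mono c(2)])
    moreover have "z n = blinfun_apply T (c *\<^sub>R s n)" by (simp add: z_def blinfun.bilinear_simps)
    ultimately have "z n \<in> blinfun_apply T ` cball 0 1" by auto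
    moreover have "blinfun_apply T ` cball 0 1 \<subseteq> ?K"
      by (rule closure_of_subset) (simp add: weak_topology_def topspace_pullback_topology)
    ultimately show ?thesis by blast
  qed
  then obtain y where y: "\<And>(\<phi>::'a \<Rightarrow>\<^sub>L real) e N. 0 < e \<Longrightarrow>
      \<exists>n\<ge>N. \<bar>blinfun_apply \<phi> (z n) - blinfun_apply \<phi> y\<bar> < e"
    using T(1) unfolding weakly_compact_op_def by (metis weakly_compact_cluster_point)
  have cl: "closed {x::'a. a \<le> x}" "closed {x::'a. x \<le> a}" for a
  proof -
    have "closed ((\<lambda>x. x - a) -` {x. 0 \<le> x})" "closed ((\<lambda>x. a - x) -` {x. 0 \<le> x})"
      by (intro closed_vimage closed_nonneg continuous_intros)+
    thus "closed {x. a \<le> x}" "closed {x. x \<le> a}" by (simp_all add: vimage_def)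
  qed
  have cv: "convex {x::'a. a \<le> x}" "convex {x::'a. x \<le> a}" for a
  proof -
    have eq: "u *\<^sub>R a + v *\<^sub>R a = a" if "u + v = 1" for u v
      using that by (simp flip: scaleR_add_left)
    have "a \<le> u *\<^sub>R x + v *\<^sub>R y" if "0 \<le> u" "0 \<le> v" "u + v = 1" "a \<le> x" "a \<le> y" for u v x y
      by (subst eq[OF that(3), symmetric]) (use that in \<open>intro add_mono scaleR_left_mono\<close>)
    moreover have "u *\<^sub>R x + v *\<^sub>R y \<le> a" if "0 \<le> u" "0 \<le> v" "u + v = 1" "x \<le> a" "y \<le> a" for u v x y
      by (subst eq[OF that(3), symmetric]) (use that in \<open>intro add_mono scaleR_left_mono\<close>)
    ultimately show "convex {x::'a. a \<le> x}" "convex {x::'a. x \<le> a}"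
      unfolding convex_def by simp_all
  qed
  have "y \<in> closure {x. 0 \<le> x}"
    using zd(2) y by (intro weak_cluster_point_in_closure[OF cv(1), of 0 z]) auto
  hence y0: "0 \<le> y" using cl(1)[of 0] by (simp add: closure_closed)
  have "y \<le> z k" for k
  proof -
    have "y \<in> closure {x. x \<le> z k}"
      using zd(1) y by (intro weak_cluster_point_in_closure[OF cv(2), of k z]) (auto simp: decseq_def)
    thus ?thesis using cl(2)[of "z k"] by (simp add: closure_closed)
  qed
  hence "y = 0" using zd(3) y0 by (intro antisym) blast+
  define C where "C = {x. \<exists>n. z n \<le> x}"
  have "convex C"
    unfolding convex_def
  proof (intro ballI allI impI)
    fix x x' and u v :: real
    assume "x \<in> C" "x' \<in> C" and uv: "0 \<le> u" "0 \<le> v" "u + v = 1"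
    then obtain m n where mn: "z m \<le> x" "z n \<le> x'" by (auto simp: C_def)
    have "z (max m n) = u *\<^sub>R z (max m n) + v *\<^sub>R z (max m n)" using uv(3) by (simp flip: scaleR_add_left)
    also have "\<dots> \<le> u *\<^sub>R x + v *\<^sub>R x'"
      using uv order_trans[OF decseqD[OF zd(1), of m "max m n"] mn(1)]
        order_trans[OF decseqD[OF zd(1), of n "max m n"] mn(2)]
      by (intro add_mono scaleR_left_mono) auto
    finally show "u *\<^sub>R x + v *\<^sub>R x' \<in> C" by (auto simp: C_def)
  qed
  hence "0 \<in> closure C"
    using y unfolding \<open>y = 0\<close> by (intro weak_cluster_point_in_closure[of C 0 z]) (auto simp: C_def)
  have "z \<longlonglongrightarrow> 0"
  proof (rule LIMSEQ_I)
    fix e :: real assume "0 < e"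
    then obtain x n where x: "z n \<le> x" "norm x < e"
      using \<open>0 \<in> closure C\<close> unfolding closure_approachable C_def by (auto simp: dist_norm)
    have "norm (z m - 0) < e" if "m \<ge> n" for m
    proof -
      have "z m \<le> x" using zd(1) that x(1) by (auto simp: decseq_def intro: order_trans)
      hence "norm (z m) \<le> norm x" using zd(2) by (intro norm_mono_nonneg)
      thus ?thesis using x(2) by simp
    qed
    thus "\<exists>n. \<forall>m\<ge>n. norm (z m - 0) < e" by blast
  qed
  hence "(\<lambda>n. (1/c) *\<^sub>R z n) \<longlonglongrightarrow> (1/c) *\<^sub>R 0" by (intro tendsto_intros)
  thus ?thesis using c(1) by (simp add: z_def blinfun.bilinear_simps)
qed

section \<open>Resolvents of positive operators\<close>

primrec op_power :: "('a::real_normed_vector \<Rightarrow>\<^sub>L 'a) \<Rightarrow> nat \<Rightarrow> ('a \<Rightarrow>\<^sub>L 'a)" where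
  "op_power U 0 = id_blinfun"
| "op_power U (Suc n) = U o\<^sub>L op_power U n"

lemma op_power_commute: "blinfun_apply (op_power U n) (blinfun_apply U x) = blinfun_apply U (blinfun_apply (op_power U n) x)"
  by (induction n) auto

lemma norm_op_power_le: "norm (op_power U n) \<le> norm U ^ n"
proof (induction n)
  case (Suc n)
  have "norm (op_power U (Suc n)) \<le> norm U * norm (op_power U n)" by (simp add: norm_blinfun_compose)
  also have "\<dots> \<le> norm U * norm U ^ n" using Suc by (intro mult_left_mono) auto
  finally show ?case by simp
qed (simp add: norm_blinfun_id_le)

lemma positive_op_op_power: "positive_op T \<Longrightarrow> positive_op (op_power T n)"
  by (induction n) (auto intro: positive_op_id positive_op_compose)

lemma sigma_oc_op_power: "sigma_order_continuous T \<Longrightarrow> sigma_order_continuous (op_power T n)"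
  by (induction n) (auto intro: sigma_oc_id sigma_oc_compose)

lemma op_power_scaleR: "op_power (c *\<^sub>R U) n = c ^ n *\<^sub>R op_power U n"
  by (induction n) (auto intro!: blinfun_eqI simp: blinfun.bilinear_simps)

lemma neumann_series:
  fixes U :: "'a::banach \<Rightarrow>\<^sub>L 'a"
  assumes b: "\<And>n. norm (op_power U n) \<le> C * q ^ n" and q: "0 \<le> q" "q < 1"
  obtains V where "op_power U sums V"
    "\<And>x. blinfun_apply V x - blinfun_apply U (blinfun_apply V x) = x"
    "\<And>x. blinfun_apply V (x - blinfun_apply U x) = x"
proof -
  have "summable (\<lambda>n. norm (op_power U n))"
  proof (rule summable_comparison_test')
    show "summable (\<lambda>n. C * q ^ n)" using q by (intro summable_mult summable_geometric) simp
    show "norm (norm (op_power U n)) \<le> C * q ^ n" for n using b by simp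
  qed
  hence "summable (op_power U)" by (rule summable_norm_cancel)
  then obtain V where V: "op_power U sums V" by (auto simp: summable_def)
  have shift: "(\<lambda>n. op_power U (Suc n)) sums (V - id_blinfun)"
    using V by (subst sums_Suc_iff) simp
  have 1: "V x - U (V x) = x" for x
  proof -
    have "(\<lambda>n. U o\<^sub>L op_power U n) sums (U o\<^sub>L V)"
      by (intro bounded_linear.sums[OF _ V] bounded_bilinear.bounded_linear_right
          bounded_bilinear_blinfun_compose)
    hence "U o\<^sub>L V = V - id_blinfun" using shift sums_unique2 by fastforce
    hence "blinfun_apply (U o\<^sub>L V) x = blinfun_apply (V - id_blinfun) x" by simp
    thus ?thesis by (simp add: blinfun.bilinear_simps)
  qed
  have 2: "V (x - U x) = x" for x
  proof -
    have "(\<lambda>n. op_power U n (U x)) sums V (U x)"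
      by (rule bounded_linear.sums[OF blinfun.bounded_linear_left V])
    moreover have "(\<lambda>n. op_power U (Suc n) x) sums (V - id_blinfun) x"
      by (rule bounded_linear.sums[OF blinfun.bounded_linear_left shift])
    ultimately have "V (U x) = (V - id_blinfun) x"
      using sums_unique2 by (fastforce simp: op_power_commute)
    thus ?thesis by (simp add: blinfun.bilinear_simps)
  qed
  show thesis using that V 1 2 by blast
qed

text \<open>
  The resolvent at a real point, on the space itself instead of its complexification, since
  positivity refers to the real space.
\<close>

definition resolvent_op :: "('a::real_normed_vector \<Rightarrow>\<^sub>L 'a) \<Rightarrow> real \<Rightarrow> ('a \<Rightarrow>\<^sub>L 'a) \<Rightarrow> bool" where
  "resolvent_op T l S \<longleftrightarrow> (\<forall>x. S (l *\<^sub>R x - T x) = x) \<and> (\<forall>x. l *\<^sub>R S x - T (S x) = x)"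

lemma resolvent_opD:
  assumes "resolvent_op T l S"
  shows "S (l *\<^sub>R x - T x) = x" "l *\<^sub>R S x - T (S x) = x" "T (S x) = l *\<^sub>R S x - x"
  using assms by (auto simp: resolvent_op_def algebra_simps)

lemma resolvent_op_commute: "resolvent_op T l S \<Longrightarrow> S (T x) = T (S x)"
  using resolvent_opD(1)[of T l S x] resolvent_opD(3)[of T l S x]
  by (simp add: blinfun.bilinear_simps algebra_simps)

lemma resolvent_identity:
  assumes "resolvent_op T a S" "resolvent_op T b S'"
  shows "S x - S' x = (b - a) *\<^sub>R S (S' x)"
proof -
  have "S x - S' x = S (b *\<^sub>R S' x - T (S' x)) - S (a *\<^sub>R S' x - T (S' x))"
    using assms by (simp add: resolvent_op_def)
  thus ?thesis by (simp add: blinfun.bilinear_simps algebra_simps)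
qed

lemma resolvent_op_unique:
  assumes "resolvent_op T a S" "resolvent_op T a S'"
  shows "S = S'"
  using resolvent_identity[OF assms] by (intro blinfun_eqI) simp

lemma resolvent_op_ge:
  assumes "positive_op T" "positive_op S" "resolvent_op T l S" "0 \<le> x"
  shows "x \<le> l *\<^sub>R S x" "T (S x) \<le> l *\<^sub>R S x"
  using resolvent_opD(3)[OF assms(3), of x] positive_op_nonneg[OF assms(1) positive_op_nonneg[OF assms(2,4)]]
    assms(4) by auto

lemma resolvent_op_mono:
  fixes A B :: "'a::banach_lattice \<Rightarrow>\<^sub>L 'a"
  assumes AB: "positive_op (B - A)"
    and RA: "positive_op SA" "resolvent_op A l SA" and RB: "positive_op SB" "resolvent_op B l SB"
  shows "SB x - SA x = SA ((B - A) (SB x))" "0 \<le> x \<Longrightarrow> SA x \<le> SB x"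
proof -
  have "SA (l *\<^sub>R SB x - A (SB x)) = SB x" by (rule resolvent_opD(1)[OF RA(2)])
  moreover have "SA (l *\<^sub>R SB x - B (SB x)) = SA x" by (simp add: resolvent_opD(2)[OF RB(2)])
  ultimately show eq: "SB x - SA x = SA ((B - A) (SB x))"
    by (simp add: blinfun.bilinear_simps algebra_simps)
  show "SA x \<le> SB x" if "0 \<le> x"
  proof -
    have "0 \<le> SB x - SA x"
      unfolding eq by (intro positive_op_nonneg[OF RA(1)] positive_op_nonneg[OF AB] positive_op_nonneg[OF RB(1)] that)
    thus ?thesis by (simp only: diff_ge_0_iff_ge)
  qed
qed

text \<open>
  \<open>l *\<^sub>R S\<close> dominates both the identity and \<open>T S = S T\<close>; iterate. So a single positive resolvent bounds
  the growth of the powers of \<open>T\<close>.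
\<close>

lemma op_power_le_resolvent:
  assumes T: "positive_op T" and S: "positive_op S" "resolvent_op T l S" and l: "0 < l"
  shows "0 \<le> x \<Longrightarrow> op_power T n x \<le> l ^ Suc n *\<^sub>R S x"
proof (induction n arbitrary: x)
  case 0 thus ?case using resolvent_op_ge(1)[OF T S] by simp
next
  case (Suc n)
  have "op_power T (Suc n) x = op_power T n (T x)" by (simp add: op_power_commute)
  also have "\<dots> \<le> l ^ Suc n *\<^sub>R S (T x)" using Suc positive_op_nonneg[OF T] by blast
  also have "\<dots> \<le> l ^ Suc n *\<^sub>R (l *\<^sub>R S x)"
    unfolding resolvent_op_commute[OF S(2)] using resolvent_op_ge(2)[OF T S Suc.prems] l
    by (intro scaleR_left_mono) auto
  finally show ?case by (simp add: mult.commute)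
qed

lemma norm_op_power_le_resolvent:
  assumes T: "positive_op T" and S: "positive_op S" "resolvent_op T l S" and l: "0 < l"
  shows "norm (op_power T n) \<le> l * norm S * l ^ n"
proof (rule norm_blinfun_bound)
  show "0 \<le> l * norm S * l ^ n" using l by simp
  fix x
  have "\<bar>op_power T n x\<bar> \<le> op_power T n \<bar>x\<bar>" by (intro positive_op_abs positive_op_op_power T)
  also have "\<dots> \<le> l ^ Suc n *\<^sub>R S \<bar>x\<bar>" by (intro op_power_le_resolvent[OF T S l] abs_ge_zero)
  finally have "norm \<bar>op_power T n x\<bar> \<le> norm (l ^ Suc n *\<^sub>R S \<bar>x\<bar>)" by (intro norm_mono_nonneg) auto
  also have "\<dots> = l ^ Suc n * norm (S \<bar>x\<bar>)" using l by simp
  also have "\<dots> \<le> l ^ Suc n * (norm S * norm \<bar>x\<bar>)" using l by (intro mult_left_mono norm_blinfun) auto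
  finally show "norm (op_power T n x) \<le> l * norm S * l ^ n * norm x" by (simp add: norm_abs_eq mult_ac)
qed

text \<open>
  The convergence of the partial sums is recorded because \<open>\<sigma>\<close>-order continuity of \<open>T\<close> passes to the
  resolvent through them.
\<close>

lemma resolvent_op_from_neumann:
  assumes T: "positive_op T" and l: "0 < l"
    and b: "\<And>n. norm (op_power T n) \<le> C * m ^ n" and m: "0 \<le> m" "m < l"
  obtains S where "positive_op S" "resolvent_op T l S"
    "(\<lambda>n. (1/l) *\<^sub>R (\<Sum>k<n. (1/l) ^ k *\<^sub>R op_power T k)) \<longlonglongrightarrow> S"
proof -
  let ?U = "(1/l) *\<^sub>R T"
  have bound: "norm (op_power ?U n) \<le> C * (m / l) ^ n" for n
    using b[of n] l by (simp add: op_power_scaleR power_divide field_simps)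
  have ml: "0 \<le> m / l" "m / l < 1" using m l by auto
  obtain V where V: "op_power ?U sums V" "\<And>x. V x - ?U (V x) = x" "\<And>x. V (x - ?U x) = x"
    using neumann_series[OF bound ml] by blast
  have lim: "(\<lambda>n. \<Sum>k<n. (1/l) ^ k *\<^sub>R op_power T k) \<longlonglongrightarrow> V"
    using V(1) by (simp add: sums_def op_power_scaleR)
  hence lim': "(\<lambda>n. (1/l) *\<^sub>R (\<Sum>k<n. (1/l) ^ k *\<^sub>R op_power T k)) \<longlonglongrightarrow> (1/l) *\<^sub>R V"
    by (intro tendsto_intros)
  have "positive_op (\<Sum>k<n. (1/l) ^ k *\<^sub>R op_power T k)" for n
    using l by (induction n) (auto intro!: positive_op_add positive_op_scaleR positive_op_op_power T
        simp: positive_op_def[of 0])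
  hence "positive_op V" by (intro tendsto_positive_op[OF lim]) auto
  moreover have "resolvent_op T l ((1/l) *\<^sub>R V)"
    unfolding resolvent_op_def
  proof (intro conjI allI)
    fix x
    have "((1/l) *\<^sub>R V) (l *\<^sub>R x - T x) = V (x - ?U x)" using l by (simp add: blinfun.bilinear_simps algebra_simps)
    thus "((1/l) *\<^sub>R V) (l *\<^sub>R x - T x) = x" using V(3) by simp
    have "l *\<^sub>R ((1/l) *\<^sub>R V) x - T (((1/l) *\<^sub>R V) x) = V x - ?U (V x)"
      using l by (simp add: blinfun.bilinear_simps)
    thus "l *\<^sub>R ((1/l) *\<^sub>R V) x - T (((1/l) *\<^sub>R V) x) = x" using V(2) by simp
  qed
  ultimately show thesis using l lim' by (intro that) (auto intro: positive_op_scaleR)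
qed

text \<open>
  With \<open>S\<close> the resolvent at \<open>l\<close>, one has \<open>(l - d) - T = (l - T) (1 - d S)\<close>, and the Neumann series of
  the second factor has positive terms. So positivity of the resolvent extends to the left for as
  long as the norm stays bounded.
\<close>

lemma resolvent_op_below:
  assumes S: "positive_op S" "resolvent_op T l S" and d: "0 \<le> d" "d * norm S < 1"
  obtains S' where "positive_op S'" "resolvent_op T (l - d) S'"
proof -
  let ?U = "d *\<^sub>R S"
  have U: "norm (op_power ?U n) \<le> 1 * (d * norm S) ^ n" for n
    using norm_op_power_le[of ?U n] d by simp
  have q: "0 \<le> d * norm S" using d by simp
  obtain V where V: "op_power ?U sums V" "\<And>x. V x - ?U (V x) = x" "\<And>x. V (x - ?U x) = x"
    using neumann_series[OF U q d(2)] by blast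
  have "positive_op (\<Sum>k<n. op_power ?U k)" for n
    using d by (induction n) (auto intro!: positive_op_add positive_op_scaleR positive_op_op_power S(1)
        simp: positive_op_def[of 0])
  hence "positive_op V" using V(1) unfolding sums_def by (intro tendsto_positive_op[of _ V sequentially]) auto
  hence pos: "positive_op (S o\<^sub>L V)" "positive_op (V o\<^sub>L S)" using S(1) by (auto intro: positive_op_compose)
  have left: "(l - d) *\<^sub>R S (V x) - T (S (V x)) = x" for x
    using V(2)[of x] resolvent_opD(2)[OF S(2), of "V x"]
    by (simp add: blinfun.bilinear_simps algebra_simps)
  have right: "V (S ((l - d) *\<^sub>R x - T x)) = x" for x
  proof -
    have "S ((l - d) *\<^sub>R x - T x) = x - ?U x"
      using resolvent_opD(1)[OF S(2), of x] by (simp add: blinfun.bilinear_simps algebra_simps)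
    thus ?thesis using V(3) by simp
  qed
  have "V (S x) = S (V x)" for x
    using right[of "S (V x)"] left[of x] by simp
  hence "resolvent_op T (l - d) (S o\<^sub>L V)"
    unfolding resolvent_op_def using left right by simp
  thus thesis using that pos by blast
qed

section \<open>The spectral radius of a positive operator\<close>

text \<open>
  Multiplication by a complex scalar is not isometric up to scaling in the product norm; the
  constant \<open>4\<close> is crude but enough for convergence.
\<close>

lemma norm_cmul_le: "norm (cmul c :: ('a::banach \<times> 'a) \<Rightarrow>\<^sub>L _) \<le> 4 * cmod c"
proof (rule norm_blinfun_bound)
  fix v :: "'a \<times> 'a"
  obtain x y where v: "v = (x, y)" by (cases v)
  have n: "norm x \<le> norm v" "norm y \<le> norm v" using norm_fst_le[of x y] norm_snd_le[of y x] by (auto simp: v)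
  have r: "\<bar>Re c\<bar> \<le> cmod c" "\<bar>Im c\<bar> \<le> cmod c" by (rule abs_Re_le_cmod abs_Im_le_cmod)+
  have p: "norm (a *\<^sub>R w) \<le> cmod c * norm v" if "\<bar>a\<bar> \<le> cmod c" "norm w \<le> norm v" for a and w :: 'a
    using that by (simp add: mult_mono)
  have "cmul c v = (Re c *\<^sub>R x - Im c *\<^sub>R y, Im c *\<^sub>R x + Re c *\<^sub>R y)" by (simp add: cmul.rep_eq v)
  hence "norm (cmul c v) \<le> norm (Re c *\<^sub>R x - Im c *\<^sub>R y) + norm (Im c *\<^sub>R x + Re c *\<^sub>R y)"
    by (simp add: norm_Pair_le)
  also have "\<dots> \<le> (norm (Re c *\<^sub>R x) + norm (Im c *\<^sub>R y)) + (norm (Im c *\<^sub>R x) + norm (Re c *\<^sub>R y))"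
    by (intro add_mono norm_triangle_ineq norm_triangle_ineq4)
  also have "\<dots> \<le> (cmod c * norm v + cmod c * norm v) + (cmod c * norm v + cmod c * norm v)"
    by (intro add_mono p n r)
  finally show "norm (cmul c v) \<le> 4 * cmod c * norm v" by simp
qed simp

lemma complexify_apply: "complexify T v = (T (fst v), T (snd v))"
  by (simp add: complexify.rep_eq)

lemma norm_complexify_le: "norm (complexify T) \<le> 2 * norm T"
proof (rule norm_blinfun_bound)
  fix v :: "'a \<times> 'a"
  have "norm (complexify T v) \<le> norm (T (fst v)) + norm (T (snd v))"
    by (simp add: complexify_apply norm_Pair_le)
  also have "\<dots> \<le> norm T * norm (fst v) + norm T * norm (snd v)" by (intro add_mono norm_blinfun)
  also have "\<dots> \<le> norm T * norm v + norm T * norm v"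
    using norm_fst_le[of "fst v" "snd v"] norm_snd_le[of "snd v" "fst v"]
    by (intro add_mono mult_left_mono) auto
  finally show "norm (complexify T v) \<le> 2 * norm T * norm v" by (simp add: mult_ac)
qed simp

lemma cmul_cmul: "cmul a (cmul b v) = cmul (a * b) v"
  by (rule complexification.scale_scale)

lemma cmul_1: "cmul 1 v = v"
  by (rule complexification.scale_one)

lemma cmul_complexify: "cmul c (complexify T v) = complexify T (cmul c v)"
  by (simp add: complexify.rep_eq cmul.rep_eq blinfun.bilinear_simps)

lemma cmul_of_real: "cmul (of_real r) v = r *\<^sub>R v"
  by (cases v) (simp add: cmul.rep_eq)

lemma in_resolvent_set_if_large:
  fixes T :: "'a::banach \<Rightarrow>\<^sub>L 'a"
  assumes b: "\<And>n. norm (op_power T n) \<le> C * m ^ n" and m: "0 \<le> m" "m < cmod z"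
  shows "z \<in> resolvent_set T"
proof -
  have z: "z \<noteq> 0" using m by auto
  let ?U = "cmul (1/z) o\<^sub>L complexify T"
  have pow: "op_power ?U n = cmul ((1/z) ^ n) o\<^sub>L complexify (op_power T n)" for n
  proof (induction n)
    case 0 show ?case by (auto intro!: blinfun_eqI simp: cmul_1 complexify_apply)
  next
    case (Suc n)
    have "op_power ?U (Suc n) v = (cmul ((1/z) ^ Suc n) o\<^sub>L complexify (op_power T (Suc n))) v" for v
    proof -
      have "op_power ?U (Suc n) v = cmul (1/z) (complexify T (cmul ((1/z) ^ n) (complexify (op_power T n) v)))"
        using Suc by simp
      also have "\<dots> = cmul (1/z) (cmul ((1/z) ^ n) (complexify T (complexify (op_power T n) v)))"
        by (simp only: cmul_complexify)
      also have "\<dots> = cmul ((1/z) ^ Suc n) (complexify T (complexify (op_power T n) v))"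
        by (simp only: cmul_cmul power_Suc)
      finally show ?thesis by (simp add: complexify_apply)
    qed
    thus ?case by (intro blinfun_eqI) 
  qed
  have bound: "norm (op_power ?U n) \<le> (8 * C) * (m / cmod z) ^ n" for n
  proof -
    have "norm (op_power ?U n) \<le> norm (cmul ((1/z) ^ n) :: ('a \<times> 'a) \<Rightarrow>\<^sub>L _) * norm (complexify (op_power T n))"
      unfolding pow by (rule norm_blinfun_compose)
    also have "\<dots> \<le> (4 * cmod ((1/z) ^ n)) * (2 * norm (op_power T n))"
      by (intro mult_mono norm_cmul_le norm_complexify_le) auto
    also have "\<dots> \<le> (4 * cmod ((1/z) ^ n)) * (2 * (C * m ^ n))"
      by (intro mult_left_mono b) auto
    also have "\<dots> = (8 * C) * (m / cmod z) ^ n" by (simp add: norm_power norm_divide power_divide)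
    finally show ?thesis .
  qed
  have cz: "0 < cmod z" using m by linarith
  have q: "0 \<le> m / cmod z" using m(1) by simp
  have q': "m / cmod z < 1" using m(2) cz by (simp only: divide_less_eq_1_pos)
  obtain V where "op_power ?U sums V" and V: "\<And>x. V x - ?U (V x) = x" "\<And>x. V (x - ?U x) = x"
    by (rule neumann_series[OF bound q q']) iprover
  have zU: "cmul z (?U y) = complexify T y" for y using z by (simp add: cmul_cmul cmul_1)
  have zz: "cmul (1/z) (cmul z y) = y" "cmul z (cmul (1/z) y) = y" for y :: "'a \<times> 'a"
    using z by (simp_all add: cmul_cmul cmul_1)
  have "is_resolvent_at T z (V o\<^sub>L cmul (1/z))"
    unfolding is_resolvent_at_def
  proof (intro conjI blinfun_eqI)
    fix v :: "'a \<times> 'a"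
    have "((V o\<^sub>L cmul (1/z)) o\<^sub>L (cmul z - complexify T)) v = V (v - ?U v)"
      by (simp only: blinfun_apply_blinfun_compose blinfun.diff_left blinfun.diff_right zz)
    thus "((V o\<^sub>L cmul (1/z)) o\<^sub>L (cmul z - complexify T)) v = id_blinfun v" unfolding V(2) id_blinfun.rep_eq .
    have "((cmul z - complexify T) o\<^sub>L (V o\<^sub>L cmul (1/z))) v
        = cmul z (V (cmul (1/z) v) - ?U (V (cmul (1/z) v)))"
      unfolding blinfun.diff_right zU by (simp add: blinfun.bilinear_simps)
    also have "\<dots> = v" unfolding V(1) by (rule zz)
    finally show "((cmul z - complexify T) o\<^sub>L (V o\<^sub>L cmul (1/z))) v = id_blinfun v"
      unfolding id_blinfun.rep_eq .
  qed
  thus ?thesis by (auto simp: resolvent_set_def)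
qed

lemma is_resolvent_at_complexify_iff:
  "is_resolvent_at T (of_real l) (complexify S) \<longleftrightarrow> resolvent_op T l S"
proof
  assume "resolvent_op T l S"
  thus "is_resolvent_at T (of_real l) (complexify S)"
    unfolding is_resolvent_at_def resolvent_op_def
    by (auto intro!: blinfun_eqI simp: blinfun.bilinear_simps cmul_of_real complexify_apply)
next
  assume a: "is_resolvent_at T (of_real l) (complexify S)"
  have "(complexify S o\<^sub>L (cmul (of_real l) - complexify T)) (x, 0) = (x, 0)"
    "((cmul (of_real l) - complexify T) o\<^sub>L complexify S) (x, 0) = (x, 0)" for x
    using a by (simp_all add: is_resolvent_at_def)
  thus "resolvent_op T l S"
    by (simp add: resolvent_op_def blinfun.bilinear_simps cmul_of_real complexify_apply)
qed

lemma is_resolvent_at_unique: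
  assumes "is_resolvent_at T z S" "is_resolvent_at T z S'"
  shows "S = S'"
proof (rule blinfun_eqI)
  fix v
  have "S v = S (((cmul z - complexify T) o\<^sub>L S') v)" using assms(2) by (simp add: is_resolvent_at_def)
  also have "\<dots> = (S o\<^sub>L (cmul z - complexify T)) (S' v)" by simp
  also have "\<dots> = S' v" using assms(1) by (simp add: is_resolvent_at_def)
  finally show "S v = S' v" .
qed

lemma resolvent_of_real:
  assumes "resolvent_op T l S"
  shows "resolvent (of_real l) T = complexify S"
  using assms unfolding resolvent_def is_resolvent_at_complexify_iff[symmetric]
  by (intro the_equality is_resolvent_at_unique[of T "of_real l"])

lemma resolvent_op_if_in_resolvent_set:
  assumes "of_real l \<in> resolvent_set T"
  obtains S where "resolvent_op T l S"
proof -
  obtain R where R: "is_resolvent_at T (of_real l) R" using assms by (auto simp: resolvent_set_def)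
  have bl: "bounded_linear (\<lambda>x. fst (R (x, 0)))"
    by (intro bounded_linear_compose[OF bounded_linear_fst] bounded_linear_compose[OF blinfun.bounded_linear_right]
        bounded_linear_Pair bounded_linear_ident bounded_linear_zero)
  define S where "S = Blinfun (\<lambda>x. fst (R (x, 0)))"
  have S: "S x = fst (R (x, 0))" for x by (simp add: S_def bounded_linear_Blinfun_apply bl)
  have e: "R (cmul (of_real l) v - complexify T v) = v" "cmul (of_real l) (R v) - complexify T (R v) = v" for v
  proof -
    have "(R o\<^sub>L (cmul (of_real l) - complexify T)) v = v" "((cmul (of_real l) - complexify T) o\<^sub>L R) v = v"
      using R by (simp_all add: is_resolvent_at_def)
    thus "R (cmul (of_real l) v - complexify T v) = v" "cmul (of_real l) (R v) - complexify T (R v) = v"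
      by (simp_all add: blinfun.bilinear_simps)
  qed
  have "resolvent_op T l S"
    unfolding resolvent_op_def
  proof (intro conjI allI)
    fix x
    have "(l *\<^sub>R x - T x, 0) = cmul (of_real l) (x, 0) - complexify T (x, 0)"
      by (simp add: cmul_of_real complexify_apply blinfun.bilinear_simps)
    thus "S (l *\<^sub>R x - T x) = x" using e(1)[of "(x, 0)"] by (simp add: S)
    have "fst (cmul (of_real l) (R (x, 0)) - complexify T (R (x, 0))) = x" using e(2)[of "(x, 0)"] by simp
    thus "l *\<^sub>R S x - T (S x) = x" by (simp add: S cmul_of_real complexify_apply)
  qed
  thus thesis by (rule that)
qed

text \<open>
  As \<open>R l - S0 = (s - l) R l S0\<close>, the norms of \<open>R l\<close> stay bounded when \<open>l\<close> decreases to \<open>s\<close>, and then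
  \<open>R l\<close> tends to \<open>S0\<close>.
\<close>

lemma resolvent_op_limit_positive:
  assumes T: "\<And>l. s < l \<Longrightarrow> \<exists>S. positive_op S \<and> resolvent_op T l S" and S0: "resolvent_op T s S0"
  shows "positive_op S0"
  unfolding positive_op_def
proof (intro allI impI)
  fix x :: 'a assume x: "0 \<le> x"
  obtain R where R: "\<And>l. s < l \<Longrightarrow> positive_op (R l) \<and> resolvent_op T l (R l)" using T by metis
  define K where "K = norm S0 + 1"
  have K: "0 < K" "norm S0 \<le> K" by (auto simp: K_def add_nonneg_pos)
  have close: "norm (R l x - S0 x) \<le> (l - s) * (2 * K * K * norm x)" if l: "s < l" "(l - s) * K \<le> 1/2" for l
  proof -
    have id: "R l y - S0 y = (s - l) *\<^sub>R R l (S0 y)" for y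
      using resolvent_identity[of T l "R l" s S0] R[OF l(1)] S0 by blast
    have b: "norm (R l y - S0 y) \<le> (l - s) * (norm (R l) * (K * norm y))" for y
    proof -
      have "norm (R l y - S0 y) = (l - s) * norm (R l (S0 y))" using l by (simp add: id)
      also have "\<dots> \<le> (l - s) * (norm (R l) * norm (S0 y))" using l by (intro mult_left_mono norm_blinfun) auto
      also have "\<dots> \<le> (l - s) * (norm (R l) * (norm S0 * norm y))"
        using l by (intro mult_left_mono norm_blinfun) auto
      also have "\<dots> \<le> (l - s) * (norm (R l) * (K * norm y))"
        using l K by (intro mult_left_mono mult_right_mono) auto
      finally show ?thesis .
    qed
    have "norm (R l) \<le> norm S0 + (1/2) * norm (R l)"
    proof (rule norm_blinfun_bound)
      fix y
      have "norm (R l y) \<le> norm (S0 y) + norm (R l y - S0 y)" using norm_triangle_sub by blast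
      also have "\<dots> \<le> norm S0 * norm y + (l - s) * (norm (R l) * (K * norm y))" by (intro add_mono norm_blinfun b)
      also have "(l - s) * (norm (R l) * (K * norm y)) = ((l - s) * K) * (norm (R l) * norm y)" by simp
      also have "\<dots> \<le> (1/2) * (norm (R l) * norm y)" using l by (intro mult_right_mono) auto
      finally show "norm (R l y) \<le> (norm S0 + (1/2) * norm (R l)) * norm y" by (simp add: algebra_simps)
    qed simp
    hence "norm (R l) \<le> 2 * K" using K by simp
    hence "(l - s) * (norm (R l) * (K * norm x)) \<le> (l - s) * (2 * K * (K * norm x))"
      using l K by (intro mult_left_mono mult_right_mono) auto
    thus ?thesis using b[of x] by simp
  qed
  have ev: "\<forall>\<^sub>F l in at_right s. s < l \<and> (l - s) * K \<le> 1/2"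
    unfolding eventually_at_right_field
  proof (intro exI conjI allI impI)
    show "s < s + 1 / (2 * K)" using K by simp
    fix l assume "s < l" "l < s + 1 / (2 * K)"
    thus "s < l" "(l - s) * K \<le> 1/2" using K by (auto simp: field_simps)
  qed
  have "((\<lambda>l. R l x - S0 x) \<longlongrightarrow> 0) (at_right s)"
  proof (rule Lim_null_comparison)
    show "\<forall>\<^sub>F l in at_right s. norm (R l x - S0 x) \<le> (l - s) * (2 * K * K * norm x)"
      using ev by eventually_elim (use close in auto)
    have "((\<lambda>l. (l - s) * (2 * K * K * norm x)) \<longlongrightarrow> (s - s) * (2 * K * K * norm x)) (at_right s)"
      by (intro tendsto_intros)
    thus "((\<lambda>l. (l - s) * (2 * K * K * norm x)) \<longlongrightarrow> 0) (at_right s)" by simp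
  qed
  hence "((\<lambda>l. R l x) \<longlongrightarrow> S0 x) (at_right s)" by (simp add: Lim_null[symmetric])
  thus "0 \<le> S0 x"
    by (rule tendsto_le_lattice[OF tendsto_const])
       (use ev R x in \<open>auto elim!: eventually_mono intro: positive_op_nonneg simp: trivial_limit_at_right_real\<close>)
qed

text \<open>
  Let \<open>L\<close> be the set of all \<open>l > 0\<close> at which \<open>T\<close> has a positive resolvent. The Neumann series shows
  that \<open>L\<close> is upward closed and that the spectrum lies in the disc of radius \<open>s = Inf L\<close>. Moreover
  \<open>s\<close> is in the spectrum: otherwise the resolvent at \<open>s\<close> is positive as a limit of positive
  resolvents, and \<open>resolvent_op_below\<close> extends \<open>L\<close> to the left of \<open>s\<close>, or, for \<open>s = 0\<close>, every \<open>x \<ge> 0\<close>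
  satisfies \<open>x = - T (S0 x) \<le> 0\<close>. So \<open>s\<close> is the spectral radius. The lower bound for the norm
  is \<open>resolvent_op_below\<close> again.
\<close>

theorem positive_op_resolvent:
  fixes T :: "'a::banach_lattice \<Rightarrow>\<^sub>L 'a"
  assumes T: "positive_op T" and nontriv: "\<exists>x::'a. x \<noteq> 0" and r: "0 < spectral_radius T"
  shows "\<And>l. spectral_radius T < l \<Longrightarrow> \<exists>S. positive_op S \<and> resolvent_op T l S"
    and "\<And>l S. spectral_radius T < l \<Longrightarrow> resolvent_op T l S \<Longrightarrow> 1 \<le> (l - spectral_radius T) * norm S"
proof -
  define L where "L = {l. 0 < l \<and> (\<exists>S. positive_op S \<and> resolvent_op T l S)}"
  have up: "l' \<in> L" if l: "l \<in> L" "l < l'" for l l'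
  proof -
    obtain S where S: "positive_op S" "resolvent_op T l S" "0 < l" using l by (auto simp: L_def)
    have l': "0 < l'" "0 \<le> l" using S l by auto
    obtain S' where "positive_op S'" "resolvent_op T l' S'"
      using resolvent_op_from_neumann[OF T l'(1) norm_op_power_le_resolvent[OF T S] l'(2) l(2)] by blast
    thus ?thesis using l' by (auto simp: L_def)
  qed
  have "norm T + 1 \<in> L"
  proof -
    have "norm (op_power T n) \<le> 1 * norm T ^ n" for n using norm_op_power_le by simp
    then obtain S where "positive_op S" "resolvent_op T (norm T + 1) S"
      by (rule resolvent_op_from_neumann[OF T, rotated]) (auto simp: add_nonneg_pos)
    thus ?thesis by (auto simp: L_def add_nonneg_pos)
  qed
  hence ne: "L \<noteq> {}" by auto
  have bdd: "bdd_below L" by (rule bdd_belowI[of _ 0]) (auto simp: L_def)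
  define s where "s = Inf L"
  have s0: "0 \<le> s" unfolding s_def using ne by (intro cInf_greatest) (auto simp: L_def)
  have above: "l \<in> L" if "s < l" for l
    using that up unfolding s_def cInf_less_iff[OF ne bdd] by blast
  have lower: "s \<le> l" if "l \<in> L" for l unfolding s_def using that bdd by (rule cInf_lower)
  have gap: "1 \<le> (l - s) * norm S" if l: "s < l" "resolvent_op T l S" "0 < s" for l S
  proof (rule ccontr)
    assume c: "\<not> 1 \<le> (l - s) * norm S"
    have pS: "positive_op S" using above[OF l(1)] resolvent_op_unique[OF l(2)] by (auto simp: L_def)
    have "((\<lambda>d. d * norm S) \<longlongrightarrow> (l - s) * norm S) (at_right (l - s))" by (intro tendsto_intros)
    hence "\<forall>\<^sub>F d in at_right (l - s). d * norm S < 1" using c by (intro order_tendstoD) auto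
    moreover have "\<forall>\<^sub>F d in at_right (l - s). d \<in> {l - s<..<l}"
      using l by (intro eventually_at_right_real) auto
    ultimately have "\<forall>\<^sub>F d in at_right (l - s). d * norm S < 1 \<and> l - s < d \<and> d < l" 
      by eventually_elim auto
    then obtain d where d: "d * norm S < 1" "l - s < d" "d < l"
      using eventually_happens[of _ "at_right (l - s)"] by (auto simp: trivial_limit_at_right_real)
    obtain S' where "positive_op S'" "resolvent_op T (l - d) S'"
      using resolvent_op_below[OF pS l(2) _ d(1)] d l by (metis diff_gt_0_iff_gt less_eq_real_def less_trans)
    hence "l - d \<in> L" using d by (auto simp: L_def)
    thus False using lower[of "l - d"] d by simp
  qed
  have s_spec: "of_real s \<in> spectrum T"
  proof (rule ccontr)
    assume "of_real s \<notin> spectrum T"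
    then obtain S0 where S0: "resolvent_op T s S0"
      using resolvent_op_if_in_resolvent_set by (auto simp: spectrum_def)
    have pos: "positive_op S0"
      by (rule resolvent_op_limit_positive[OF _ S0]) (use above in \<open>auto simp: L_def\<close>)
    show False
    proof (cases "s = 0")
      case True
      have "x \<le> 0" if "0 \<le> x" for x :: 'a
      proof -
        have "x = - T (S0 x)" using resolvent_opD(2)[OF S0, of x] True by simp
        moreover have "0 \<le> T (S0 x)" using T pos that by (simp add: positive_op_nonneg)
        ultimately show ?thesis by (metis neg_le_0_iff_le)
      qed
      from this[OF abs_ge_zero] have "\<bar>x\<bar> \<le> 0" for x :: 'a .
      thus False using nontriv by simp
    next
      case False
      hence s: "0 < s" using s0 by simp
      define d where "d = min (s/2) (1 / (2 * (norm S0 + 1)))"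
      have d: "0 < d" "d < s" using s by (auto simp: d_def add_nonneg_pos)
      have K: "0 < norm S0 + 1" by (simp add: add_nonneg_pos)
      have "d * norm S0 \<le> d * (norm S0 + 1)" using d by (intro mult_left_mono) auto
      also have "\<dots> \<le> 1 / (2 * (norm S0 + 1)) * (norm S0 + 1)"
        by (intro mult_right_mono) (auto simp: d_def)
      also have "\<dots> = 1 / 2" using K by simp
      finally have d1: "d * norm S0 < 1" by simp
      obtain S' where "positive_op S'" "resolvent_op T (s - d) S'"
        using resolvent_op_below[OF pos S0 _ d1] d by force
      hence "s - d \<in> L" using d by (auto simp: L_def)
      thus False using lower[of "s - d"] d by simp
    qed
  qed
  have spec_le: "cmod z \<le> s" if "z \<in> spectrum T" for z
  proof (rule ccontr)
    assume "\<not> cmod z \<le> s"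
    then obtain l where l: "s < l" "l < cmod z" using dense[of s "cmod z"] by auto
    obtain S where S: "positive_op S" "resolvent_op T l S" using above[OF l(1)] by (auto simp: L_def)
    have l0: "0 < l" using l s0 by simp
    have "z \<in> resolvent_set T"
      by (rule in_resolvent_set_if_large[OF norm_op_power_le_resolvent[OF T S l0] _ l(2)]) (use l0 in simp)
    thus False using that by (simp add: spectrum_def)
  qed
  have rad: "spectral_radius T = s"
    unfolding spectral_radius_def
  proof (rule cSup_eq_maximum)
    show "s \<in> cmod ` spectrum T" using s_spec s0 by (metis abs_of_nonneg imageI norm_of_real)
  qed (use spec_le in auto)
  show "\<exists>S. positive_op S \<and> resolvent_op T l S" if "spectral_radius T < l" for l
    using above[of l] that by (auto simp: rad L_def)
  show "1 \<le> (l - spectral_radius T) * norm S" if "spectral_radius T < l" "resolvent_op T l S" for l S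
    using gap that r by (simp add: rad)
qed

section \<open>Poles of the resolvent\<close>

lemma power_series_coeff_bound:
  fixes c :: "nat \<Rightarrow> 'b::real_normed_vector"
  assumes "summable (\<lambda>k. s ^ k *\<^sub>R c k)" "0 < s"
  obtains M where "0 \<le> M" "\<And>k t. 0 \<le> t \<Longrightarrow> t ^ k * norm (c k) \<le> M * (t / s) ^ k"
proof -
  obtain M where M: "\<And>k. norm (s ^ k *\<^sub>R c k) \<le> M"
    using summable_imp_Bseq[OF assms(1)] by (auto simp: Bseq_def)
  have "0 \<le> M" using order_trans[OF norm_ge_zero M[of 0]] .
  moreover have "t ^ k * norm (c k) \<le> M * (t / s) ^ k" if "0 \<le> t" for t k
  proof -
    have "t ^ k * norm (c k) = (t / s) ^ k * norm (s ^ k *\<^sub>R c k)"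
      using assms(2) by (simp add: power_divide)
    also have "\<dots> \<le> (t / s) ^ k * M" using that assms(2) by (intro mult_left_mono M) auto
    finally show ?thesis by (simp add: mult.commute)
  qed
  ultimately show thesis using that by blast
qed

lemma power_series_tendsto_coeff_0:
  fixes c :: "nat \<Rightarrow> 'b::banach"
  assumes "\<forall>\<^sub>F t in at_right 0. (\<lambda>k. t ^ k *\<^sub>R c k) sums f t"
  shows "(f \<longlongrightarrow> c 0) (at_right (0::real))"
proof -
  obtain b where b: "0 < b" "\<And>t. 0 < t \<Longrightarrow> t < b \<Longrightarrow> (\<lambda>k. t ^ k *\<^sub>R c k) sums f t"
    using assms unfolding eventually_at_right_field by auto
  define s where "s = b / 2"
  have s: "0 < s" "s < b" using b(1) by (auto simp: s_def)
  obtain M where M: "0 \<le> M" "\<And>k t. 0 \<le> t \<Longrightarrow> t ^ k * norm (c k) \<le> M * (t / s) ^ k"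
    using power_series_coeff_bound[of s c] b(2)[OF s] s(1) by (metis sums_summable)
  have bound: "norm (f t - c 0) \<le> t * (2 * M / s)" if t: "0 < t" "t < s / 2" for t
  proof -
    have "(\<lambda>k. t ^ Suc k *\<^sub>R c (Suc k)) sums (f t - c 0)"
      using b(2)[of t] t s by (subst sums_Suc_iff) simp
    moreover have "(\<lambda>k. (M * t / s) * (1/2) ^ k) sums ((M * t / s) * (1 / (1 - 1/2)))"
      by (intro sums_mult geometric_sums) simp
    moreover have "norm (t ^ Suc k *\<^sub>R c (Suc k)) \<le> (M * t / s) * (1/2) ^ k" for k
    proof -
      have "norm (t ^ Suc k *\<^sub>R c (Suc k)) = t ^ Suc k * norm (c (Suc k))" using t by simp
      also have "\<dots> \<le> M * (t / s) ^ Suc k" using t by (intro M) simp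
      also have "\<dots> = (M * t / s) * (t / s) ^ k" by simp
      also have "\<dots> \<le> (M * t / s) * (1/2) ^ k"
        using t s M by (intro mult_left_mono power_mono) (auto simp: field_simps)
      finally show ?thesis .
    qed
    ultimately have "norm (f t - c 0) \<le> (M * t / s) * (1 / (1 - 1/2))" by (rule norm_sums_le)
    thus ?thesis by (simp add: mult_ac)
  qed
  have "((\<lambda>t. f t - c 0) \<longlongrightarrow> 0) (at_right 0)"
  proof (rule Lim_null_comparison)
    show "\<forall>\<^sub>F t in at_right 0. norm (f t - c 0) \<le> t * (2 * M / s)"
      unfolding eventually_at_right_field using bound s by (intro exI[of _ "s / 2"]) auto
    have "((\<lambda>t. t * (2 * M / s)) \<longlongrightarrow> 0 * (2 * M / s)) (at_right 0)" by (intro tendsto_intros)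
    thus "((\<lambda>t. t * (2 * M / s)) \<longlongrightarrow> 0) (at_right 0)" by simp
  qed
  thus ?thesis by (simp add: Lim_null[symmetric])
qed

text \<open>
  The constant term is the limit at zero; then divide by \<open>t\<close> and repeat.
\<close>

lemma power_series_coeffs_vanish:
  fixes c :: "nat \<Rightarrow> 'b::banach"
  assumes "\<forall>\<^sub>F t in at_right (0::real). (\<lambda>k. t ^ k *\<^sub>R c k) sums (t ^ m *\<^sub>R b)" "k < m"
  shows "c k = 0"
  using assms
proof (induction m arbitrary: c k)
  case (Suc m)
  have "((\<lambda>t. t ^ Suc m *\<^sub>R b) \<longlongrightarrow> c 0) (at_right 0)"
    by (rule power_series_tendsto_coeff_0[OF Suc.prems(1)])
  moreover have "((\<lambda>t::real. t ^ Suc m *\<^sub>R b) \<longlongrightarrow> 0 ^ Suc m *\<^sub>R b) (at_right 0)" by (intro tendsto_intros)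
  ultimately have "c 0 = 0 ^ Suc m *\<^sub>R b" by (rule tendsto_unique[OF trivial_limit_at_right_real])
  hence c0: "c 0 = 0" by simp
  have "\<forall>\<^sub>F t in at_right (0::real). (\<lambda>k. t ^ k *\<^sub>R c (Suc k)) sums (t ^ m *\<^sub>R b)"
    using Suc.prems(1) eventually_at_right_less[of "0::real"]
  proof eventually_elim
    case (elim t)
    have "(\<lambda>k. t ^ Suc k *\<^sub>R c (Suc k)) sums (t ^ Suc m *\<^sub>R b)"
      using elim(1) by (subst sums_Suc_iff) (simp add: c0)
    hence "(\<lambda>k. (1/t) *\<^sub>R (t ^ Suc k *\<^sub>R c (Suc k))) sums ((1/t) *\<^sub>R (t ^ Suc m *\<^sub>R b))"
      by (rule sums_scaleR_right)
    thus ?case using elim(2) by simp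
  qed
  hence "c (Suc j) = 0" if "j < m" for j using Suc.IH[of "\<lambda>k. c (Suc k)" j] that by simp
  thus ?case using c0 Suc.prems(2) by (cases k) auto
qed simp

lemma bounded_linear_cmul_compose:
  "bounded_linear (\<lambda>c. cmul c o\<^sub>L (C :: ('a::banach \<times> 'a) \<Rightarrow>\<^sub>L ('a \<times> 'a)))"
proof (rule bounded_linear_intro)
  fix a b :: complex and r :: real
  show "cmul (a + b) o\<^sub>L C = (cmul a o\<^sub>L C) + (cmul b o\<^sub>L C)"
    by (intro blinfun_eqI) (simp add: blinfun.bilinear_simps complexification.scale_left_distrib)
  show "cmul (r *\<^sub>R a) o\<^sub>L C = r *\<^sub>R (cmul a o\<^sub>L C)"
    by (intro blinfun_eqI)
       (simp only: blinfun_apply_blinfun_compose blinfun.scaleR_left scaleR_conv_of_real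
          cmul_cmul[symmetric] cmul_of_real)
  have "norm (cmul a o\<^sub>L C) \<le> norm (cmul a :: ('a \<times> 'a) \<Rightarrow>\<^sub>L _) * norm C" by (rule norm_blinfun_compose)
  also have "\<dots> \<le> 4 * cmod a * norm C" by (intro mult_right_mono norm_cmul_le) simp
  finally show "norm (cmul a o\<^sub>L C) \<le> norm a * (4 * norm C)" by (simp add: mult_ac)
qed

lemma cis_int_has_integral:
  "((\<lambda>t. cis (of_int j * t)) has_integral (if j = 0 then of_real (2 * pi) else 0)) {0..2 * pi}"
proof (cases "j = 0")
  case True
  have "((\<lambda>t. 1::complex) has_integral ((2 * pi - 0) *\<^sub>R 1)) {0..2 * pi}"
    using has_integral_const_real[of "1::complex" 0 "2 * pi"] by simp
  thus ?thesis using True by (simp add: scaleR_conv_of_real)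
next
  case False
  let ?F = "\<lambda>t. (1 / (\<i> * of_int j)) * cis (of_int j * t)"
  have "(?F has_vector_derivative cis (of_int j * t)) (at t within {0..2 * pi})" for t
  proof -
    have "((\<lambda>t. cis (of_int j * t)) has_derivative (\<lambda>y. (y * of_int j) *\<^sub>R (\<i> * cis (of_int j * t)))) (at t within {0..2 * pi})"
      by (auto intro!: derivative_eq_intros)
    hence "((\<lambda>t. cis (of_int j * t)) has_vector_derivative (of_int j *\<^sub>R (\<i> * cis (of_int j * t)))) (at t within {0..2 * pi})"
      unfolding has_vector_derivative_def by simp
    hence "(?F has_vector_derivative (1 / (\<i> * of_int j)) * (of_int j *\<^sub>R (\<i> * cis (of_int j * t)))) (at t within {0..2 * pi})"
      by (rule has_vector_derivative_mult_right)
    thus ?thesis using False by (simp add: scaleR_conv_of_real)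
  qed
  hence "((\<lambda>t. cis (of_int j * t)) has_integral (?F (2 * pi) - ?F 0)) {0..2 * pi}"
    by (intro fundamental_theorem_of_calculus) auto
  moreover have "cis (of_int j * (2 * pi)) = 1"
    using cos_int_2pin[of j] sin_int_2pin[of j] by (auto simp: complex_eq_iff mult_ac)
  ultimately show ?thesis using False by simp
qed

text \<open>
  The Laurent series converges uniformly on small circles, and all its terms integrate to zero
  except the one with exponent \<open>-1\<close>, which has index \<open>m - 1\<close>.
\<close>

lemma circle_resolvent_integral_laurent:
  fixes T :: "'a::banach \<Rightarrow>\<^sub>L 'a"
  assumes m: "0 < m" and d: "0 < \<rho>" "\<rho> < d / 2"
    and sums: "\<And>w. w \<noteq> z \<Longrightarrow> dist w z < d \<Longrightarrow>
      (\<lambda>k. cmul ((w - z) powi (int k - int m)) o\<^sub>L C k) sums resolvent w T"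
  shows "circle_resolvent_integral T z \<rho> = C (m - 1)"
proof -
  \<comment> \<open>A point between \<open>\<rho>\<close> and the radius of convergence, so that the terms of the series on the circle
    of radius \<open>\<rho>\<close> are dominated by a geometric series with quotient \<open>\<rho> / s\<close>.\<close>
  define s where "s = d / 2"
  have s: "0 < s" "s < d" "\<rho> < s" using d by (auto simp: s_def)
  have "summable (\<lambda>k. s ^ k *\<^sub>R C k)"
  proof -
    have "(\<lambda>k. cmul ((z + of_real s - z) powi (int k - int m)) o\<^sub>L C k) sums resolvent (z + of_real s) T"
      using s by (intro sums) (auto simp: dist_norm)
    hence "(\<lambda>k. s ^ m *\<^sub>R (cmul (of_real s powi (int k - int m)) o\<^sub>L C k)) sums (s ^ m *\<^sub>R resolvent (z + of_real s) T)"
      by (intro sums_scaleR_right) simp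
    moreover have "s ^ m *\<^sub>R (cmul (of_real s powi (int k - int m)) o\<^sub>L C k) = s ^ k *\<^sub>R C k" for k
      using s(1) by (intro blinfun_eqI)
        (simp add: blinfun.bilinear_simps cmul_of_real power_int_diff flip: of_real_power of_real_divide)
    ultimately show ?thesis by (simp add: sums_iff)
  qed
  then obtain M where M: "0 \<le> M" "\<And>k t. 0 \<le> t \<Longrightarrow> t ^ k * norm (C k) \<le> M * (t / s) ^ k"
    using power_series_coeff_bound s(1) by metis
  \<comment> \<open>The exponent of the \<open>k\<close>-th term after multiplication by \<open>w\<close>, the derivative of the circle up to the factor \<open>\<i>\<close>.\<close>
  define j where "j k = 1 + (int k - int m)" for k
  define F where "F k t = cmul (of_real (\<rho> powi j k) * cis (of_int (j k) * t)) o\<^sub>L C k" for k t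
  have F: "cmul w o\<^sub>L (cmul (w powi (int k - int m)) o\<^sub>L C k) = F k t" if "w = of_real \<rho> * cis t" for w k t
  proof -
    have "w \<noteq> 0" using that d by simp
    hence "w * w powi (int k - int m) = w powi j k" using power_int_add[of w 1 "int k - int m"] by (simp add: j_def)
    also have "\<dots> = of_real (\<rho> powi j k) * cis (of_int (j k) * t)"
      by (simp add: that power_int_mult_distrib cis_power_int of_real_power_int)
    finally show ?thesis unfolding F_def
      by (intro blinfun_eqI) (simp add: cmul_cmul)
  qed
  define g where "g t = cmul (of_real \<rho> * cis t) o\<^sub>L resolvent (z + of_real \<rho> * cis t) T" for t
  have gsum: "(\<lambda>k. F k t) sums g t" for t
  proof -
    let ?w = "of_real \<rho> * cis t"
    have "(\<lambda>k. cmul ((z + ?w - z) powi (int k - int m)) o\<^sub>L C k) sums resolvent (z + ?w) T"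
      using d by (intro sums) (auto simp: dist_norm norm_mult)
    hence "(\<lambda>k. cmul ?w o\<^sub>L (cmul (?w powi (int k - int m)) o\<^sub>L C k)) sums (cmul ?w o\<^sub>L resolvent (z + ?w) T)"
      by (intro bounded_linear.sums[OF bounded_bilinear.bounded_linear_right[OF bounded_bilinear_blinfun_compose]]) simp
    thus ?thesis by (simp only: F[OF refl] g_def)
  qed
  have "norm (F k t) \<le> (4 * \<rho> / \<rho> ^ m * M) * (\<rho> / s) ^ k" for k t
  proof -
    have "norm (F k t) \<le> norm (cmul (of_real (\<rho> powi j k) * cis (of_int (j k) * t)) :: ('a \<times> 'a) \<Rightarrow>\<^sub>L _) * norm (C k)"
      unfolding F_def by (rule norm_blinfun_compose)
    also have "\<dots> \<le> (4 * cmod (of_real (\<rho> powi j k) * cis (of_int (j k) * t))) * norm (C k)"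
      by (intro mult_right_mono norm_cmul_le) simp
    also have "cmod (of_real (\<rho> powi j k) * cis (of_int (j k) * t)) = \<rho> powi j k"
      using d by (simp add: norm_mult norm_power_int)
    also have "\<rho> powi j k = \<rho> / \<rho> ^ m * \<rho> ^ k" using d by (simp add: j_def power_int_add power_int_diff)
    also have "4 * (\<rho> / \<rho> ^ m * \<rho> ^ k) * norm (C k) = (4 * \<rho> / \<rho> ^ m) * (\<rho> ^ k * norm (C k))" by simp
    also have "\<dots> \<le> (4 * \<rho> / \<rho> ^ m) * (M * (\<rho> / s) ^ k)" using d by (intro mult_left_mono M) auto
    finally show ?thesis by (simp add: mult_ac)
  qed
  moreover have "summable (\<lambda>k. (4 * \<rho> / \<rho> ^ m * M) * (\<rho> / s) ^ k)"
    using d s by (intro summable_mult summable_geometric) simp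
  ultimately have "uniform_limit {0..2 * pi} (\<lambda>n t. \<Sum>k<n. F k t) (\<lambda>t. \<Sum>k. F k t) sequentially"
    by (intro Weierstrass_m_test)
  hence ul: "uniform_limit {0..2 * pi} (\<lambda>n t. \<Sum>k<n. F k t) g sequentially"
    using gsum by (simp add: sums_iff)
  have cont: "continuous_on {0..2 * pi} (\<lambda>t. \<Sum>k<n. F k t)" for n
    unfolding F_def cis_conv_exp
    by (intro continuous_intros bounded_linear.continuous_on[OF bounded_linear_cmul_compose])
  obtain I J where IJ: "\<And>n. ((\<lambda>t. \<Sum>k<n. F k t) has_integral I n) {0..2 * pi}"
    "(g has_integral J) {0..2 * pi}" "I \<longlonglongrightarrow> J"
    by (rule uniform_limit_integral[OF ul cont sequentially_bot]) iprover
  define v where "v k = (if k = m - 1 then (2 * pi) *\<^sub>R C (m - 1) else 0)" for k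
  have Fint: "(F k has_integral v k) {0..2 * pi}" for k
  proof -
    let ?c = "of_real (\<rho> powi j k) * (if j k = 0 then of_real (2 * pi) else 0) :: complex"
    have "((\<lambda>t. of_real (\<rho> powi j k) * cis (of_int (j k) * t)) has_integral ?c) {0..2 * pi}"
      by (intro has_integral_mult_right cis_int_has_integral)
    from has_integral_linear[OF this bounded_linear_cmul_compose[of "C k"]]
    have "(F k has_integral (cmul ?c o\<^sub>L C k)) {0..2 * pi}" by (simp add: o_def F_def[abs_def])
    moreover have "cmul ?c o\<^sub>L C k = v k"
    proof (cases "j k = 0")
      case True
      hence k: "k = m - 1" using m by (auto simp: j_def)
      have "?c = of_real (2 * pi)" using True by simp
      thus ?thesis unfolding v_def k[symmetric] by (intro blinfun_eqI) (simp add: cmul_of_real blinfun.bilinear_simps del: of_real_mult)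
    next
      case False
      hence "k \<noteq> m - 1" using m by (auto simp: j_def)
      thus ?thesis using False by (intro blinfun_eqI) (simp add: v_def)
    qed
    ultimately show ?thesis by simp
  qed
  have "I n = (2 * pi) *\<^sub>R C (m - 1)" if "m \<le> n" for n
  proof -
    have "((\<lambda>t. \<Sum>k<n. F k t) has_integral (\<Sum>k<n. v k)) {0..2 * pi}"
      by (intro has_integral_sum Fint) auto
    hence "I n = (\<Sum>k<n. v k)" using IJ(1) has_integral_unique by blast
    also have "\<dots> = (2 * pi) *\<^sub>R C (m - 1)"
    proof -
      have "m - 1 \<in> {..<n}" using that m by simp
      thus ?thesis unfolding v_def by (simp only: sum.delta finite_lessThan if_True)
    qed
    finally show ?thesis .
  qed
  hence "I \<longlonglongrightarrow> (2 * pi) *\<^sub>R C (m - 1)"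
    by (intro tendsto_eventually) (auto simp: eventually_sequentially)
  hence "J = (2 * pi) *\<^sub>R C (m - 1)" using IJ(3) LIMSEQ_unique by blast
  hence "integral {0..2 * pi} g = (2 * pi) *\<^sub>R C (m - 1)" using IJ(2) by (simp add: integral_unique)
  thus ?thesis unfolding circle_resolvent_integral_def g_def[symmetric] by simp
qed

text \<open>
  A complex spanning set \<open>S\<close> together with \<open>\<i> S\<close> spans over the reals.
\<close>

lemma complex_finite_dim_imp_real:
  fixes V :: "('a::banach \<times> 'a) set"
  assumes "complex_finite_dim V"
  obtains F where "finite F" "V \<subseteq> span F"
proof -
  obtain S where S: "finite S" "V = complexification.span S" using assms by (auto simp: complex_finite_dim_def)
  define F where "F = S \<union> cmul \<i> ` S"
  have ispan: "cmul \<i> x \<in> span F" if "x \<in> span F" for x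
  proof -
    have "linear (blinfun_apply (cmul \<i> :: ('a \<times> 'a) \<Rightarrow>\<^sub>L _))"
      by (rule bounded_linear.linear[OF blinfun.bounded_linear_right])
    hence "cmul \<i> x \<in> span (cmul \<i> ` F)" using that linear_span_image by blast
    moreover have "cmul \<i> ` F \<subseteq> span F"
    proof -
      have "cmul \<i> (cmul \<i> s) = - s" for s :: "'a \<times> 'a"
        using cmul_of_real[of "-1" s] by (simp add: cmul_cmul)
      hence "cmul \<i> (cmul \<i> s) \<in> span F" if "s \<in> S" for s
        using that by (simp only: F_def) (intro span_neg span_base UnI1)
      moreover have "cmul \<i> s \<in> span F" if "s \<in> S" for s
        using that by (intro span_base) (simp add: F_def)
      ultimately show ?thesis by (simp only: F_def image_Un image_image) blast
    qed
    ultimately show ?thesis using span_mono span_span by blast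
  qed
  have "complexification.span S \<subseteq> span F"
  proof (rule complexification.span_minimal)
    show "S \<subseteq> span F" by (auto simp: F_def intro: span_base)
    show "complexification.subspace (span F)"
    proof (rule complexification.subspaceI)
      fix c x assume x: "x \<in> span F"
      have "cmul c x = cmul (of_real (Re c) + of_real (Im c) * \<i>) x" by (simp add: complex_eq mult.commute)
      also have "\<dots> = Re c *\<^sub>R x + Im c *\<^sub>R cmul \<i> x"
        by (simp only: complexification.scale_left_distrib cmul_of_real cmul_cmul[symmetric])
      finally show "cmul c x \<in> span F" using x ispan by (simp add: span_add span_scale)
    qed (auto simp: span_zero span_add)
  qed
  thus thesis using that[of F] S by (auto simp: F_def)
qed

text \<open>
  At a real point \<open>r + t\<close> the Laurent series times \<open>t ^ m\<close> is a power series in \<open>t\<close> with constant term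
  \<open>C 0\<close>, so \<open>C 0\<close> is a limit of complexified positive operators. Put \<open>N = T - r\<close>. Comparing
  coefficients in \<open>(t - N) (\<Sum>k. t ^ k * C k) = t ^ m\<close> gives \<open>C k = N (C (k + 1))\<close> for \<open>k + 1 < m\<close>, so
  \<open>C 0\<close> is \<open>N ^ (m - 1)\<close> times the spectral projection \<open>C (m - 1)\<close>, and its rank is finite if the
  spectral subspace is finite dimensional.
\<close>

theorem resolvent_pole_leading_coefficient:
  fixes T :: "'a::banach_lattice \<Rightarrow>\<^sub>L 'a"
  assumes R: "\<And>l. r < l \<Longrightarrow> positive_op (R l) \<and> resolvent_op T l (R l)"
    and pole: "is_resolvent_pole T (of_real r)"
  obtains m P where "0 < m" "P \<noteq> 0" "positive_op P"
    "((\<lambda>l. (l - r) ^ m *\<^sub>R R l) \<longlongrightarrow> P) (at_right r)"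
    "complex_finite_dim (spectral_subspace T (of_real r)) \<Longrightarrow> \<exists>F. finite F \<and> range (blinfun_apply P) \<subseteq> span F"
proof -
  obtain m C where m: "0 < m" and C0: "C 0 \<noteq> 0" and ev: "\<forall>\<^sub>F w in at (of_real r). w \<in> resolvent_set T \<and>
           (\<lambda>k. cmul ((w - of_real r) powi (int k - int m)) o\<^sub>L C k) sums resolvent w T"
    using pole unfolding is_resolvent_pole_def by blast
  obtain d where d: "0 < d" and sums: "\<And>w. w \<noteq> of_real r \<Longrightarrow> dist w (of_real r) < d \<Longrightarrow>
      (\<lambda>k. cmul ((w - of_real r) powi (int k - int m)) o\<^sub>L C k) sums resolvent w T"
    using ev unfolding eventually_at by blast
  define E where "E t = complexify (R (t + r))" for t
  have Esums: "(\<lambda>k. t ^ k *\<^sub>R C k) sums (t ^ m *\<^sub>R E t)" if t: "0 < t" "t < d" for t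
  proof -
    have "(\<lambda>k. cmul ((of_real (t + r) - of_real r) powi (int k - int m)) o\<^sub>L C k) sums resolvent (of_real (t + r)) T"
      using t by (intro sums) (auto simp: dist_norm)
    moreover have "resolvent (of_real (t + r)) T = E t"
      unfolding E_def using R[of "t + r"] t by (intro resolvent_of_real) auto
    ultimately have "(\<lambda>k. t ^ m *\<^sub>R (cmul (of_real t powi (int k - int m)) o\<^sub>L C k)) sums (t ^ m *\<^sub>R E t)"
      by (intro sums_scaleR_right) simp
    moreover have "t ^ m *\<^sub>R (cmul (of_real t powi (int k - int m)) o\<^sub>L C k) = t ^ k *\<^sub>R C k" for k
      using t(1) by (intro blinfun_eqI)
        (simp add: blinfun.bilinear_simps cmul_of_real power_int_diff flip: of_real_power of_real_divide)
    ultimately show ?thesis by simp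
  qed
  have ev0: "\<forall>\<^sub>F t in at_right 0. 0 < t \<and> t < d"
    unfolding eventually_at_right_field using d by auto
  have limC: "((\<lambda>t. t ^ m *\<^sub>R E t) \<longlongrightarrow> C 0) (at_right 0)"
    by (rule power_series_tendsto_coeff_0) (use ev0 Esums in \<open>auto elim: eventually_mono\<close>)
  define P where "P = fst_blinfun o\<^sub>L (C 0 o\<^sub>L Blinfun (\<lambda>x. (x, 0)))"
  have bl: "bounded_linear (\<lambda>x::'a. (x, 0::'a))"
    by (intro bounded_linear_Pair bounded_linear_ident bounded_linear_zero)
  have P: "P x = fst (C 0 (x, 0))" for x by (simp add: P_def bounded_linear_Blinfun_apply bl)
  have limP0: "((\<lambda>t. fst_blinfun o\<^sub>L ((t ^ m *\<^sub>R E t) o\<^sub>L Blinfun (\<lambda>x. (x, 0)))) \<longlongrightarrow> P) (at_right 0)"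
    unfolding P_def by (intro tendsto_intros limC bounded_bilinear.tendsto[OF bounded_bilinear_blinfun_compose])
  moreover have "fst_blinfun o\<^sub>L ((t ^ m *\<^sub>R E t) o\<^sub>L Blinfun (\<lambda>x. (x, 0))) = t ^ m *\<^sub>R R (t + r)" for t
    by (intro blinfun_eqI) (simp add: E_def bounded_linear_Blinfun_apply bl complexify_apply blinfun.bilinear_simps)
  ultimately have limP: "((\<lambda>t. t ^ m *\<^sub>R R (t + r)) \<longlongrightarrow> P) (at_right 0)" by simp
  hence lim: "((\<lambda>l. (l - r) ^ m *\<^sub>R R l) \<longlongrightarrow> P) (at_right r)"
    by (subst filterlim_at_right_to_0) simp
  have C0P: "C 0 = complexify P"
  proof (rule blinfun_eqI)
    fix v
    have "((\<lambda>t. (t ^ m *\<^sub>R E t) v) \<longlongrightarrow> C 0 v) (at_right 0)" by (intro tendsto_intros limC)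
    moreover have "((\<lambda>t. ((t ^ m *\<^sub>R R (t + r)) (fst v), (t ^ m *\<^sub>R R (t + r)) (snd v))) \<longlongrightarrow> (P (fst v), P (snd v))) (at_right 0)"
      by (intro tendsto_intros limP)
    ultimately show "C 0 v = complexify P v"
      using tendsto_unique[OF trivial_limit_at_right_real]
      by (fastforce simp: E_def complexify_apply blinfun.bilinear_simps)
  qed
  have "P \<noteq> 0"
  proof
    assume "P = 0"
    hence "C 0 = 0" unfolding C0P by (intro blinfun_eqI) (simp add: complexify_apply zero_prod_def)
    thus False using C0 by simp
  qed
  have pos: "positive_op P"
  proof (rule tendsto_positive_op[OF lim _ trivial_limit_at_right_real])
    show "\<forall>\<^sub>F l in at_right r. positive_op ((l - r) ^ m *\<^sub>R R l)"
      using eventually_at_right_less[of r] by eventually_elim (use R in \<open>auto intro!: positive_op_scaleR\<close>)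
  qed
  have fin: "\<exists>F. finite F \<and> range (blinfun_apply P) \<subseteq> span F"
    if fd: "complex_finite_dim (spectral_subspace T (of_real r))"
  proof -
    have "\<forall>\<^sub>F \<rho> in at_right 0. circle_resolvent_integral T (of_real r) \<rho> = C (m - 1)"
      unfolding eventually_at_right_field using d m
      by (intro exI[of _ "d / 2"] conjI allI impI circle_resolvent_integral_laurent[where C = C and d = d] sums) auto
    hence "spectral_projection T (of_real r) = C (m - 1)"
      unfolding spectral_projection_def
    proof (rule the_equality)
      fix Q assume "\<forall>\<^sub>F \<rho> in at_right 0. circle_resolvent_integral T (of_real r) \<rho> = Q"
      hence "\<forall>\<^sub>F \<rho> in at_right (0::real). Q = C (m - 1)"
        using \<open>\<forall>\<^sub>F \<rho> in at_right 0. circle_resolvent_integral T (of_real r) \<rho> = C (m - 1)\<close>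
        by eventually_elim simp
      thus "Q = C (m - 1)" by (simp add: trivial_limit_at_right_real)
    qed
    then obtain F where F: "finite F" "range (blinfun_apply (C (m - 1))) \<subseteq> span F"
      using complex_finite_dim_imp_real[OF fd] unfolding spectral_subspace_def by metis
    define N where "N = complexify T - r *\<^sub>R id_blinfun"
    have step: "C k = N o\<^sub>L C (Suc k)" if k: "Suc k < m" for k
    proof -
      \<comment> \<open>The coefficients of \<open>(t - N) (\<Sum>k. t ^ k * C k)\<close>.\<close>
      define c where "c k = (if k = 0 then 0 else C (k - 1)) - (N o\<^sub>L C k)" for k
      have "c (Suc k) = 0"
      proof (rule power_series_coeffs_vanish[of c m id_blinfun, OF _ k])
        show "\<forall>\<^sub>F t in at_right 0. (\<lambda>k. t ^ k *\<^sub>R c k) sums (t ^ m *\<^sub>R id_blinfun)"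
          using ev0
        proof eventually_elim
          case (elim t)
          note S = Esums[of t]
          have "(\<lambda>k. t ^ Suc k *\<^sub>R C k) sums (t *\<^sub>R (t ^ m *\<^sub>R E t))"
            using sums_scaleR_right[OF S, of t] elim by simp
          hence 1: "(\<lambda>k. t ^ k *\<^sub>R (if k = 0 then 0 else C (k - 1))) sums (t *\<^sub>R (t ^ m *\<^sub>R E t))"
            using sums_Suc_iff[of "\<lambda>k. t ^ k *\<^sub>R (if k = 0 then 0 else C (k - 1))"] by simp
          have "(\<lambda>k. N o\<^sub>L (t ^ k *\<^sub>R C k)) sums (N o\<^sub>L (t ^ m *\<^sub>R E t))"
            using elim by (intro bounded_linear.sums[OF bounded_bilinear.bounded_linear_right[OF bounded_bilinear_blinfun_compose]] S) auto
          from sums_diff[OF 1 this]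
          have "(\<lambda>k. t ^ k *\<^sub>R (if k = 0 then 0 else C (k - 1)) - (N o\<^sub>L (t ^ k *\<^sub>R C k)))
            sums (t *\<^sub>R (t ^ m *\<^sub>R E t) - (N o\<^sub>L (t ^ m *\<^sub>R E t)))" .
          moreover have "t ^ k *\<^sub>R (if k = 0 then 0 else C (k - 1)) - (N o\<^sub>L (t ^ k *\<^sub>R C k)) = t ^ k *\<^sub>R c k" for k
            by (intro blinfun_eqI) (simp add: c_def blinfun.bilinear_simps algebra_simps)
          moreover have "t *\<^sub>R (t ^ m *\<^sub>R E t) - (N o\<^sub>L (t ^ m *\<^sub>R E t)) = t ^ m *\<^sub>R id_blinfun"
          proof (rule blinfun_eqI)
            fix v
            have "resolvent_op T (t + r) (R (t + r))" using R elim by simp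
            note e = resolvent_opD(2)[OF this]
            have "(t + r) *\<^sub>R E t v - complexify T (E t v) = v"
              using e[of "fst v"] e[of "snd v"] by (simp add: E_def complexify_apply prod_eq_iff)
            hence "t ^ m *\<^sub>R ((t + r) *\<^sub>R E t v - complexify T (E t v)) = t ^ m *\<^sub>R v" by simp
            thus "(t *\<^sub>R (t ^ m *\<^sub>R E t) - (N o\<^sub>L (t ^ m *\<^sub>R E t))) v = (t ^ m *\<^sub>R id_blinfun) v"
              by (simp add: N_def blinfun.bilinear_simps algebra_simps)
          qed
          ultimately show ?case by simp
        qed
      qed
      thus ?thesis by (simp add: c_def)
    qed
    have C0N: "j < m \<Longrightarrow> C 0 = op_power N j o\<^sub>L C j" for j
    proof (induction j)
      case (Suc j)
      hence "C 0 = op_power N j o\<^sub>L (N o\<^sub>L C (Suc j))" using step by simp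
      thus ?case by (auto intro!: blinfun_eqI simp: op_power_commute)
    qed (auto intro!: blinfun_eqI)
    let ?h = "\<lambda>v. fst (op_power N (m - 1) v)"
    have lin: "linear ?h"
      by (intro bounded_linear.linear bounded_linear_compose[OF bounded_linear_fst] blinfun.bounded_linear_right)
    have "P x \<in> span (?h ` F)" for x
    proof -
      have "P x = ?h (C (m - 1) (x, 0))" using C0N[of "m - 1"] m by (simp add: P)
      moreover have "C (m - 1) (x, 0) \<in> span F" using F by auto
      ultimately show ?thesis using linear_span_image[OF lin] by blast
    qed
    thus ?thesis using F(1) by (intro exI[of _ "?h ` F"]) auto
  qed
  show thesis using that[OF m \<open>P \<noteq> 0\<close> pos lim fin] .
qed

section \<open>Finite-dimensional subspaces\<close>

text \<open>
  Adjoining a vector \<open>a\<close> outside the span, which is closed by the induction hypothesis, the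
  coefficient of \<open>a\<close> in a bounded vector is bounded in terms of the distance from \<open>a\<close> to the span.
\<close>

lemma compact_span_cball:
  fixes F :: "'a::real_normed_vector set"
  assumes "finite F"
  shows "compact (span F \<inter> cball 0 \<rho>)"
  using assms
proof (induction F arbitrary: \<rho> rule: finite_induct)
  case empty
  have "span {} \<inter> cball 0 \<rho> \<subseteq> {0::'a}" by (simp add: Int_lower1)
  thus ?case by (metis finite.emptyI finite.insertI finite_imp_compact finite_subset)
next
  case (insert a F)
  show ?case
  proof (cases "a \<in> span F")
    case True
    thus ?thesis using insert by (simp add: span_redundant)
  next
    case False
    have cl: "closed (span F)"
      unfolding closed_sequential_limits
    proof (intro allI impI, elim conjE)
      fix x l assume x: "\<forall>n. x n \<in> span F" "x \<longlonglongrightarrow> l"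
      obtain b where b: "\<And>n. norm (x n) \<le> b"
        using convergent_imp_Bseq[of x] x(2) by (auto simp: convergent_def Bseq_def)
      have "closed (span F \<inter> cball 0 b)" using insert.IH by (rule compact_imp_closed)
      moreover have "x n \<in> span F \<inter> cball 0 b" for n using x b by simp
      ultimately have "l \<in> span F \<inter> cball 0 b" using x(2) closed_sequentially by blast
      thus "l \<in> span F" by simp
    qed
    \<comment> \<open>Positive because \<open>a\<close> lies outside the closed subspace \<open>span F\<close>.\<close>
    define d where "d = infdist a (span F)"
    have ne: "span F \<noteq> {}" using span_zero by blast
    have d: "0 < d" using False cl ne in_closed_iff_infdist_zero[of "span F" a] infdist_nonneg[of a "span F"]
      by (auto simp: d_def less_le)
    have c_le: "\<bar>c\<bar> * d \<le> norm x" if "x - c *\<^sub>R a \<in> span F" for c x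
    proof (cases "c = 0")
      case False
      have "- ((1/c) *\<^sub>R (x - c *\<^sub>R a)) \<in> span F" using that by (intro span_neg span_scale)
      hence "d \<le> dist a (- ((1/c) *\<^sub>R (x - c *\<^sub>R a)))" unfolding d_def by (rule infdist_le)
      also have "\<dots> = norm ((1/c) *\<^sub>R x)" using False by (simp add: dist_norm algebra_simps)
      also have "\<dots> = norm x / \<bar>c\<bar>" by simp
      finally show ?thesis using False by (simp add: field_simps)
    qed simp
    let ?\<psi> = "\<lambda>(c, y). c *\<^sub>R a + y"
    let ?K = "cball (0::real) (\<rho> / d) \<times> (span F \<inter> cball 0 (\<rho> + (\<rho> / d) * norm a))"
    have "compact (?\<psi> ` ?K)"
      unfolding case_prod_unfold
      by (intro compact_continuous_image compact_Times insert.IH compact_cball continuous_intros)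
    hence "compact (?\<psi> ` ?K \<inter> cball 0 \<rho>)" by (intro compact_Int_closed) auto
    moreover have "?\<psi> ` ?K \<inter> cball 0 \<rho> = span (insert a F) \<inter> cball 0 \<rho>"
    proof (intro equalityI subsetI)
      fix x assume "x \<in> ?\<psi> ` ?K \<inter> cball 0 \<rho>"
      then obtain c y where cy: "x = c *\<^sub>R a + y" "y \<in> span F" "x \<in> cball 0 \<rho>" by auto
      have "y \<in> span (insert a F)" using cy(2) span_mono[of F "insert a F"] by auto
      moreover have "a \<in> span (insert a F)" by (simp add: span_base)
      ultimately show "x \<in> span (insert a F) \<inter> cball 0 \<rho>"
        unfolding Int_iff using cy(3) by (simp add: cy(1) span_add span_scale)
    next
      fix x assume x: "x \<in> span (insert a F) \<inter> cball 0 \<rho>"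
      then obtain c where c: "x - c *\<^sub>R a \<in> span F" by (auto simp: span_insert)
      have nx: "norm x \<le> \<rho>" using x by simp
      have cr: "\<bar>c\<bar> \<le> \<rho> / d" using c_le[OF c] nx d by (simp add: pos_le_divide_eq)
      have "norm (x - c *\<^sub>R a) \<le> norm x + \<bar>c\<bar> * norm a" using norm_triangle_ineq4[of x "c *\<^sub>R a"] by simp
      also have "\<dots> \<le> \<rho> + (\<rho> / d) * norm a" using nx cr by (intro add_mono mult_right_mono) auto
      finally have "(c, x - c *\<^sub>R a) \<in> ?K" using c cr by simp
      hence "?\<psi> (c, x - c *\<^sub>R a) \<in> ?\<psi> ` ?K" by (rule imageI)
      thus "x \<in> ?\<psi> ` ?K \<inter> cball 0 \<rho>" using x by simp
    qed
    ultimately show ?thesis by simp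
  qed
qed

lemma finite_dim_bounded_below:
  fixes K :: "'a::banach_lattice \<Rightarrow>\<^sub>L 'b::real_normed_vector"
  assumes F: "finite F" and K: "\<And>x. x \<in> span F \<Longrightarrow> 0 \<le> x \<Longrightarrow> x \<noteq> 0 \<Longrightarrow> K x \<noteq> 0"
  obtains \<delta> where "0 < \<delta>" "\<And>x. x \<in> span F \<Longrightarrow> 0 \<le> x \<Longrightarrow> \<delta> * norm x \<le> norm (K x)"
proof -
  let ?S = "(span F \<inter> cball 0 1) \<inter> ({x. 0 \<le> x} \<inter> {x. norm x = 1})"
  have cS: "compact ?S" 
    by (rule compact_Int_closed[OF compact_span_cball[OF F]])
       (intro closed_Int closed_nonneg closed_Collect_eq continuous_intros)
  have inS: "(1 / norm x) *\<^sub>R x \<in> ?S" if "x \<in> span F" "0 \<le> x" "x \<noteq> 0" for x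
    using that by (auto simp: span_scale scaleR_nonneg_nonneg)
  show thesis
  proof (cases "?S = {}")
    case True
    have zero: "x = 0" if "x \<in> span F" "0 \<le> x" for x
    proof (rule ccontr)
      assume "x \<noteq> 0"
      from inS[OF that this] True show False by blast
    qed
    show thesis
    proof (rule that[of 1])
      show "1 * norm x \<le> norm (K x)" if "x \<in> span F" "0 \<le> x" for x using zero[OF that] by simp
    qed simp
  next
    case False
    have "continuous_on ?S (\<lambda>x. norm (K x))" by (intro continuous_intros)
    then obtain x0 where x0: "x0 \<in> ?S" "\<And>x. x \<in> ?S \<Longrightarrow> norm (K x0) \<le> norm (K x)"
      using continuous_attains_inf[OF cS False, of "\<lambda>x. norm (K x)"] by metis
    have "x0 \<noteq> 0" using x0(1) by auto
    hence "0 < norm (K x0)" using K x0(1) by simp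
    moreover have "norm (K x0) * norm x \<le> norm (K x)" if x: "x \<in> span F" "0 \<le> x" for x
    proof (cases "x = 0")
      case False
      have "norm (K x0) \<le> norm (K ((1 / norm x) *\<^sub>R x))" by (intro x0(2) inS x False)
      also have "\<dots> = norm (K x) / norm x" by (simp add: blinfun.bilinear_simps)
      finally show ?thesis using False by (simp add: pos_le_divide_eq)
    qed simp
    ultimately show thesis by (rule that)
  qed
qed

section \<open>Leading coefficients of irreducible operators\<close>

lemma sigma_oc_resolvent:
  fixes T :: "'a::banach_lattice \<Rightarrow>\<^sub>L 'a"
  assumes l: "is_norm (lorentz_seminorm :: 'a \<Rightarrow> real)" and T: "sigma_order_continuous T"
    and R: "positive_op S" "resolvent_op T m S" "0 < m" "m < l" and Rl: "resolvent_op T l Rl"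
  shows "sigma_order_continuous Rl"
proof -
  have T0: "positive_op T" using T by (rule sigma_oc_positive)
  have l0: "0 < l" "0 \<le> m" using R by auto
  obtain S' where S': "resolvent_op T l S'"
    "(\<lambda>n. (1/l) *\<^sub>R (\<Sum>k<n. (1/l) ^ k *\<^sub>R op_power T k)) \<longlonglongrightarrow> S'"
    by (rule resolvent_op_from_neumann[OF T0 l0(1) norm_op_power_le_resolvent[OF T0 R(1,2,3)] l0(2) R(4)]) iprover
  have "sigma_order_continuous (\<Sum>k<n. (1/l) ^ k *\<^sub>R op_power T k)" for n
    using l0 by (induction n) (auto intro!: sigma_oc_add sigma_oc_scaleR sigma_oc_op_power T sigma_oc_zero)
  hence "sigma_order_continuous ((1/l) *\<^sub>R (\<Sum>k<n. (1/l) ^ k *\<^sub>R op_power T k))" for n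
    using l0 by (intro sigma_oc_scaleR) auto
  hence "sigma_order_continuous S'" using S'(2) by (rule sigma_oc_norm_limit[OF l])
  thus ?thesis using resolvent_op_unique[OF Rl S'(1)] by simp
qed

text \<open>
  Multiply \<open>T (R l x) = l *\<^sub>R R l x - x\<close> by \<open>(l - r) ^ m\<close>; the last term vanishes in the limit.
\<close>

lemma leading_coefficient_eigen:
  fixes T :: "'a::banach_lattice \<Rightarrow>\<^sub>L 'a"
  assumes R: "\<And>l. r < l \<Longrightarrow> resolvent_op T l (R l)" and m: "0 < m"
    and lim: "((\<lambda>l. (l - r) ^ m *\<^sub>R R l) \<longlongrightarrow> P) (at_right r)"
  shows "T (P x) = r *\<^sub>R P x" "P (T x) = r *\<^sub>R P x"
proof -
  have limx: "((\<lambda>l. ((l - r) ^ m *\<^sub>R R l) x) \<longlongrightarrow> P x) (at_right r)" for x by (intro tendsto_intros lim)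
  have "((\<lambda>l. l *\<^sub>R (((l - r) ^ m *\<^sub>R R l) x) - (l - r) ^ m *\<^sub>R x) \<longlongrightarrow> r *\<^sub>R P x - (r - r) ^ m *\<^sub>R x) (at_right r)"
    by (intro tendsto_intros limx)
  hence main: "((\<lambda>l. l *\<^sub>R (((l - r) ^ m *\<^sub>R R l) x) - (l - r) ^ m *\<^sub>R x) \<longlongrightarrow> r *\<^sub>R P x) (at_right r)"
    using m by (simp add: power_0_left)
  have eq: "T (R l x) = l *\<^sub>R R l x - x" "R l (T x) = l *\<^sub>R R l x - x" if "r < l" for l
    using resolvent_opD(3)[OF R[OF that]] resolvent_op_commute[OF R[OF that]] by simp_all
  have "((\<lambda>l. T (((l - r) ^ m *\<^sub>R R l) x)) \<longlongrightarrow> T (P x)) (at_right r)" by (intro tendsto_intros limx)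
  moreover have "\<forall>\<^sub>F l in at_right r. T (((l - r) ^ m *\<^sub>R R l) x) = l *\<^sub>R (((l - r) ^ m *\<^sub>R R l) x) - (l - r) ^ m *\<^sub>R x"
    using eventually_at_right_less[of r]
    by eventually_elim (simp add: blinfun.bilinear_simps eq algebra_simps)
  ultimately have "((\<lambda>l. l *\<^sub>R (((l - r) ^ m *\<^sub>R R l) x) - (l - r) ^ m *\<^sub>R x) \<longlongrightarrow> T (P x)) (at_right r)"
    by (rule Lim_transform_eventually)
  thus "T (P x) = r *\<^sub>R P x" using main tendsto_unique[OF trivial_limit_at_right_real] by blast
  have "\<forall>\<^sub>F l in at_right r. ((l - r) ^ m *\<^sub>R R l) (T x) = l *\<^sub>R (((l - r) ^ m *\<^sub>R R l) x) - (l - r) ^ m *\<^sub>R x"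
    using eventually_at_right_less[of r]
    by eventually_elim (simp add: blinfun.bilinear_simps eq algebra_simps)
  with limx[of "T x"] have "((\<lambda>l. l *\<^sub>R (((l - r) ^ m *\<^sub>R R l) x) - (l - r) ^ m *\<^sub>R x) \<longlongrightarrow> P (T x)) (at_right r)"
    by (rule Lim_transform_eventually)
  thus "P (T x) = r *\<^sub>R P x" using main tendsto_unique[OF trivial_limit_at_right_real] by blast
qed

lemma leading_coefficient_sigma_oc_lorentz:
  fixes T :: "'a::banach_lattice \<Rightarrow>\<^sub>L 'a"
  assumes l: "is_norm (lorentz_seminorm :: 'a \<Rightarrow> real)" and T: "sigma_order_continuous T"
    and R: "\<And>l. r < l \<Longrightarrow> positive_op (R l) \<and> resolvent_op T l (R l)" and r: "0 < r"
    and lim: "((\<lambda>l. (l - r) ^ m *\<^sub>R R l) \<longlongrightarrow> P) (at_right r)"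
  shows "sigma_order_continuous P"
proof -
  let ?l = "\<lambda>k. r + 1 / real (Suc k)"
  have "(\<lambda>k. r + 1 / real (Suc k)) \<longlonglongrightarrow> r + 0"
    by (intro tendsto_intros LIMSEQ_Suc[OF lim_1_over_n])
  hence "filterlim ?l (at_right r) sequentially"
    unfolding filterlim_at by (auto simp del: of_nat_Suc)
  with lim have limk: "(\<lambda>k. (?l k - r) ^ m *\<^sub>R R (?l k)) \<longlonglongrightarrow> P" by (rule filterlim_compose)
  have "sigma_order_continuous ((?l k - r) ^ m *\<^sub>R R (?l k))" for k
  proof (rule sigma_oc_scaleR)
    define q where "q = 1 / real (Suc k)"
    have q: "0 < q" by (simp add: q_def)
    define a where "a = r + q / 2"
    have a: "r < a" "0 < a" "a < ?l k" "r < ?l k"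
      using q r unfolding a_def q_def[symmetric] by auto
    show "sigma_order_continuous (R (?l k))"
      using R[OF a(1)] R[OF a(4)] a by (intro sigma_oc_resolvent[OF l T _ _ a(2,3)]) auto
    show "0 < (?l k - r) ^ m" by simp
  qed
  from sigma_oc_norm_limit[OF l this limk] show ?thesis .
qed

text \<open>
  If \<open>s n\<close> decreases to zero, then \<open>T (s n)\<close> tends to zero in norm, hence so does
  \<open>r *\<^sub>R P (s n) = P (T (s n))\<close>.
\<close>

lemma sigma_oc_if_weakly_compact_factor:
  fixes P T :: "'a::banach_lattice \<Rightarrow>\<^sub>L 'a"
  assumes T: "weakly_compact_op T" "sigma_order_continuous T" and P: "positive_op P"
    and eig: "\<And>x. P (T x) = r *\<^sub>R P x" and r: "0 < r"
  shows "sigma_order_continuous P"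
proof (rule sigma_oc_I[OF P])
  fix s and y :: 'a assume s: "seq_decreases_to s 0" and y: "\<And>n. y \<le> P (s n)"
  have "(\<lambda>n. T (s n)) \<longlonglongrightarrow> 0" using weakly_compact_sigma_oc_norm_null[OF T s] .
  hence "(\<lambda>n. (1/r) *\<^sub>R P (T (s n))) \<longlonglongrightarrow> (1/r) *\<^sub>R P 0" by (intro tendsto_intros)
  hence "(\<lambda>n. P (s n)) \<longlonglongrightarrow> 0" using r by (simp add: eig)
  thus "y \<le> 0" by (rule tendsto_le_lattice[OF tendsto_const]) (use y in auto)
qed

lemma resolvent_weak_unit:
  fixes B :: "'a::banach_lattice \<Rightarrow>\<^sub>L 'a"
  assumes B: "band_irreducible B" "sigma_order_continuous B"
    and S: "positive_op S" "resolvent_op B l S" and x: "0 \<le> x" "x \<noteq> 0"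
  shows "weak_unit (S x)"
proof (rule irreducible_weak_unit[OF B])
  show "0 \<le> S x" by (rule positive_op_nonneg[OF S(1) x(1)])
  show "S x \<noteq> 0" using resolvent_opD(2)[OF S(2), of x] x by auto
  show "B (S x) \<le> l *\<^sub>R S x" using resolvent_op_ge(2)[OF sigma_oc_positive[OF B(2)] S x(1)] .
qed

text \<open>
  From \<open>x = l *\<^sub>R S x - B (S x)\<close> one gets \<open>Q x = (l - r) *\<^sub>R Q (S x)\<close>. If \<open>Q x = 0\<close>, then \<open>Q\<close> kills the
  weak unit \<open>S x\<close>.
\<close>

lemma left_eigenoperator_strictly_positive:
  fixes B Q :: "'a::banach_lattice \<Rightarrow>\<^sub>L 'a"
  assumes B: "band_irreducible B" "sigma_order_continuous B"
    and S: "positive_op S" "resolvent_op B l S" and l: "r < l"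
    and Q: "sigma_order_continuous Q" "Q \<noteq> 0" "\<And>x. Q (B x) = r *\<^sub>R Q x"
    and x: "0 \<le> x" "Q x = 0"
  shows "x = 0"
proof (rule ccontr)
  assume "x \<noteq> 0"
  hence wu: "weak_unit (S x)" by (intro resolvent_weak_unit[OF B S x(1)])
  have "Q x = Q (l *\<^sub>R S x - B (S x))" using resolvent_opD(2)[OF S(2), of x] by simp
  also have "\<dots> = (l - r) *\<^sub>R Q (S x)" by (simp add: blinfun.bilinear_simps Q(3) algebra_simps)
  finally have "Q (S x) = 0" using x(2) l by simp
  hence "Q = 0" using weak_unit_sigma_oc_eq_0[OF wu Q(1)] by simp
  thus False using Q(2) by simp
qed

text \<open>
  The multiple is given by the largest \<open>t\<close> with \<open>t *\<^sub>R u \<le> v\<close>: beyond it the order is reversed, and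
  both inequalities survive in the limit.
\<close>

lemma totally_ordered_imp_multiple:
  fixes u v :: "'a::banach_lattice"
  assumes u: "0 \<le> u" "u \<noteq> 0" and v: "0 \<le> v"
    and total: "\<And>t. 0 \<le> v - t *\<^sub>R u \<or> v - t *\<^sub>R u \<le> 0"
  shows "\<exists>t. v = t *\<^sub>R u"
proof -
  define S where "S = {t. t *\<^sub>R u \<le> v}"
  have "closed ((\<lambda>t. v - t *\<^sub>R u) -` {x. 0 \<le> x})"
    by (intro closed_vimage closed_nonneg continuous_intros)
  hence cl: "closed S" by (simp add: S_def vimage_def)
  have "0 \<in> S" using v by (simp add: S_def)
  hence ne: "S \<noteq> {}" by blast
  have "t \<le> norm v / norm u" if "t \<in> S" for t
  proof (cases "0 \<le> t")
    case True
    hence "norm (t *\<^sub>R u) \<le> norm v" using that u by (intro norm_mono_nonneg) (auto simp: S_def scaleR_nonneg_nonneg)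
    thus ?thesis using True u(2) by (simp add: pos_le_divide_eq)
  next
    case False
    thus ?thesis by (meson divide_nonneg_nonneg linear norm_ge_zero order_trans)
  qed
  hence bdd: "bdd_above S" by (rule bdd_aboveI)
  have "Sup S \<in> S" using cl ne bdd by (intro closed_contains_Sup)
  hence le: "Sup S *\<^sub>R u \<le> v" by (simp add: S_def)
  have "v \<le> (Sup S + 1 / real (Suc n)) *\<^sub>R u" for n
  proof -
    have "Sup S + 1 / real (Suc n) \<notin> S"
      using cSup_upper[OF _ bdd, of "Sup S + 1 / real (Suc n)"] by (auto simp del: of_nat_Suc)
    thus ?thesis using total[of "Sup S + 1 / real (Suc n)"] by (auto simp: S_def simp del: of_nat_Suc)
  qed
  moreover have "(\<lambda>n. (Sup S + 1 / real (Suc n)) *\<^sub>R u) \<longlonglongrightarrow> (Sup S + 0) *\<^sub>R u"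
    by (intro tendsto_intros LIMSEQ_Suc[OF lim_1_over_n])
  ultimately have "v \<le> Sup S *\<^sub>R u"
    by (intro tendsto_le_lattice[OF tendsto_const[of v sequentially]]) auto
  thus ?thesis using le by (intro exI[of _ "Sup S"]) (rule antisym)
qed

text \<open>
  \<open>P\<close> is strictly positive. In a pole of order \<open>m > 1\<close> one would have \<open>P P = 0\<close>, so \<open>m = 1\<close>. If
  \<open>B v = r *\<^sub>R v\<close>, then \<open>B \<bar>v\<bar> - r *\<^sub>R \<bar>v\<bar>\<close> is positive and killed by \<open>P\<close>, so \<open>\<bar>v\<bar>\<close> and the positive and
  negative parts of \<open>v\<close> are eigenvectors. These parts are disjoint, and nonzero positive eigenvectors
  are weak units, so one part is zero. The eigenspace is therefore totally ordered, and
  one-dimensional.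
\<close>

theorem irreducible_leading_coefficient:
  fixes B :: "'a::banach_lattice \<Rightarrow>\<^sub>L 'a"
  assumes B: "band_irreducible B" "sigma_order_continuous B" and r: "0 < r"
    and R: "\<And>l. r < l \<Longrightarrow> positive_op (R l) \<and> resolvent_op B l (R l)" and m: "0 < m"
    and lim: "((\<lambda>l. (l - r) ^ m *\<^sub>R R l) \<longlongrightarrow> P) (at_right r)"
    and P: "sigma_order_continuous P" "P \<noteq> 0"
  obtains u where "0 \<le> u" "u \<noteq> 0" "B u = r *\<^sub>R u" "P u = u" "\<And>x. \<exists>t. P x = t *\<^sub>R u" "m = 1"
    "\<And>x. 0 \<le> x \<Longrightarrow> P x = 0 \<Longrightarrow> x = 0"
proof -
  have pB: "positive_op B" and pP: "positive_op P" using B P by (auto intro: sigma_oc_positive)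
  have R': "\<And>l. r < l \<Longrightarrow> resolvent_op B l (R l)" using R by blast
  note eig = leading_coefficient_eigen[OF R' m lim]
  have strict: "x = 0" if "0 \<le> x" "P x = 0" for x
    using R[of "r + 1"] by (intro left_eigenoperator_strictly_positive[OF B _ _ _ P eig(2) that]) auto
  obtain x0 where x0: "0 \<le> x0" "P x0 \<noteq> 0" using positive_op_eq_0[OF pP] P(2) by blast
  define u where "u = P x0"
  have u: "0 \<le> u" "u \<noteq> 0" using x0 pP by (auto simp: u_def positive_op_nonneg)
  have m1: "m = 1"
  proof (rule ccontr)
    assume "m \<noteq> 1"
    hence m2: "0 < m - 1" using m by simp
    have "((\<lambda>l. P (((l - r) ^ m *\<^sub>R R l) x0)) \<longlongrightarrow> P (P x0)) (at_right r)" by (intro tendsto_intros lim)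
    moreover have "\<forall>\<^sub>F l in at_right r. P (((l - r) ^ m *\<^sub>R R l) x0) = (l - r) ^ (m - 1) *\<^sub>R P x0"
      using eventually_at_right_less[of r]
    proof eventually_elim
      case (elim l)
      have "P x0 = P (l *\<^sub>R R l x0 - B (R l x0))" using resolvent_opD(2)[OF R'[OF elim], of x0] by simp
      also have "\<dots> = (l - r) *\<^sub>R P (R l x0)" by (simp add: blinfun.bilinear_simps eig algebra_simps)
      finally have "(l - r) ^ (m - 1) *\<^sub>R P x0 = ((l - r) ^ (m - 1) * (l - r)) *\<^sub>R P (R l x0)" by simp
      also have "(l - r) ^ (m - 1) * (l - r) = (l - r) ^ m" using m power_minus_mult by blast
      finally show ?case by (simp add: blinfun.bilinear_simps)
    qed
    ultimately have "((\<lambda>l. (l - r) ^ (m - 1) *\<^sub>R P x0) \<longlongrightarrow> P (P x0)) (at_right r)"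
      by (rule Lim_transform_eventually)
    moreover have "((\<lambda>l. (l - r) ^ (m - 1) *\<^sub>R P x0) \<longlongrightarrow> (r - r) ^ (m - 1) *\<^sub>R P x0) (at_right r)"
      by (intro tendsto_intros)
    ultimately have "P (P x0) = (r - r) ^ (m - 1) *\<^sub>R P x0"
      by (rule tendsto_unique[OF trivial_limit_at_right_real])
    hence "P u = 0" using m2 by (simp add: u_def power_0_left)
    thus False using strict u by blast
  qed
  have fix_P: "P v = v" if v: "B v = r *\<^sub>R v" for v
  proof -
    have "((\<lambda>l. ((l - r) ^ m *\<^sub>R R l) v) \<longlongrightarrow> P v) (at_right r)" by (intro tendsto_intros lim)
    moreover have "\<forall>\<^sub>F l in at_right r. ((l - r) ^ m *\<^sub>R R l) v = v"
      using eventually_at_right_less[of r]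
    proof eventually_elim
      case (elim l)
      thus ?case using resolvent_opD(1)[OF R'[OF elim], of v]
        by (simp add: v m1 blinfun.bilinear_simps flip: scaleR_diff_left)
    qed
    ultimately have "((\<lambda>l. v) \<longlongrightarrow> P v) (at_right r)" by (rule Lim_transform_eventually)
    thus ?thesis using tendsto_unique[OF trivial_limit_at_right_real tendsto_const] by metis
  qed
  have abs_eig: "B \<bar>v\<bar> = r *\<^sub>R \<bar>v\<bar>" if v: "B v = r *\<^sub>R v" for v
  proof -
    have "r *\<^sub>R \<bar>v\<bar> \<le> \<bar>r *\<^sub>R v\<bar>" by (rule scaleR_abs_le[OF r])
    also have "\<dots> \<le> B \<bar>v\<bar>" using positive_op_abs[OF pB, of v] v by simp
    finally have "0 \<le> B \<bar>v\<bar> - r *\<^sub>R \<bar>v\<bar>" by simp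
    moreover have "P (B \<bar>v\<bar> - r *\<^sub>R \<bar>v\<bar>) = 0" by (simp add: blinfun.bilinear_simps eig)
    ultimately have "B \<bar>v\<bar> - r *\<^sub>R \<bar>v\<bar> = 0" by (rule strict)
    thus ?thesis by simp
  qed
  have total: "0 \<le> v \<or> v \<le> 0" if v: "B v = r *\<^sub>R v" for v
  proof (cases "pprt v = 0")
    case True
    thus ?thesis by (simp add: le_zero_iff_zero_pprt)
  next
    case False
    have "B (pprt v) = r *\<^sub>R pprt v"
      by (simp add: pprt_half blinfun.bilinear_simps abs_eig[OF v] v scaleR_add_right)
    hence "weak_unit (pprt v)" using False by (intro irreducible_weak_unit[OF B, of _ r]) auto
    hence "pprt (- v) = 0" using disjoint_pprt[of v] weak_unit_disjoint[of "pprt v" "pprt (- v)"]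
      by (simp only: inf.commute zero_le_pprt simp_thms)
    hence "- v \<le> 0" using le_zero_iff_zero_pprt[of "- v"] by simp
    thus ?thesis by simp
  qed
  have one_dim: "\<exists>t. v = t *\<^sub>R u" if v: "B v = r *\<^sub>R v" for v
  proof -
    have nonneg: "\<exists>t. w = t *\<^sub>R u" if w: "B w = r *\<^sub>R w" "0 \<le> w" for w
    proof (rule totally_ordered_imp_multiple[OF u w(2)])
      fix t
      show "0 \<le> w - t *\<^sub>R u \<or> w - t *\<^sub>R u \<le> 0"
        by (rule total) (simp add: blinfun.bilinear_simps w u_def eig algebra_simps)
    qed
    show ?thesis
    proof (cases "0 \<le> v")
      case True thus ?thesis using nonneg[OF v] by simp
    next
      case False
      hence "0 \<le> - v" using total[OF v] by simp
      then obtain t where "- v = t *\<^sub>R u" using nonneg[of "- v"] v by (auto simp: blinfun.bilinear_simps)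
      hence "v = (- t) *\<^sub>R u" by (metis minus_minus scaleR_minus_left)
      thus ?thesis by blast
    qed
  qed
  have Bu: "B u = r *\<^sub>R u" by (simp add: u_def eig)
  have "\<exists>t. P x = t *\<^sub>R u" for x by (rule one_dim) (rule eig)
  thus thesis using that[OF u Bu fix_P[OF Bu]] m1 strict by blast
qed

section \<open>Comparison when the larger operator has a pole\<close>

text \<open>
  For \<open>l\<close> close to \<open>r\<close> the resolvent has large norm, almost attained at a positive vector \<open>z\<close>; take
  the normalized \<open>R l z\<close>.
\<close>

lemma positive_approximate_eigenvector:
  fixes A :: "'a::banach_lattice \<Rightarrow>\<^sub>L 'a"
  assumes R: "\<And>l. r < l \<Longrightarrow> positive_op (R l) \<and> resolvent_op A l (R l)"
    and gap: "\<And>l. r < l \<Longrightarrow> 1 \<le> (l - r) * norm (R l)" and e: "0 < e"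
  obtains x where "0 \<le> x" "norm x = 1" "norm (A x - r *\<^sub>R x) \<le> e"
proof -
  define l where "l = r + e / 3"
  have l: "r < l" "l - r = e / 3" using e by (auto simp: l_def)
  note Rl = R[OF l(1)]
  have N: "0 < norm (R l)" "1 / norm (R l) \<le> e / 3"
  proof -
    show "0 < norm (R l)" using gap[OF l(1)] by (cases "norm (R l) = 0") auto
    thus "1 / norm (R l) \<le> e / 3" using gap[OF l(1)] l(2) by (simp add: pos_divide_le_eq)
  qed
  have "\<exists>y. norm (R l) / 2 * norm y < norm (R l y)"
  proof (rule ccontr)
    assume "\<nexists>y. norm (R l) / 2 * norm y < norm (R l y)"
    hence "norm (R l) \<le> norm (R l) / 2" by (intro norm_blinfun_bound) (auto simp: not_less)
    thus False using N by simp
  qed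
  then obtain y where y: "norm (R l) / 2 * norm y < norm (R l y)" by blast
  define z where "z = \<bar>y\<bar>"
  have z: "0 \<le> z" "norm (R l) / 2 * norm z < norm (R l z)"
  proof -
    have "norm (R l y) \<le> norm (R l z)"
      unfolding z_def using Rl positive_op_abs[of "R l" y] positive_op_nonneg[of "R l" "\<bar>y\<bar>"]
      by (intro norm_mono_abs) auto
    thus "norm (R l) / 2 * norm z < norm (R l z)" using y by (simp add: z_def norm_abs_eq)
  qed (simp add: z_def)
  define n where "n = norm (R l z)"
  have n: "0 < n" using z(2) N(1) unfolding n_def by (meson divide_pos_pos le_less_trans mult_nonneg_nonneg less_imp_le norm_ge_zero zero_less_numeral)
  define x where "x = (1 / n) *\<^sub>R R l z"
  have x: "0 \<le> x" "norm x = 1"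
    using n Rl z(1) positive_op_nonneg[of "R l" z] by (auto simp: x_def n_def scaleR_nonneg_nonneg)
  have ARz: "A (R l z) = l *\<^sub>R R l z - z" using Rl by (intro resolvent_opD(3)) blast
  have eq: "A x - r *\<^sub>R x = (l - r) *\<^sub>R x - (1 / n) *\<^sub>R z"
    by (simp add: x_def blinfun.bilinear_simps ARz scaleR_diff_right scaleR_diff_left diff_divide_distrib)
  have "norm (A x - r *\<^sub>R x) \<le> norm ((l - r) *\<^sub>R x) + norm ((1 / n) *\<^sub>R z)"
    unfolding eq by (rule norm_triangle_ineq4)
  also have "norm ((l - r) *\<^sub>R x) = e / 3" using x l e by simp
  also have "norm ((1 / n) *\<^sub>R z) \<le> 2 * (e / 3)"
  proof -
    have "norm z \<le> 2 / norm (R l) * n" using z(2) N(1) by (simp add: n_def field_simps)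
    hence "norm z / n \<le> 2 / norm (R l)" using n by (simp add: pos_divide_le_eq)
    also have "\<dots> = 2 * (1 / norm (R l))" by simp
    also have "\<dots> \<le> 2 * (e / 3)" using N(2) by (intro mult_left_mono) auto
    finally show ?thesis using n by simp
  qed
  finally show thesis using that x by simp
qed

text \<open>
  Let \<open>u\<close> span the range of \<open>P\<close>. For an approximate eigenvector \<open>x\<close> of \<open>A\<close>,
  \<open>x = (l - r) *\<^sub>R RA l x + RA l (r *\<^sub>R x - A x) \<le> P x + h\<close> with \<open>h\<close> small and \<open>P x = t *\<^sub>R u\<close>, where \<open>t\<close> is
  bounded away from zero because \<open>norm x = 1\<close>. Applying \<open>P A\<close> and dividing by \<open>t\<close> yields
  \<open>r *\<^sub>R u \<le> P (A u)\<close> up to a small error. Since \<open>P (B u) = r *\<^sub>R u\<close>, this forces \<open>P ((B - A) u) = 0\<close>.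
\<close>

theorem eq_if_pole_of_larger:
  fixes A B :: "'a::banach_lattice \<Rightarrow>\<^sub>L 'a"
  assumes A: "positive_op A" and AB: "positive_op (B - A)"
    and B: "band_irreducible B" "sigma_order_continuous B" and r: "0 < r"
    and RA: "\<And>l. r < l \<Longrightarrow> positive_op (RA l) \<and> resolvent_op A l (RA l)"
    and RB: "\<And>l. r < l \<Longrightarrow> positive_op (RB l) \<and> resolvent_op B l (RB l)"
    and gap: "\<And>l. r < l \<Longrightarrow> 1 \<le> (l - r) * norm (RA l)" and m: "0 < m"
    and lim: "((\<lambda>l. (l - r) ^ m *\<^sub>R RB l) \<longlongrightarrow> P) (at_right r)"
    and P: "sigma_order_continuous P" "P \<noteq> 0"
  shows "A = B"
proof -
  obtain u where u: "0 \<le> u" "u \<noteq> 0" "B u = r *\<^sub>R u" "P u = u" and one_dim: "\<And>x. \<exists>t. P x = t *\<^sub>R u"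
    and m1: "m = 1" and strict: "\<And>x. 0 \<le> x \<Longrightarrow> P x = 0 \<Longrightarrow> x = 0"
  proof (rule irreducible_leading_coefficient[OF B r RB m lim P])
    fix u assume "0 \<le> u" "u \<noteq> 0" "B u = r *\<^sub>R u" "P u = u" "\<And>x. \<exists>t. P x = t *\<^sub>R u" "m = 1"
      "\<And>x. 0 \<le> x \<Longrightarrow> P x = 0 \<Longrightarrow> x = 0"
    thus thesis by (rule that)
  qed
  have pP: "positive_op P" using P(1) by (rule sigma_oc_positive)
  have RB': "\<And>l. r < l \<Longrightarrow> resolvent_op B l (RB l)" using RB by blast
  note eig = leading_coefficient_eigen[OF RB' m lim]
  have nu: "0 < norm u" using u by simp
  have "r *\<^sub>R u - P (A u) \<le> 0"
  proof (rule le_zero_if_small_upper_bounds)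
    fix e :: real assume e: "0 < e"
    \<comment> \<open>The final error is at most \<open>2 * norm u\<close>, a bound for \<open>1 / t\<close>, times \<open>norm k\<close>, and this is less
      than \<open>K * d\<close>; the summand \<open>1\<close> only makes \<open>K\<close> positive.\<close>
    define K where "K = 2 * norm u * (norm P * norm A * 2 + norm P) + 1"
    have K: "0 < K" unfolding K_def by (intro add_nonneg_pos mult_nonneg_nonneg add_nonneg_nonneg) auto
    define d where "d = min (1/4) (e / K)"
    have d: "0 < d" "d \<le> 1/4" "K * d \<le> e" using e K by (auto simp: d_def min_def field_simps)
    have "\<forall>\<^sub>F l in at_right r. dist ((l - r) ^ m *\<^sub>R RB l) P < d" using lim d(1) by (rule tendstoD)
    hence "\<forall>\<^sub>F l in at_right r. r < l \<and> norm ((l - r) *\<^sub>R RB l - P) < d"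
      using eventually_at_right_less[of r] by eventually_elim (simp add: m1 dist_norm)
    then obtain l where l: "r < l" "norm ((l - r) *\<^sub>R RB l - P) < d"
      using eventually_happens'[OF trivial_limit_at_right_real] by blast
    have NA: "0 < norm (RA l) + 1" by (simp add: add_nonneg_pos)
    \<comment> \<open>\<open>l\<close> is fixed before \<open>x\<close>, so the defect of \<open>x\<close> can be chosen small relative to \<open>norm (RA l)\<close>.\<close>
    define a where "a = min d (d / (norm (RA l) + 1))"
    have a: "0 < a" "a \<le> d" using d NA by (auto simp: a_def)
    have aN: "norm (RA l) * a \<le> d"
    proof -
      have "norm (RA l) * a \<le> (norm (RA l) + 1) * a" using a by (intro mult_right_mono) auto
      also have "\<dots> \<le> (norm (RA l) + 1) * (d / (norm (RA l) + 1))"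
        using NA by (intro mult_left_mono) (auto simp: a_def)
      finally show ?thesis using NA by simp
    qed
    obtain x where x: "0 \<le> x" "norm x = 1" "norm (A x - r *\<^sub>R x) \<le> a"
      by (rule positive_approximate_eigenvector[OF RA gap a(1)]) iprover
    define h where "h = ((l - r) *\<^sub>R RB l - P) x + RA l (r *\<^sub>R x - A x)"
    have nh: "norm h \<le> 2 * d"
    proof -
      have "norm (((l - r) *\<^sub>R RB l - P) x) \<le> d"
        using norm_blinfun[of "(l - r) *\<^sub>R RB l - P" x] x l by simp
      moreover have "norm (RA l (r *\<^sub>R x - A x)) \<le> norm (RA l) * a"
        using norm_blinfun[of "RA l" "r *\<^sub>R x - A x"] x(3)
          mult_left_mono[of "norm (r *\<^sub>R x - A x)" a "norm (RA l)"] by (simp add: norm_minus_commute)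
      ultimately show ?thesis unfolding h_def using aN norm_triangle_ineq by (smt (verit))
    qed
    have xle: "x \<le> P x + h"
    proof -
      have "x = (l - r) *\<^sub>R RA l x + RA l (r *\<^sub>R x - A x)"
        using resolvent_opD(1)[of A l "RA l" x] RA[OF l(1)] by (simp add: blinfun.bilinear_simps algebra_simps)
      also have "\<dots> \<le> (l - r) *\<^sub>R RB l x + RA l (r *\<^sub>R x - A x)"
        using resolvent_op_mono(2)[OF AB _ _ _ _ x(1), of "RA l" l "RB l"] RA[OF l(1)] RB[OF l(1)] l(1)
        by (intro add_right_mono scaleR_left_mono) auto
      finally show ?thesis by (simp add: h_def blinfun.bilinear_simps)
    qed
    obtain t where t: "P x = t *\<^sub>R u" using one_dim by blast
    have t0: "0 \<le> t"
    proof (rule ccontr)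
      assume "\<not> 0 \<le> t"
      hence "0 \<le> (- t) *\<^sub>R u" using u(1) by (intro scaleR_nonneg_nonneg) auto
      moreover have "0 \<le> t *\<^sub>R u" using positive_op_nonneg[OF pP x(1)] t by simp
      ultimately have "t *\<^sub>R u = 0" by simp
      thus False using u(2) \<open>\<not> 0 \<le> t\<close> by simp
    qed
    have tb: "1 / 2 \<le> t * norm u"
    proof -
      have "norm x \<le> norm (P x + h)" using x(1) xle by (rule norm_mono_nonneg)
      also have "\<dots> \<le> norm (P x) + norm h" by (rule norm_triangle_ineq)
      also have "norm (P x) = t * norm u" using t t0 by simp
      finally show ?thesis using nh d(2) x(2) by simp
    qed
    have tpos: "0 < t" using tb nu t0 by (cases "t = 0") auto
    have tinv: "1 / t \<le> 2 * norm u" using tb tpos by (simp add: pos_divide_le_eq mult.commute)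
    define k where "k = P (A h) - P (A x - r *\<^sub>R x)"
    have "P (A x) \<le> P (A (P x + h))" by (intro positive_op_mono[OF pP] positive_op_mono[OF A] xle)
    hence "t *\<^sub>R (r *\<^sub>R u - P (A u)) \<le> k"
      by (simp add: k_def t blinfun.bilinear_simps algebra_simps)
    hence "(1 / t) *\<^sub>R (t *\<^sub>R (r *\<^sub>R u - P (A u))) \<le> (1 / t) *\<^sub>R k" using tpos by (intro scaleR_left_mono) auto
    hence le: "r *\<^sub>R u - P (A u) \<le> (1 / t) *\<^sub>R k" using tpos by simp
    have "norm k \<le> norm P * norm A * (2 * d) + norm P * d"
    proof -
      have "norm (P (A h)) \<le> norm P * (norm A * norm h)"
        by (intro order_trans[OF norm_blinfun] mult_left_mono norm_blinfun) auto
      also have "\<dots> \<le> norm P * (norm A * (2 * d))" by (intro mult_left_mono nh) auto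
      finally have "norm (P (A h)) \<le> norm P * norm A * (2 * d)" by (simp only: mult.assoc)
      moreover have "norm (P (A x - r *\<^sub>R x)) \<le> norm P * d"
        using x(3) a(2) by (intro order_trans[OF norm_blinfun] mult_left_mono) auto
      ultimately show ?thesis unfolding k_def by (intro order_trans[OF norm_triangle_ineq4] add_mono)
    qed
    hence "norm ((1 / t) *\<^sub>R k) \<le> (2 * norm u) * (norm P * norm A * (2 * d) + norm P * d)"
      using tinv tpos by (simp only: norm_scaleR) (intro mult_mono, auto)
    also have "\<dots> = (K - 1) * d" by (simp add: K_def algebra_simps)
    also have "\<dots> \<le> K * d" using d(1) by simp
    finally have "norm ((1 / t) *\<^sub>R k) \<le> e" using d(3) by simp
    thus "\<exists>k. r *\<^sub>R u - P (A u) \<le> k \<and> norm k \<le> e" using le by blast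
  qed
  moreover have "P ((B - A) u) = r *\<^sub>R u - P (A u)" by (simp add: blinfun.bilinear_simps u)
  moreover have "0 \<le> P ((B - A) u)" by (intro positive_op_nonneg[OF pP] positive_op_nonneg[OF AB] u)
  ultimately have "P ((B - A) u) = 0" by (intro antisym) auto
  hence "(B - A) u = 0" by (rule strict[OF positive_op_nonneg[OF AB u(1)]])
  moreover have "weak_unit u" using u by (intro irreducible_weak_unit[OF B, of _ r]) auto
  moreover have "sigma_order_continuous (B - A)"
    by (rule sigma_oc_dominated[OF B(2) AB]) (use A in simp)
  ultimately have "B - A = 0" using weak_unit_sigma_oc_eq_0 by blast
  thus ?thesis by simp
qed

section \<open>Comparison when the smaller operator has a pole\<close>

text \<open>
  Suppose \<open>B - A \<noteq> 0\<close>. If \<open>Q (B - A)\<close> were zero, then \<open>Q B = r Q\<close> would make \<open>Q\<close> strictly positive and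
  \<open>B - A\<close> zero. So \<open>K = Q (B - A) (RB b)\<close> kills no nonzero positive vector, as \<open>RB b\<close> produces weak units. On
  the finite-dimensional range of \<open>Q\<close> compactness gives \<open>\<delta> > 0\<close> with \<open>\<delta> * norm x \<le> norm (K x)\<close> for
  positive \<open>x\<close>, and the powers of a positive \<open>H\<close> close to \<open>K\<close> still decay at most like \<open>(\<delta> / 2) ^ n\<close>.
  For \<open>l\<close> close to \<open>r\<close> take \<open>H = (l - r) ^ m *\<^sub>R G\<close> with \<open>G = RA l (B - A) (RB b)\<close>. From
  \<open>RA l (B - A) (RB l) = RB l - RA l\<close> and \<open>RB b (RB l) \<le> RB l\<close> one obtains \<open>G (RB l) \<le> RB l\<close>, so the
  powers of \<open>G\<close> are bounded and those of \<open>H\<close> decay at least like \<open>(\<delta> / 4) ^ n\<close>.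
\<close>

theorem eq_if_finite_rank_pole_of_smaller:
  fixes A B Q :: "'a::banach_lattice \<Rightarrow>\<^sub>L 'a"
  assumes A: "positive_op A" and AB: "positive_op (B - A)"
    and B: "band_irreducible B" "sigma_order_continuous B" and r: "0 < r"
    and RA: "\<And>l. r < l \<Longrightarrow> positive_op (RA l) \<and> resolvent_op A l (RA l)"
    and RB: "\<And>l. r < l \<Longrightarrow> positive_op (RB l) \<and> resolvent_op B l (RB l)" and m: "0 < m"
    and lim: "((\<lambda>l. (l - r) ^ m *\<^sub>R RA l) \<longlongrightarrow> Q) (at_right r)"
    and Q: "sigma_order_continuous Q" "Q \<noteq> 0"
    and F: "finite F" "range (blinfun_apply Q) \<subseteq> span F"
  shows "A = B"
proof (rule ccontr)
  assume "A \<noteq> B"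
  hence D0: "B - A \<noteq> 0" by simp
  have pB: "positive_op B" and pQ: "positive_op Q" using B Q by (auto intro: sigma_oc_positive)
  have RA': "\<And>l. r < l \<Longrightarrow> resolvent_op A l (RA l)" using RA by blast
  note eig = leading_coefficient_eigen[OF RA' m lim]
  \<comment> \<open>Later \<open>l < r + 1\<close>, so that \<open>1 \<le> b - l\<close> and \<open>RB b (RB l x) \<le> RB l x\<close> without a factor.\<close>
  define b where "b = r + 2"
  have b: "r < b" by (simp add: b_def)
  note Rb = RB[OF b]
  have sigma_oc_diff: "sigma_order_continuous (B - A)" by (rule sigma_oc_dominated[OF B(2) AB]) (use A in simp)
  have QD0: "Q o\<^sub>L (B - A) \<noteq> 0"
  proof
    assume "Q o\<^sub>L (B - A) = 0"
    hence QD: "Q ((B - A) x) = 0" for x by (metis blinfun_apply_blinfun_compose zero_blinfun.rep_eq)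
    hence QB: "Q (B x) = r *\<^sub>R Q x" for x using eig(2)[of x] QD[of x] by (simp add: blinfun.bilinear_simps)
    have "(B - A) x = 0" if "0 \<le> x" for x
      using left_eigenoperator_strictly_positive[OF B _ _ b Q QB positive_op_nonneg[OF AB that] QD] Rb by blast
    thus False using positive_op_eq_0[OF AB] D0 by blast
  qed
  define T where "T = (B - A) o\<^sub>L RB b"
  define K where "K = Q o\<^sub>L T"
  have pT: "positive_op T" and pK: "positive_op K"
    unfolding K_def T_def using Rb AB pQ by (auto intro: positive_op_compose)
  have Kpos: "K x \<noteq> 0" if x: "0 \<le> x" "x \<noteq> 0" for x
  proof
    assume "K x = 0"
    hence "(Q o\<^sub>L (B - A)) (RB b x) = 0" by (simp add: K_def T_def)
    moreover have "weak_unit (RB b x)" using Rb by (intro resolvent_weak_unit[OF B _ _ x]) auto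
    ultimately show False using weak_unit_sigma_oc_eq_0[OF _ sigma_oc_compose[OF Q(1) sigma_oc_diff]] QD0 by blast
  qed
  have KF: "K x \<in> span F" for x using F(2) by (auto simp: K_def)
  obtain \<delta> where \<delta>: "0 < \<delta>" "\<And>x. x \<in> span F \<Longrightarrow> 0 \<le> x \<Longrightarrow> \<delta> * norm x \<le> norm (K x)"
    by (rule finite_dim_bounded_below[OF F(1), of K]) (use Kpos in blast)+
  \<comment> \<open>The invariant of the iteration is \<open>norm z \<le> M * norm (K z)\<close>: it makes the error \<open>(H - K) z\<close> small
    relative to \<open>norm (K z)\<close>, and \<open>\<eta>\<close> is small enough for the invariant to reproduce itself.\<close>
  define M where "M = 4 / \<delta>"
  have M: "0 < M" using \<delta> by (simp add: M_def)
  define \<eta> where "\<eta> = min (1 / M) (\<delta> / (2 * (norm K + 1) * M))"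
  have NK: "0 < norm K + 1" by (simp add: add_nonneg_pos)
  have \<eta>: "0 < \<eta>" "\<eta> * M \<le> 1" "\<eta> * norm K * M \<le> \<delta> / 2"
  proof -
    show "0 < \<eta>" unfolding \<eta>_def using M \<delta> NK by simp
    have "\<eta> * M \<le> (1 / M) * M" using M by (intro mult_right_mono) (auto simp: \<eta>_def)
    thus "\<eta> * M \<le> 1" using M by simp
    have "\<eta> * norm K * M \<le> \<eta> * ((norm K + 1) * M)"
      using M \<open>0 < \<eta>\<close> by (simp add: algebra_simps)
    also have "\<dots> \<le> (\<delta> / (2 * (norm K + 1) * M)) * ((norm K + 1) * M)"
      using M NK by (intro mult_right_mono) (auto simp: \<eta>_def)
    also have "\<dots> = \<delta> / 2"
    proof -
      have "(\<delta> / (2 * N * M)) * (N * M) = \<delta> / 2" if "0 < N" for N using that M by simp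
      thus ?thesis using NK .
    qed
    finally show "\<eta> * norm K * M \<le> \<delta> / 2" .
  qed
  have limK: "((\<lambda>l. ((l - r) ^ m *\<^sub>R RA l) o\<^sub>L T) \<longlongrightarrow> K) (at_right r)"
    unfolding K_def by (intro bounded_bilinear.tendsto[OF bounded_bilinear_blinfun_compose] lim tendsto_const)
  have "\<forall>\<^sub>F l in at_right r. dist (((l - r) ^ m *\<^sub>R RA l) o\<^sub>L T) K < \<eta>"
    by (rule tendstoD[OF limK \<eta>(1)])
  moreover have "\<forall>\<^sub>F l in at_right r. (l - r) ^ m < \<delta> / 4"
  proof (rule order_tendstoD)
    have "((\<lambda>l. (l - r) ^ m) \<longlongrightarrow> (r - r) ^ m) (at_right r)" by (intro tendsto_intros)
    thus "((\<lambda>l. (l - r) ^ m) \<longlongrightarrow> 0) (at_right r)" using m by (simp add: power_0_left)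
  qed (use \<delta> in simp)
  moreover have "\<forall>\<^sub>F l in at_right r. l \<in> {r<..<r + 1}" by (rule eventually_at_right_real) simp
  ultimately have "\<forall>\<^sub>F l in at_right r. norm ((((l - r) ^ m *\<^sub>R RA l) o\<^sub>L T) - K) < \<eta> \<and> (l - r) ^ m < \<delta> / 4 \<and> r < l \<and> l < r + 1"
    by eventually_elim (simp add: dist_norm)
  then obtain l where l: "norm ((((l - r) ^ m *\<^sub>R RA l) o\<^sub>L T) - K) < \<eta>" "(l - r) ^ m < \<delta> / 4" "r < l" "l < r + 1"
    using eventually_happens'[OF trivial_limit_at_right_real] by blast
  note RAl = RA[OF l(3)] and RBl = RB[OF l(3)]
  define G where "G = RA l o\<^sub>L T"
  define H where "H = (l - r) ^ m *\<^sub>R G"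
  have pG: "positive_op G" unfolding G_def using RAl pT by (auto intro: positive_op_compose)
  have H: "norm (H - K) \<le> \<eta>" "positive_op H"
  proof -
    have "H = ((l - r) ^ m *\<^sub>R RA l) o\<^sub>L T" by (intro blinfun_eqI) (simp add: H_def G_def blinfun.bilinear_simps)
    thus "norm (H - K) \<le> \<eta>" using l by simp
    show "positive_op H" unfolding H_def using l pG by (intro positive_op_scaleR) auto
  qed
  have G1: "G (RB l x) \<le> RB l x" if x: "0 \<le> x" for x
  proof -
    let ?y = "RB l x"
    have y0: "0 \<le> ?y" using RBl x by (auto intro: positive_op_nonneg)
    have yb: "RB b ?y \<le> ?y"
    proof -
      have eq: "RB l x - RB b x = (b - l) *\<^sub>R RB l (RB b x)"
        "RB b x - RB l x = (l - b) *\<^sub>R RB b (RB l x)"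
        using resolvent_identity[of B l "RB l" b "RB b" x] resolvent_identity[of B b "RB b" l "RB l" x] RBl Rb by auto
      have "?y = RB b x + (b - l) *\<^sub>R RB b ?y" using eq(2) by (simp add: algebra_simps)
      moreover have "0 \<le> RB b x" using Rb x by (auto intro: positive_op_nonneg)
      ultimately have "(b - l) *\<^sub>R RB b ?y \<le> ?y" by (metis add_increasing order_refl)
      moreover have "1 *\<^sub>R RB b ?y \<le> (b - l) *\<^sub>R RB b ?y"
        using l(4) Rb y0 by (intro scaleR_right_mono) (auto intro: positive_op_nonneg simp: b_def)
      ultimately show ?thesis by simp
    qed
    have "G ?y = RA l ((B - A) (RB b ?y))" by (simp add: G_def T_def)
    also have "\<dots> \<le> RA l ((B - A) ?y)" using RAl by (intro positive_op_mono AB yb) auto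
    also have "\<dots> = ?y - RA l x" using resolvent_op_mono(1)[OF AB, of "RA l" l "RB l" x] RAl RBl by simp
    also have "\<dots> \<le> ?y" using RAl x by (simp add: positive_op_nonneg)
    finally show ?thesis .
  qed
  have GN: "op_power G n (RB l x) \<le> RB l x" if x: "0 \<le> x" for n x
  proof (induction n)
    case (Suc n)
    have "op_power G (Suc n) (RB l x) \<le> G (RB l x)" using positive_op_mono[OF pG Suc] by simp
    also have "\<dots> \<le> RB l x" using G1[OF x] .
    finally show ?case .
  qed simp
  have Gbound: "op_power G n x \<le> l *\<^sub>R RB l x" if x: "0 \<le> x" for n x
  proof -
    have "x \<le> l *\<^sub>R RB l x" using resolvent_op_ge(1)[OF pB _ _ x, of "RB l" l] RBl by blast
    hence "op_power G n x \<le> op_power G n (l *\<^sub>R RB l x)" by (intro positive_op_mono positive_op_op_power pG)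
    also have "\<dots> = l *\<^sub>R op_power G n (RB l x)" by (simp add: blinfun.bilinear_simps)
    also have "\<dots> \<le> l *\<^sub>R RB l x" using GN[OF x] l r by (intro scaleR_left_mono) auto
    finally show ?thesis .
  qed
  obtain w where w: "0 \<le> w" "Q w \<noteq> 0" using positive_op_eq_0[OF pQ] Q(2) by blast
  define x where "x = Q w"
  have x: "0 \<le> x" "x \<noteq> 0" "x \<in> span F" using w F(2) pQ by (auto simp: x_def positive_op_nonneg)
  define z where "z n = op_power H n x" for n
  have z0: "0 \<le> z n" for n unfolding z_def by (intro positive_op_nonneg positive_op_op_power H x)
  have zs: "z (Suc n) = H (z n)" for n by (simp add: z_def)
  have inv: "norm (z n) \<le> M * norm (K (z n)) \<and> (\<delta> / 2) ^ n * norm (K x) \<le> norm (K (z n))" for n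
  proof (induction n)
    case 0
    have "norm x \<le> (1 / \<delta>) * norm (K x)" using \<delta>(2)[OF x(3,1)] \<delta>(1) by (simp add: field_simps)
    also have "\<dots> \<le> M * norm (K x)" using \<delta>(1) by (intro mult_right_mono) (auto simp: M_def field_simps)
    finally show ?case by (simp add: z_def)
  next
    case (Suc n)
    let ?k = "norm (K (z n))"
    have diff: "norm (z (Suc n) - K (z n)) \<le> \<eta> * norm (z n)"
      using norm_blinfun[of "H - K" "z n"] mult_right_mono[OF H(1) norm_ge_zero[of "z n"]]
      by (simp add: zs blinfun.bilinear_simps)
    have zk: "\<eta> * norm (z n) \<le> \<eta> * (M * ?k)" using Suc \<eta>(1) by (intro mult_left_mono) auto
    have up: "norm (z (Suc n)) \<le> 2 * ?k"
    proof -
      have "norm (z (Suc n)) \<le> ?k + norm (z (Suc n) - K (z n))" by (rule norm_triangle_sub)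
      also have "\<dots> \<le> ?k + \<eta> * M * ?k" using diff zk by simp
      also have "\<eta> * M * ?k \<le> 1 * ?k" using \<eta>(2) by (intro mult_right_mono) auto
      finally show ?thesis by simp
    qed
    have low: "\<delta> / 2 * ?k \<le> norm (K (z (Suc n)))"
    proof -
      have "\<delta> * ?k \<le> norm (K (K (z n)))" by (intro \<delta>(2) KF positive_op_nonneg[OF pK] z0)
      also have "\<dots> \<le> norm (K (z (Suc n))) + norm (K (K (z n)) - K (z (Suc n)))" by (rule norm_triangle_sub)
      also have "K (K (z n)) - K (z (Suc n)) = K (K (z n) - z (Suc n))" by (simp add: blinfun.bilinear_simps)
      also have "norm \<dots> \<le> norm K * norm (K (z n) - z (Suc n))" by (rule norm_blinfun)
      also have "\<dots> \<le> norm K * (\<eta> * (M * ?k))"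
        using diff zk by (intro mult_left_mono) (auto simp: norm_minus_commute)
      also have "\<dots> = (\<eta> * norm K * M) * ?k" by simp
      also have "\<dots> \<le> \<delta> / 2 * ?k" using \<eta>(3) by (intro mult_right_mono) auto
      finally show ?thesis by simp
    qed
    have "norm (z (Suc n)) \<le> M * norm (K (z (Suc n)))"
    proof -
      have "2 * ?k = M * (\<delta> / 2 * ?k)" using \<delta>(1) by (simp add: M_def)
      also have "\<dots> \<le> M * norm (K (z (Suc n)))" using low M by (intro mult_left_mono) auto
      finally show ?thesis using up by simp
    qed
    moreover have "(\<delta> / 2) ^ Suc n * norm (K x) \<le> norm (K (z (Suc n)))"
    proof -
      have "(\<delta> / 2) ^ Suc n * norm (K x) = \<delta> / 2 * ((\<delta> / 2) ^ n * norm (K x))" by simp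
      also have "\<dots> \<le> \<delta> / 2 * ?k" using Suc \<delta>(1) by (intro mult_left_mono) auto
      finally show ?thesis using low by simp
    qed
    ultimately show ?case by blast
  qed
  define c where "c = norm K * norm (l *\<^sub>R RB l x)"
  have "(\<delta> / 2) ^ n * norm (K x) \<le> (\<delta> / 4) ^ n * c" for n
  proof -
    have "norm (z n) = ((l - r) ^ m) ^ n * norm (op_power G n x)"
      using l(3) by (simp add: z_def H_def op_power_scaleR blinfun.bilinear_simps)
    also have "\<dots> \<le> (\<delta> / 4) ^ n * norm (l *\<^sub>R RB l x)"
      using l(2,3) x(1) Gbound[OF x(1)] \<delta>(1)
      by (intro mult_mono power_mono norm_mono_nonneg positive_op_nonneg positive_op_op_power pG) auto
    finally have "norm (z n) \<le> (\<delta> / 4) ^ n * norm (l *\<^sub>R RB l x)" .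
    hence "norm K * norm (z n) \<le> norm K * ((\<delta> / 4) ^ n * norm (l *\<^sub>R RB l x))" by (intro mult_left_mono) auto
    moreover have "norm (K (z n)) \<le> norm K * norm (z n)" by (rule norm_blinfun)
    ultimately show ?thesis using inv[of n] by (simp add: c_def mult_ac)
  qed
  hence "2 ^ n * norm (K x) \<le> c" for n
  proof -
    have "(\<delta> / 4) ^ n * (2 ^ n * norm (K x)) = (\<delta> / 2) ^ n * norm (K x)"
      by (simp add: mult.assoc[symmetric] power_mult_distrib[symmetric])
    also have "\<dots> \<le> (\<delta> / 4) ^ n * c" by fact
    finally show ?thesis using \<delta>(1) by simp
  qed
  hence "2 ^ n \<le> c / norm (K x)" for n using Kpos[OF x(1,2)] by (simp add: pos_le_divide_eq)
  moreover obtain n where "c / norm (K x) < 2 ^ n" using real_arch_pow[of 2 "c / norm (K x)"] by auto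
  ultimately show False by (meson not_less)
qed

section \<open>The comparison theorem\<close>

theorem theorem9:
  fixes A B :: "'a::banach_lattice \<Rightarrow>\<^sub>L 'a"
  assumes "positive_op A" and "positive_op B" and "positive_op (B - A)"
    and "band_irreducible B"
    and "spectral_radius A = spectral_radius B" and "spectral_radius B > 0"
    and "(is_norm (lorentz_seminorm :: 'a \<Rightarrow> real) \<and> sigma_order_continuous B \<and>
            is_resolvent_pole B (of_real (spectral_radius B)))
       \<or> (is_norm (lorentz_seminorm :: 'a \<Rightarrow> real) \<and> sigma_order_continuous B \<and>
            is_resolvent_pole A (of_real (spectral_radius A)) \<and>
            complex_finite_dim (spectral_subspace A (of_real (spectral_radius A))))
       \<or> (weakly_compact_op B \<and> sigma_order_continuous B \<and>
            is_resolvent_pole B (of_real (spectral_radius B)))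
       \<or> (band_irreducible A \<and> weakly_compact_op A \<and>
            is_resolvent_pole A (of_real (spectral_radius A)) \<and> sigma_order_continuous B)"
  shows "A = B"
proof (cases "\<exists>x::'a. x \<noteq> 0")
  case False
  hence zero: "x = 0" for x :: 'a by blast
  have "A x = B x" for x using zero[of "A x"] zero[of "B x"] by simp
  thus ?thesis by (intro blinfun_eqI)
next
  case nontriv: True
  define r where "r = spectral_radius B"
  have r: "0 < r" and rA: "spectral_radius A = r" using assms(5,6) by (auto simp: r_def)
  have sigma_oc_B: "sigma_order_continuous B" using assms(7) by blast
  have sigma_oc_A: "sigma_order_continuous A" by (rule sigma_oc_dominated[OF sigma_oc_B assms(1,3)])
  have rA0: "0 < spectral_radius A" using r rA by simp
  note specA = positive_op_resolvent[OF assms(1) nontriv rA0, unfolded rA]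
  note specB = positive_op_resolvent[OF assms(2) nontriv assms(6), folded r_def]
  obtain RA where RA: "\<And>l. r < l \<Longrightarrow> positive_op (RA l) \<and> resolvent_op A l (RA l)"
    using specA(1) by metis
  obtain RB where RB: "\<And>l. r < l \<Longrightarrow> positive_op (RB l) \<and> resolvent_op B l (RB l)"
    using specB(1) by metis
  have RA': "\<And>l. r < l \<Longrightarrow> resolvent_op A l (RA l)" and RB': "\<And>l. r < l \<Longrightarrow> resolvent_op B l (RB l)"
    using RA RB by blast+
  have gap: "1 \<le> (l - r) * norm (RA l)" if "r < l" for l by (rule specA(2)[OF that RA'[OF that]])
  show ?thesis
  proof (cases "is_resolvent_pole B (of_real r) \<and> (is_norm (lorentz_seminorm :: 'a \<Rightarrow> real) \<or> weakly_compact_op B)")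
    case True
    obtain m P where m: "0 < m" and P: "P \<noteq> 0" "positive_op P"
      and lim: "((\<lambda>l. (l - r) ^ m *\<^sub>R RB l) \<longlongrightarrow> P) (at_right r)"
    proof (rule resolvent_pole_leading_coefficient[OF RB conjunct1[OF True]])
      fix m P assume "0 < m" "P \<noteq> 0" "positive_op P" "((\<lambda>l. (l - r) ^ m *\<^sub>R RB l) \<longlongrightarrow> P) (at_right r)"
      thus thesis by (rule that)
    qed
    have "sigma_order_continuous P"
      using True
    proof (elim conjE disjE)
      assume "is_norm (lorentz_seminorm :: 'a \<Rightarrow> real)"
      thus ?thesis using leading_coefficient_sigma_oc_lorentz[OF _ sigma_oc_B RB r lim] by blast
    next
      assume "weakly_compact_op B"
      thus ?thesis
        using sigma_oc_if_weakly_compact_factor[OF _ sigma_oc_B P(2) leading_coefficient_eigen(2)[OF RB' m lim] r] by blast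
    qed
    from eq_if_pole_of_larger[OF assms(1,3,4) sigma_oc_B r RA RB gap m lim this P(1)] show ?thesis .
  next
    case False
    hence poleA: "is_resolvent_pole A (of_real r)" using assms(7) rA r_def by auto
    obtain m Q where m: "0 < m" and Q: "Q \<noteq> 0" "positive_op Q"
      and lim: "((\<lambda>l. (l - r) ^ m *\<^sub>R RA l) \<longlongrightarrow> Q) (at_right r)"
      and fin: "complex_finite_dim (spectral_subspace A (of_real r)) \<Longrightarrow>
        \<exists>F. finite F \<and> range (blinfun_apply Q) \<subseteq> span F"
    proof (rule resolvent_pole_leading_coefficient[OF RA poleA])
      fix m Q assume "0 < m" "Q \<noteq> 0" "positive_op Q" "((\<lambda>l. (l - r) ^ m *\<^sub>R RA l) \<longlongrightarrow> Q) (at_right r)"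
        "complex_finite_dim (spectral_subspace A (of_real r)) \<Longrightarrow> \<exists>F. finite F \<and> range (blinfun_apply Q) \<subseteq> span F"
      thus thesis by (rule that)
    qed
    have "sigma_order_continuous Q \<and> (\<exists>F. finite F \<and> range (blinfun_apply Q) \<subseteq> span F)"
    proof (cases "is_norm (lorentz_seminorm :: 'a \<Rightarrow> real) \<and> complex_finite_dim (spectral_subspace A (of_real r))")
      case True
      thus ?thesis using leading_coefficient_sigma_oc_lorentz[OF _ sigma_oc_A RA r lim] fin by blast
    next
      case no: False
      hence A: "band_irreducible A" "weakly_compact_op A" using assms(7) False rA r_def by auto
      have sigma_oc_Q: "sigma_order_continuous Q"
        by (rule sigma_oc_if_weakly_compact_factor[OF A(2) sigma_oc_A Q(2) leading_coefficient_eigen(2)[OF RA' m lim] r])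
      obtain u where u: "\<And>x. \<exists>t. Q x = t *\<^sub>R u"
      proof (rule irreducible_leading_coefficient[OF A(1) sigma_oc_A r RA m lim sigma_oc_Q Q(1)])
        fix u assume "\<And>x. \<exists>t. Q x = t *\<^sub>R u"
        thus thesis by (rule that)
      qed
      have "Q x \<in> span {u}" for x using u[of x] by (auto simp: span_singleton)
      thus ?thesis using sigma_oc_Q by (intro conjI exI[of _ "{u}"]) auto
    qed
    then obtain F where "sigma_order_continuous Q" "finite F" "range (blinfun_apply Q) \<subseteq> span F" by blast
    thus ?thesis by (intro eq_if_finite_rank_pole_of_smaller[OF assms(1,3,4) sigma_oc_B r RA RB m lim _ Q(1)])
  qed
qed

end
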